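(* Consider the $d$-dimensional renewal model with $r$ heterogeneous claim types described in the context. Assume that for some $\alpha>1$, $\overline{F_k^j}\in\mathcal{RV}_{-\alpha}$ for all $1\le k\le d$, $1\le j\le r$; that there is a distribution function $F$ such that for all $1\le k\le d$, $1\le j\le r$, $\overline{F_k^j}(x)\sim a_k^j\overline F(x)$ as $x\to\infty$ for some constant $a_k^j>0$; and that there is some $\alpha^*>\alpha$ such that $\phi(\alpha^* )<0$. Put $$l_k(t)=\sum_{j=1}^ra_k^j\int_{0-}^te^{s\phi(\alpha)}\,\mathrm{d}\lambda_{k,s}^j,\qquad1\le k\le d.$$ Then for every $1\le k\le d$ and any fixed $T\in\Lambda$, as $q\uparrow1$, it holds uniformly for all $t\in\Lambda^T=\Lambda\cap[T,\infty]$ that $$\mathrm{SES}_{q,k}(D_t)\sim\frac{l_k(t)}{\sum_{i=1}^dl_i(t)}\left(\Big(\sum_{i=1}^dl_i(t)\Big)^{\frac1\alpha}-\big(l_k(t)\big)^{\frac1\alpha}+\frac{\big(\sum_{i=1}^dl_i(t)\big)^{\frac1\alpha}}{\alpha-1}\right)F^{\gets}(q),$$ $$\mathrm{MES}_{q,k}(D_t)\sim\frac{\alpha}{\alpha-1}\,\frac{l_k(t)}{\big(\sum_{i=1}^dl_i(t)\big)^{1-\frac1\alpha}}\,F^{\gets}(q).$$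
   Context: Model. Let $d,r\ge1$ be integers. For $1\le k\le d$ (business line), $1\le j\le r$ (claim type), the nonnegative random variables $\{X_{ki}^j;i\ge1\}$ (claim sizes) have common distribution function $F_k^j$. All the variables $\{X_{ki}^j;\,i\ge1,1\le k\le d,1\le j\le r\}$ are pairwise asymptotically independent (PAI): any two distinct ones are asymptotically independent. Here two nonnegative unbounded random variables $Y_1,Y_2$ with distributions $G_1,G_2$ are asymptotically independent if $\lim_{x\to\infty}\mathbb{P}(Y_1>U_1(x),Y_2>U_2(x))/\mathbb{P}(Y_1>U_1(x))=0$, where $U_i=(1/\overline{G_i})^{\gets}$ and $g^{\gets}(x)=\inf\{y:g(y)\ge x\}$. For each $k$, $\{(\theta_{ki}^1,\dots,\theta_{ki}^r);i\ge1\}$ is an i.i.d. sequence of nonnegative random vectors, with arbitrary dependence among the components of each vector; each $\theta_{ki}^j$ is not almost surely $0$. Put $\tau_{ki}^j=\sum_{h=1}^i\theta_{kh}^j$, $\tau_{k0}^j=0$, $N_{k,t}^j=\sup\{m\ge0:\tau_{km}^j\le t\}$ and $\lambda_{k,t}^j=\mathbb{E}[N_{k,t}^j]=\sum_{i\ge1}\mathbb{P}(\tau_{ki}^j\le t)$. $\{R_t\}_{t\ge0}$ is a real-valued càdlàg Lévy process with $\mathbb{E}[R_1]>0$ and Laplace exponent $\phi(a)=\log\mathbb{E}[e^{-aR_1}]$. The family of all claim sizes, the inter-arrival vector sequences of the different business lines, and the process $\{R_t\}$ are mutually independent. With constants $c_k>0$, for $0\le t\le\infty$, $$Z_{k,t}=\sum_{j=1}^r\sum_{i=1}^\infty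 X_{ki}^je^{-R_{\tau_{ki}^j}}\mathbf{1}_{\{\tau_{ki}^j\le t\}}-c_k\int_0^te^{-R_s}\mathrm{d}s,\qquad D_t=\sum_{k=1}^dZ_{k,t}.$$ Let $\Lambda=\{t\in[0,\infty]:0<\lambda_{k,t}^j\le\infty\text{ for all }1\le k\le d,1\le j\le r\}$ (so $\infty\in\Lambda$). The integral $\int_{0-}^t$ includes a possible atom at $0$: $\int_{0-}^te^{s\phi(\alpha)}\mathrm{d}\lambda_{k,s}^j=\sum_{i\ge1}\mathbb{E}[e^{\phi(\alpha)\tau_{ki}^j}\mathbf{1}_{\{\tau_{ki}^j\le t\}}]$. Risk measures. For $0<q<1$, $\mathrm{VaR}_q(X)=F_X^{\gets}(q)=\inf\{y\in\mathbb{R}:F_X(y)\ge q\}$, and likewise $F^{\gets}(q)=\inf\{y:F(y)\ge q\}$. With $x^+=\max\{x,0\}$, $$\mathrm{SES}_{q,k}(D_t)=\mathbb{E}\big[(Z_{k,t}-\mathrm{VaR}_q(Z_{k,t}))^+\mid D_t>\mathrm{VaR}_q(D_t)\big],\quad \mathrm{MES}_{q,k}(D_t)=\mathbb{E}\big[Z_{k,t}\mid D_t>\mathrm{VaR}_q(D_t)\big].$$ Notation. $\overline F=1-F$; $\overline F\in\mathcal{RV}_{-\alpha}$ means $\lim_{x\to\infty}\overline F(yx)/\overline F(x)=y^{-\alpha}$ for all $y>0$. $f(q,t)\sim g(q,t)$ uniformly for $t\in\Delta$ as $q\uparrow1$ means $\lim_{q\uparrow1}\sup_{t\in\Delta}|f(q,t)/g(q,t)-1|=0$.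 *)

theory Defs
  imports "HOL-Probability.Probability" "HOL-Library.Landau_Symbols"
begin

section \<open>Distribution functions, quantiles and tails\<close>

definition distribution_function :: "(real \<Rightarrow> real) \<Rightarrow> bool" where
  "distribution_function F \<longleftrightarrow> (\<exists>N. real_distribution N \<and> F = cdf N)"

definition df :: "'a measure \<Rightarrow> ('a \<Rightarrow> real) \<Rightarrow> real \<Rightarrow> real" where
  "df M Y = cdf (distr M borel Y)"

definition gen_inverse :: "(real \<Rightarrow> real) \<Rightarrow> real \<Rightarrow> real" where
  "gen_inverse g x = Inf {y. g y \<ge> x}"

definition tail :: "(real \<Rightarrow> real) \<Rightarrow> real \<Rightarrow> real" where
  "tail F x = 1 - F x"

definition regularly_varying :: "real \<Rightarrow> (real \<Rightarrow> real) \<Rightarrow> bool" where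
  "regularly_varying \<rho> f \<longleftrightarrow> (\<forall>y>0. ((\<lambda>x. f (y * x) / f x) \<longlongrightarrow> y powr \<rho>) at_top)"

text \<open>Only meant for nonnegative unbounded variables, for which the tails below never vanish
  (so no division by 0 occurs) and the infimum is over a nonempty set, bounded below once \<open>x > 1\<close>.\<close>

definition asymptotically_independent ::
    "'a measure \<Rightarrow> ('a \<Rightarrow> real) \<Rightarrow> ('a \<Rightarrow> real) \<Rightarrow> bool" where
  "asymptotically_independent M Y1 Y2 \<longleftrightarrow>
    (let U1 = gen_inverse (\<lambda>y. 1 / tail (df M Y1) y);
         U2 = gen_inverse (\<lambda>y. 1 / tail (df M Y2) y)
     in ((\<lambda>x. measure M {\<omega> \<in> space M. Y1 \<omega> > U1 x \<and> Y2 \<omega> > U2 x}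
              / measure M {\<omega> \<in> space M. Y1 \<omega> > U1 x}) \<longlongrightarrow> 0) at_top)"


section \<open>Levy processes\<close>

definition cadlag :: "(real \<Rightarrow> real) \<Rightarrow> bool" where
  "cadlag f \<longleftrightarrow> (\<forall>t\<ge>0. (f \<longlongrightarrow> f t) (at_right t)) \<and> (\<forall>t>0. \<exists>l. (f \<longlongrightarrow> l) (at_left t))"

text \<open>Only the times \<open>t \<ge> 0\<close> matter. Stochastic continuity follows from the cadlag paths and the
  stationary increments.\<close>

definition (in prob_space) levy_process :: "(real \<Rightarrow> 'a \<Rightarrow> real) \<Rightarrow> bool" where
  "levy_process R \<longleftrightarrow>
     (\<forall>t\<ge>0. random_variable borel (R t)) \<and>
     (AE \<omega> in M. R 0 \<omega> = 0) \<and>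
     (\<forall>\<omega>\<in>space M. cadlag (\<lambda>t. R t \<omega>)) \<and>
     (\<forall>(n::nat) (t :: nat \<Rightarrow> real). 0 \<le> t 0 \<and> strict_mono t \<longrightarrow>
        indep_vars (\<lambda>_. borel) (\<lambda>i \<omega>. R (t (Suc i)) \<omega> - R (t i) \<omega>) {..<n}) \<and>
     (\<forall>s\<ge>0. \<forall>h\<ge>0.
        distr M borel (\<lambda>\<omega>. R (s + h) \<omega> - R s \<omega>) = distr M borel (\<lambda>\<omega>. R h \<omega> - R 0 \<omega>))"

text \<open>Meaningful where \<open>exp (- a * R\<^sub>1)\<close> is integrable; elsewhere the exponent is infinite, and the
  real value below is just 0.\<close>

definition laplace_exponent :: "'a measure \<Rightarrow> (real \<Rightarrow> 'a \<Rightarrow> real) \<Rightarrow> real \<Rightarrow> real" where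
  "laplace_exponent M R a = ln (\<integral>\<omega>. exp (- a * R 1 \<omega>) \<partial>M)"


section \<open>Renewal quantities\<close>

text \<open>Families are written \<open>X k j i\<close> and \<open>\<theta> k j i\<close> with business line \<open>k\<close>, claim type \<open>j\<close> and
  sequence index \<open>i\<close>, all starting at 1. Time horizons live in \<open>[0,\<infinity>]\<close> and have type \<^typ>\<open>ennreal\<close>;
  arrival times and the time argument of the Levy process are real.\<close>

type_synonym 'a family = "nat \<Rightarrow> nat \<Rightarrow> nat \<Rightarrow> 'a \<Rightarrow> real"

definition arrival :: "'a family \<Rightarrow> 'a family" where
  "arrival \<theta> k j i \<omega> = (\<Sum>h=1..i. \<theta> k j h \<omega>)"

definition claim_count :: "'a family \<Rightarrow> nat \<Rightarrow> nat \<Rightarrow> ennreal \<Rightarrow> 'a \<Rightarrow> ennreal" where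
  "claim_count \<theta> k j t \<omega> = (SUP m \<in> {m. ennreal (arrival \<theta> k j m \<omega>) \<le> t}. of_nat m)"

definition renewal_function :: "'a measure \<Rightarrow> 'a family \<Rightarrow> nat \<Rightarrow> nat \<Rightarrow> ennreal \<Rightarrow> ennreal" where
  "renewal_function M \<theta> k j t = (\<integral>\<^sup>+ \<omega>. claim_count \<theta> k j t \<omega> \<partial>M)"

definition admissible_times :: "'a measure \<Rightarrow> nat \<Rightarrow> nat \<Rightarrow> 'a family \<Rightarrow> ennreal set" where
  "admissible_times M d r \<theta> =
     {t. \<forall>k\<in>{1..d}. \<forall>j\<in>{1..r}. 0 < renewal_function M \<theta> k j t}"

definition upto_time :: "ennreal \<Rightarrow> real set" where
  "upto_time t = {s. 0 \<le> s \<and> ennreal s \<le> t}"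

text \<open>The Lebesgue-Stieltjes measure of the renewal function, which is finite at finite times.
  Extending it by 0 to negative times puts mass \<open>renewal_function M \<theta> k j 0\<close> at the point 0.\<close>

definition renewal_measure :: "'a measure \<Rightarrow> 'a family \<Rightarrow> nat \<Rightarrow> nat \<Rightarrow> real measure" where
  "renewal_measure M \<theta> k j =
     interval_measure (\<lambda>s. if s < 0 then 0 else enn2real (renewal_function M \<theta> k j (ennreal s)))"

definition ell :: "'a measure \<Rightarrow> nat \<Rightarrow> 'a family \<Rightarrow> (real \<Rightarrow> 'a \<Rightarrow> real) \<Rightarrow> real
    \<Rightarrow> (nat \<Rightarrow> nat \<Rightarrow> real) \<Rightarrow> nat \<Rightarrow> ennreal \<Rightarrow> real" where
  "ell M r \<theta> R \<alpha> a k t =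
     (\<Sum>j=1..r. a k j * (LINT s:upto_time t|renewal_measure M \<theta> k j. exp (s * laplace_exponent M R \<alpha>)))"


section \<open>Discounted losses\<close>

text \<open>In the model below the series and the integral converge almost surely, also for \<open>t = \<infinity>\<close>.\<close>

definition line_loss :: "nat \<Rightarrow> 'a family \<Rightarrow> 'a family \<Rightarrow> (real \<Rightarrow> 'a \<Rightarrow> real) \<Rightarrow> (nat \<Rightarrow> real)
    \<Rightarrow> nat \<Rightarrow> ennreal \<Rightarrow> 'a \<Rightarrow> real" where
  "line_loss r X \<theta> R c k t \<omega> =
     (\<Sum>j=1..r. \<Sum>i. X k j (Suc i) \<omega> * exp (- R (arrival \<theta> k j (Suc i) \<omega>) \<omega>)
                    * indicator (upto_time t) (arrival \<theta> k j (Suc i) \<omega>))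
     - c k * (LINT s:upto_time t|lborel. exp (- R s \<omega>))"

definition total_loss :: "nat \<Rightarrow> nat \<Rightarrow> 'a family \<Rightarrow> 'a family \<Rightarrow> (real \<Rightarrow> 'a \<Rightarrow> real) \<Rightarrow> (nat \<Rightarrow> real)
    \<Rightarrow> ennreal \<Rightarrow> 'a \<Rightarrow> real" where
  "total_loss d r X \<theta> R c t \<omega> = (\<Sum>k=1..d. line_loss r X \<theta> R c k t \<omega>)"


section \<open>Risk measures\<close>

definition VaR :: "'a measure \<Rightarrow> real \<Rightarrow> ('a \<Rightarrow> real) \<Rightarrow> real" where
  "VaR M q Y = gen_inverse (df M Y) q"

definition cond_expectation_event :: "'a measure \<Rightarrow> ('a \<Rightarrow> real) \<Rightarrow> 'a set \<Rightarrow> real" where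
  "cond_expectation_event M Y A = (LINT \<omega>:A|M. Y \<omega>) / measure M A"

text \<open>For a component \<open>Z\<close> of the total \<open>D\<close>.\<close>

definition SES :: "'a measure \<Rightarrow> real \<Rightarrow> ('a \<Rightarrow> real) \<Rightarrow> ('a \<Rightarrow> real) \<Rightarrow> real" where
  "SES M q Z D =
     cond_expectation_event M (\<lambda>\<omega>. max (Z \<omega> - VaR M q Z) 0) {\<omega> \<in> space M. D \<omega> > VaR M q D}"

definition MES :: "'a measure \<Rightarrow> real \<Rightarrow> ('a \<Rightarrow> real) \<Rightarrow> ('a \<Rightarrow> real) \<Rightarrow> real" where
  "MES M q Z D = cond_expectation_event M Z {\<omega> \<in> space M. D \<omega> > VaR M q D}"


section \<open>The model\<close>

definition generated_events :: "'a measure \<Rightarrow> ('a \<Rightarrow> real) set \<Rightarrow> 'a set set" where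
  "generated_events M \<Y> = sigma_sets (space M) {Y -` B \<inter> space M | Y B. Y \<in> \<Y> \<and> B \<in> sets borel}"

datatype source = Claims | Arrivals nat | Returns

fun source_events :: "'a measure \<Rightarrow> nat \<Rightarrow> nat \<Rightarrow> 'a family \<Rightarrow> 'a family \<Rightarrow> (real \<Rightarrow> 'a \<Rightarrow> real)
    \<Rightarrow> source \<Rightarrow> 'a set set" where
  "source_events M d r X \<theta> R Claims =
     generated_events M {X k j i | k j i. k \<in> {1..d} \<and> j \<in> {1..r} \<and> i \<ge> 1}"
| "source_events M d r X \<theta> R (Arrivals k) =
     generated_events M {\<theta> k j i | j i. j \<in> {1..r} \<and> i \<ge> 1}"
| "source_events M d r X \<theta> R Returns = generated_events M {R t | t. t \<ge> 0}"

text \<open>\<open>Fc k j\<close> is the distribution function of the claims of line \<open>k\<close> and type \<open>j\<close>. The assumption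
  \<open>mean_pos\<close> says that the mean of \<open>R 1\<close> exists in \<open>(0,\<infinity>]\<close>: the left-hand side is the mean of
  its negative part, the right-hand side that of its positive part.\<close>

locale renewal_risk_model = prob_space M
  for M :: "'a measure"
    and d r :: nat
    and X :: "'a family"
    and Fc :: "nat \<Rightarrow> nat \<Rightarrow> real \<Rightarrow> real"
    and \<theta> :: "'a family"
    and R :: "real \<Rightarrow> 'a \<Rightarrow> real"
    and c :: "nat \<Rightarrow> real" +
  assumes d_pos: "d \<ge> 1"
    and r_pos: "r \<ge> 1"
    and claim_rv: "\<And>k j i. \<lbrakk>k \<in> {1..d}; j \<in> {1..r}; i \<ge> 1\<rbrakk> \<Longrightarrow> random_variable borel (X k j i)"
    and claim_nonneg:
      "\<And>k j i \<omega>. \<lbrakk>k \<in> {1..d}; j \<in> {1..r}; i \<ge> 1; \<omega> \<in> space M\<rbrakk> \<Longrightarrow> 0 \<le> X k j i \<omega>"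
    and claim_df: "\<And>k j i. \<lbrakk>k \<in> {1..d}; j \<in> {1..r}; i \<ge> 1\<rbrakk> \<Longrightarrow> df M (X k j i) = Fc k j"
    and claim_PAI:
      "\<And>k j i k' j' i'. \<lbrakk>k \<in> {1..d}; j \<in> {1..r}; i \<ge> 1; k' \<in> {1..d}; j' \<in> {1..r}; i' \<ge> 1;
         (k, j, i) \<noteq> (k', j', i')\<rbrakk>
        \<Longrightarrow> asymptotically_independent M (X k j i) (X k' j' i')"
    and interarrival_nonneg:
      "\<And>k j i \<omega>. \<lbrakk>k \<in> {1..d}; j \<in> {1..r}; i \<ge> 1; \<omega> \<in> space M\<rbrakk> \<Longrightarrow> 0 \<le> \<theta> k j i \<omega>"
    and interarrival_nondegenerate:
      "\<And>k j i. \<lbrakk>k \<in> {1..d}; j \<in> {1..r}; i \<ge> 1\<rbrakk> \<Longrightarrow> \<not> (AE \<omega> in M. \<theta> k j i \<omega> = 0)"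
    and interarrival_indep:
      "\<And>k. k \<in> {1..d} \<Longrightarrow>
         indep_vars (\<lambda>_. \<Pi>\<^sub>M j\<in>{1..r}. borel) (\<lambda>i \<omega>. \<lambda>j\<in>{1..r}. \<theta> k j i \<omega>) {1..}"
    and interarrival_ident:
      "\<And>k i. \<lbrakk>k \<in> {1..d}; i \<ge> 1\<rbrakk> \<Longrightarrow>
         distr M (\<Pi>\<^sub>M j\<in>{1..r}. borel) (\<lambda>\<omega>. \<lambda>j\<in>{1..r}. \<theta> k j i \<omega>)
         = distr M (\<Pi>\<^sub>M j\<in>{1..r}. borel) (\<lambda>\<omega>. \<lambda>j\<in>{1..r}. \<theta> k j 1 \<omega>)"
    and levy: "levy_process R"
    and mean_pos: "(\<integral>\<^sup>+ \<omega>. ennreal (- R 1 \<omega>) \<partial>M) < (\<integral>\<^sup>+ \<omega>. ennreal (R 1 \<omega>) \<partial>M)"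
    and sources_indep:
      "indep_sets (source_events M d r X \<theta> R) ({Claims, Returns} \<union> Arrivals ` {1..d})"
    and premium_pos: "\<And>k. k \<in> {1..d} \<Longrightarrow> 0 < c k"

end

theory Submission
  imports Defs
begin

text \<open>One big jump: for large \<open>x\<close> the loss \<open>D\<^sub>t\<close> exceeds \<open>x\<close> essentially only because a single
  discounted claim does. By Breiman's argument a discounted claim of line \<open>k\<close> and type \<open>j\<close> exceeds \<open>x\<close>
  with probability about \<open>a\<^sub>k\<^sub>j E[exp (\<phi> \<alpha> * \<tau>); \<tau> \<le> t]\<close> times the tail of \<open>F\<close>, pairwise asymptotic
  independence rules out two large claims, the late claims are controlled by a union bound with
  geometrically decreasing thresholds, and the premiums have a moment of order above \<open>\<alpha>\<close>. Hence for
  \<open>u > 0\<close> the event \<open>Z\<^sub>k > u x, D > x\<close> has probability about \<open>l\<^sub>k(t) max u 1 powr - \<alpha>\<close> times the tail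
  of \<open>F\<close>. Integrating over \<open>u\<close> gives the conditional expectations, and inverting the tails gives
  the quantiles. Uniformity in \<open>t\<close> is obtained by working along arbitrary sequences of levels and times,
  with \<open>l\<^sub>k\<close> and \<open>L\<close> convergent along a subsequence because they are bounded.\<close>

section \<open>Regularly varying tails and quantiles\<close>

text \<open>The claims are only pairwise asymptotically independent, so no estimate can use the
  joint law of three of them; every probability is reduced to events about one or two claims. The
  weights of the claims are dependent as well, since all of them read the same return process; a
  pair of claims is therefore handled by cutting both weights at a constant. The series converge
  because the moments of the weights decay geometrically in the index: the moment of order p of a
  discount factor at an arrival time \<tau> is the mean of exp (\<phi>(p) \<tau>), a power of a
  Laplace transform below 1 as soon as \<phi>(p) < 0, and negativity of \<phi> passes from
  \<open>\<alpha>'\<close> to all smaller positive exponents. Two exponents \<gamma> < \<alpha> <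
  \<beta> appear throughout, because regular variation controls \<open>f (x / w) / f x\<close> by
  powers of \<open>w\<close> only up to such a margin. The choice 1 < \<gamma> makes the resulting
  bound integrable over the levels \<open>u\<close>; the choice \<beta> < \<open>\<alpha>'\<close>
  makes the moments finite.\<close>

locale rv_tail =
  fixes f :: "real \<Rightarrow> real" and \<alpha> :: real
  assumes f_anti: "x \<le> y \<Longrightarrow> f y \<le> f x"
    and f_pos: "0 < f x"
    and f_le_1: "f x \<le> 1"
    and f_rv: "regularly_varying (- \<alpha>) f"
    and index_gt_1: "1 < \<alpha>"
begin

text \<open>Regular variation is stated for a fixed factor. Since \<open>f\<close> is antitone, a
  converging factor \<open>y n\<close> can be replaced by constants \<open>c\<close> just above or
  just below \<open>y0\<close>, and continuity of \<open>c powr - \<alpha>\<close> at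
  \<open>y0\<close> closes the gap.\<close>

lemma rv_ratio_seq:
  assumes x: "filterlim x at_top sequentially" and y: "y \<longlonglongrightarrow> y0" and "0 < y0"
  shows "(\<lambda>n. f (y n * x n) / f (x n)) \<longlonglongrightarrow> y0 powr - \<alpha>"
proof (rule order_tendstoI)
  have lim: "(\<lambda>n. f (c * x n) / f (x n)) \<longlonglongrightarrow> c powr - \<alpha>" if "0 < c" for c
    using filterlim_compose[OF f_rv[unfolded regularly_varying_def, rule_format, OF that] x] .
  have ev: "eventually (\<lambda>n. x n > 0) sequentially"
    using x by (simp add: filterlim_at_top_dense)
  have cont: "((\<lambda>c. c powr - \<alpha>) \<longlongrightarrow> y0 powr - \<alpha>) (at y0)"
    using \<open>0 < y0\<close> by (intro tendsto_intros) auto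
  {
    fix u assume u: "u < y0 powr - \<alpha>"
    have "eventually (\<lambda>c. u < c powr - \<alpha> \<and> y0 < c) (at_right y0)"
      using order_tendstoD(1)[OF tendsto_mono[OF at_le cont] u, of "{y0<..}"]
        eventually_at_right_less[of y0] by (auto elim: eventually_elim2)
    then obtain c where c: "u < c powr - \<alpha>" "y0 < c"
      using eventually_happens[of _ "at_right y0"] by auto
    have c0: "0 < c" using c \<open>0 < y0\<close> by simp
    show "eventually (\<lambda>n. u < f (y n * x n) / f (x n)) sequentially"
      using order_tendstoD(1)[OF lim[OF c0] c(1)] order_tendstoD(2)[OF y c(2)] ev
    proof eventually_elim
      case (elim n)
      have "f (c * x n) \<le> f (y n * x n)" using elim by (intro f_anti mult_right_mono) auto
      then show ?case
        using elim f_pos[of "x n"] divide_right_mono[of _ _ "f (x n)"] by fastforce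
    qed
  }
  {
    fix u assume u: "y0 powr - \<alpha> < u"
    have "eventually (\<lambda>c. c powr - \<alpha> < u \<and> c < y0 \<and> 0 < c) (at_left y0)"
      using order_tendstoD(2)[OF tendsto_mono[OF at_le cont] u, of "{..<y0}"]
        eventually_at_left_real[OF \<open>0 < y0\<close>] by (auto elim: eventually_elim2)
    then obtain c where c: "c powr - \<alpha> < u" "c < y0" "0 < c"
      using eventually_happens[of _ "at_left y0"] by auto
    show "eventually (\<lambda>n. f (y n * x n) / f (x n) < u) sequentially"
      using order_tendstoD(2)[OF lim[OF c(3)] c(1)] order_tendstoD(1)[OF y c(2)] ev
    proof eventually_elim
      case (elim n)
      have "f (y n * x n) \<le> f (c * x n)" using elim by (intro f_anti mult_right_mono) auto
      then show ?case
        using elim f_pos[of "x n"] divide_right_mono[of _ _ "f (x n)"] by fastforce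
    qed
  }
qed

text \<open>Potter's bounds. Eventually one doubling of the argument multiplies \<open>f\<close> by
  a factor between \<open>2 powr - \<beta>\<close> and \<open>2 powr - \<gamma>\<close>; iteration
  covers the dyadic multiples and monotonicity the rest. The sum of two powers treats small and
  large \<open>w\<close> at once, and \<open>x / w\<close> may even fall below \<open>x0\<close>, as
  dominated convergence with a random \<open>w\<close> demands.\<close>

lemma rv_potter:
  assumes "0 < \<gamma>" "\<gamma> < \<alpha>" "\<alpha> < \<beta>"
  obtains C x0 where "0 < C" "0 < x0"
    "\<And>x w. x0 \<le> x \<Longrightarrow> 0 < w \<Longrightarrow> f (x / w) \<le> C * (w powr \<gamma> + w powr \<beta>) * f x"
proof -
  have lim: "((\<lambda>x. f (2 * x) / f x) \<longlongrightarrow> 2 powr - \<alpha>) at_top"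
    using f_rv unfolding regularly_varying_def by (rule allE[of _ 2]) auto
  have "eventually (\<lambda>x. f (2 * x) / f x < 2 powr - \<gamma> \<and> 2 powr - \<beta> < f (2 * x) / f x) at_top"
    using order_tendstoD(1)[OF lim, of "2 powr - \<beta>"] order_tendstoD(2)[OF lim, of "2 powr - \<gamma>"]
      assms by (auto intro: eventually_conj)
  then obtain x1 where x1: "\<And>x. x1 \<le> x \<Longrightarrow> f (2 * x) / f x < 2 powr - \<gamma> \<and> 2 powr - \<beta> < f (2 * x) / f x"
    unfolding eventually_at_top_linorder by auto
  define x0 where "x0 = max 1 x1"
  have x0: "0 < x0" by (simp add: x0_def)
  have step: "f (2 * x) \<le> 2 powr - \<gamma> * f x" "2 powr - \<beta> * f x \<le> f (2 * x)" if "x0 \<le> x" for x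
    using x1[of x] that f_pos[of x] by (auto simp: x0_def field_simps)
  have iter: "f (2 ^ m * x) \<le> 2 powr (- \<gamma> * m) * f x \<and> 2 powr (- \<beta> * m) * f x \<le> f (2 ^ m * x)"
    if x: "x0 \<le> x" for x and m :: nat
  proof (induction m)
    case (Suc m)
    have "x0 \<le> 2 ^ m * x" using x x0 by (smt (verit) mult_le_cancel_right1 one_le_power)
    note s = step[OF this]
    have "f (2 ^ Suc m * x) \<le> 2 powr - \<gamma> * (2 powr (- \<gamma> * m) * f x)"
      using order_trans[OF s(1) mult_left_mono[OF conjunct1[OF Suc]]] by (simp add: mult.assoc)
    moreover have "2 powr - \<beta> * (2 powr (- \<beta> * m) * f x) \<le> f (2 ^ Suc m * x)"
      using order_trans[OF mult_left_mono[OF conjunct2[OF Suc]] s(2)] by (simp add: mult.assoc)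
    moreover have e: "2 powr - p * (2 powr (- p * m) * f x) = 2 powr (- p * Suc m) * f x" for p :: real
      by (simp add: powr_add[symmetric] algebra_simps)
    ultimately show ?case unfolding e by simp
  qed simp
  have dyadic: "\<exists>m::nat. 2 ^ m \<le> y \<and> y < 2 * 2 ^ m" if "1 \<le> y" for y :: real
  proof -
    define m where "m = nat \<lfloor>log 2 y\<rfloor>"
    have "0 \<le> log 2 y" using that by simp
    then have m: "real m \<le> log 2 y" "log 2 y < real m + 1" unfolding m_def by linarith+
    have "2 powr m \<le> y" "y < 2 powr (real m + 1)"
      using m that by (simp_all add: le_log_iff less_log_iff log_less_iff)
    then show ?thesis by (auto simp: powr_realpow powr_add intro!: exI[of _ m])
  qed
  have up: "f (y * x) \<le> 2 powr \<gamma> * y powr - \<gamma> * f x" if "x0 \<le> x" "1 \<le> y" for x y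
  proof -
    obtain m :: nat where m: "2 ^ m \<le> y" "y < 2 * 2 ^ m" using dyadic[OF \<open>1 \<le> y\<close>] by auto
    have "f (y * x) \<le> f (2 ^ m * x)" using m that x0 by (intro f_anti mult_right_mono) auto
    also have "\<dots> \<le> 2 powr (- \<gamma> * m) * f x" using iter[OF that(1)] by auto
    also have "2 powr (- \<gamma> * m) = 2 powr \<gamma> * (2 * 2 ^ m) powr - \<gamma>"
      by (simp add: powr_mult powr_minus powr_realpow[symmetric] powr_powr field_simps powr_add[symmetric])
    also have "(2 * 2 ^ m) powr - \<gamma> \<le> y powr - \<gamma>" using m assms that by (intro powr_mono2') auto
    finally show ?thesis using f_pos[of x] by (simp add: mult_right_mono)
  qed
  have low: "f x \<le> 2 powr \<beta> * y powr \<beta> * f (y * x)" if "x0 \<le> x" "1 \<le> y" for x y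
  proof -
    obtain m :: nat where m: "2 ^ m \<le> y" "y < 2 * 2 ^ m" using dyadic[OF \<open>1 \<le> y\<close>] by auto
    have "2 powr (- \<beta> * Suc m) * f x \<le> f (2 ^ Suc m * x)" using iter[OF that(1)] by blast
    also have "\<dots> \<le> f (y * x)" using m that x0 by (intro f_anti mult_right_mono) auto
    finally have "f x \<le> 2 powr (\<beta> * Suc m) * f (y * x)"
      unfolding mult_minus_left powr_minus_divide by (simp add: pos_divide_le_eq mult.commute)
    also have "2 powr (\<beta> * Suc m) = (2 * 2 ^ m) powr \<beta>"
      by (simp add: powr_realpow[symmetric] powr_powr powr_add[symmetric] powr_mult algebra_simps)
    also have "\<dots> \<le> (2 * y) powr \<beta>" using m assms by (intro powr_mono2) auto
    finally show ?thesis using f_pos[of "y * x"] that by (simp add: powr_mult mult_right_mono)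
  qed
  \<comment> \<open>The second entry does two jobs: \<open>f x0 \<le> 1\<close> makes it at least
    \<open>2 powr \<beta>\<close>, and it pays for arguments \<open>x / w\<close> below
    \<open>x0\<close>.\<close>
  define C where "C = max (2 powr \<gamma>) (2 powr \<beta> / f x0)"
  have C: "0 < C" by (simp add: C_def less_max_iff_disj)
  have "f (x / w) \<le> C * (w powr \<gamma> + w powr \<beta>) * f x" if x: "x0 \<le> x" and w: "0 < w" for x w
  proof -
    have "f (x / w) \<le> C * w powr \<gamma> * f x \<or> f (x / w) \<le> C * w powr \<beta> * f x"
    proof (cases "w \<le> 1")
      case True
      have "f (x / w) \<le> 2 powr \<gamma> * (1 / w) powr - \<gamma> * f x"
        using up[OF x, of "1 / w"] True w by simp
      also have "(1 / w) powr - \<gamma> = w powr \<gamma>" using w by (simp add: powr_minus powr_divide)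
      also have "2 powr \<gamma> * w powr \<gamma> * f x \<le> C * w powr \<gamma> * f x"
        using f_pos[of x] by (intro mult_right_mono) (auto simp: C_def)
      finally show ?thesis by simp
    next
      case False
      show ?thesis
      proof (cases "x0 \<le> x / w")
        case True
        have "f (x / w) \<le> 2 powr \<beta> * w powr \<beta> * f x"
          using low[OF True, of w] False w by simp
        also have "2 powr \<beta> * w powr \<beta> * f x \<le> C * w powr \<beta> * f x"
        proof -
          have "2 powr \<beta> \<le> 2 powr \<beta> / f x0"
            using f_pos[of x0] f_le_1[of x0] by (simp add: field_simps)
          then show ?thesis
            using f_pos[of x] by (intro mult_right_mono) (auto simp: C_def)
        qed
        finally show ?thesis by simp
      next
        \<comment> \<open>Here only \<open>f (x / w) \<le> 1\<close> is known; comparing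
          \<open>x\<close> with \<open>x0\<close> and using \<open>x / x0 \<le> w\<close> shows that
          the claimed bound is at least 1.\<close>
        case small: False
        have "f x0 \<le> 2 powr \<beta> * (x / x0) powr \<beta> * f x"
          using low[of x0 "x / x0"] x x0 by simp
        also have "(x / x0) powr \<beta> \<le> w powr \<beta>"
          using small x x0 w assms by (intro powr_mono2) (auto simp: field_simps)
        finally have "1 \<le> 2 powr \<beta> / f x0 * w powr \<beta> * f x"
          using f_pos[of x0] f_pos[of x] by (simp add: field_simps mult_right_mono)
        also have "\<dots> \<le> C * w powr \<beta> * f x"
          using f_pos[of x] by (intro mult_right_mono) (auto simp: C_def)
        finally show ?thesis using f_le_1[of "x / w"] by linarith
      qed
    qed
    moreover have "0 \<le> C * w powr \<gamma> * f x" "0 \<le> C * w powr \<beta> * f x"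
      using C f_pos[of x] by auto
    ultimately show ?thesis by (auto simp: algebra_simps)
  qed
  then show ?thesis using that C x0 by blast
qed

text \<open>To the left of the asymptotic range the antitone \<open>f\<close> stays above
  \<open>f x1\<close>, while \<open>G\<close> is at most 1.\<close>

lemma tail_dominated:
  assumes lim: "((\<lambda>x. G x / f x) \<longlongrightarrow> c) at_top" and c: "0 \<le> c" and G: "\<And>x. G x \<le> 1"
  obtains K where "0 < K" "\<And>x. G x \<le> K * f x"
proof -
  have "eventually (\<lambda>x. G x / f x < c + 1) at_top"
    using order_tendstoD(2)[OF lim, of "c + 1"] by simp
  then obtain x1 where x1: "\<And>x. x1 \<le> x \<Longrightarrow> G x / f x < c + 1"
    unfolding eventually_at_top_linorder by auto
  have "G x \<le> max (c + 1) (1 / f x1) * f x" for x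
  proof (cases "x1 \<le> x")
    case True
    then have "G x \<le> (c + 1) * f x" using x1[of x] f_pos[of x] by (simp add: field_simps)
    also have "\<dots> \<le> max (c + 1) (1 / f x1) * f x"
      using f_pos[of x] by (intro mult_right_mono) auto
    finally show ?thesis .
  next
    case False
    then have "1 \<le> (1 / f x1) * f x" using f_anti[of x x1] f_pos[of x1] by (simp add: field_simps)
    also have "\<dots> \<le> max (c + 1) (1 / f x1) * f x"
      using f_pos[of x] by (intro mult_right_mono) auto
    finally show ?thesis using G[of x] by simp
  qed
  moreover have "0 < max (c + 1) (1 / f x1)" using c by simp
  ultimately show ?thesis using that by blast
qed

text \<open>Potter's bound read backwards: \<open>w = x / x0\<close> bounds \<open>f x\<close> from
  below by a multiple of \<open>1 / (x + x powr \<beta>)\<close>, up to constants, and a \<beta>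
  strictly between \<alpha> and \<open>p\<close> leaves room.\<close>

lemma powr_negligible:
  assumes "\<alpha> < p"
  shows "((\<lambda>x. x powr - p / f x) \<longlongrightarrow> 0) at_top"
proof -
  define \<beta> where "\<beta> = (\<alpha> + p) / 2"
  have b: "\<alpha> < \<beta>" "\<beta> < p" "0 < \<beta>" using assms index_gt_1 by (auto simp: \<beta>_def)
  obtain C x0 where C: "0 < C" "0 < x0"
    and pot: "\<And>x w. x0 \<le> x \<Longrightarrow> 0 < w \<Longrightarrow> f (x / w) \<le> C * (w powr 1 + w powr \<beta>) * f x"
    using rv_potter[of 1 \<beta>] index_gt_1 b by auto
  have bound: "x powr - p / f x \<le> C / f x0 * (1 / x0) * x powr (1 - p)
     + C / f x0 * (1 / x0) powr \<beta> * x powr (\<beta> - p)" if "x0 \<le> x" for x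
  proof -
    have x: "0 < x" using that C by simp
    have "f x0 \<le> C * ((x / x0) + (x / x0) powr \<beta>) * f x"
      using pot[OF that, of "x / x0"] x C by simp
    then have "1 / f x \<le> C / f x0 * (x / x0 + (x / x0) powr \<beta>)"
      using f_pos[of x] f_pos[of x0] by (simp add: field_simps)
    then have "x powr - p * (1 / f x) \<le> x powr - p * (C / f x0 * (x / x0 + (x / x0) powr \<beta>))"
      by (intro mult_left_mono) auto
    also have "\<dots> = C / f x0 * (1 / x0) * (x powr - p * x) + C / f x0 * (1 / x0) powr \<beta> * (x powr - p * x powr \<beta>)"
      using x C f_pos[of x0] by (simp add: powr_divide add_divide_distrib distrib_left distrib_right mult_ac)
    also have "x powr - p * x = x powr (1 - p)" using x by (simp add: powr_diff powr_minus field_simps)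
    also have "x powr - p * x powr \<beta> = x powr (\<beta> - p)" by (simp add: powr_add[symmetric])
    finally show ?thesis by simp
  qed
  have lim: "((\<lambda>x. C / f x0 * (1 / x0) * x powr (1 - p)
     + C / f x0 * (1 / x0) powr \<beta> * x powr (\<beta> - p)) \<longlongrightarrow> 0) at_top"
    by (intro tendsto_add_zero tendsto_mult_right_zero tendsto_neg_powr filterlim_ident)
       (use b assms index_gt_1 in auto)
  show ?thesis
  proof (rule tendsto_sandwich[OF _ _ tendsto_const lim])
    show "\<forall>\<^sub>F x in at_top. 0 \<le> x powr - p / f x"
      using f_pos by (intro always_eventually allI divide_nonneg_nonneg) (auto intro: less_imp_le)
  qed (use bound in \<open>auto simp: eventually_at_top_linorder\<close>)
qed

end

text \<open>Left neighbourhoods of \<open>a\<close> have a countable base, so a failure of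
  uniformity yields sequences of levels and parameters along which the error stays above some
  \<open>e\<close>. Asking only for a convergent subsequence lets compactness arguments
  enter.\<close>

lemma uniform_limit_seqI:
  fixes f :: "real \<Rightarrow> 'b \<Rightarrow> real"
  assumes "\<And>q t. filterlim q (at_left a) sequentially \<Longrightarrow> (\<And>n::nat. t n \<in> S) \<Longrightarrow>
      \<exists>\<sigma>. strict_mono \<sigma> \<and> (\<lambda>n. f (q (\<sigma> n)) (t (\<sigma> n))) \<longlonglongrightarrow> c"
  shows "uniform_limit S f (\<lambda>_. c) (at_left a)"
proof (rule uniform_limitI, rule ccontr)
  fix e :: real assume e: "0 < e" and n: "\<not> (\<forall>\<^sub>F q in at_left a. \<forall>t\<in>S. dist (f q t) c < e)"
  have ex: "\<exists>q t. a - 1 / Suc n < q \<and> q < a \<and> t \<in> S \<and> e \<le> dist (f q t) c" for n :: nat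
  proof (rule ccontr)
    assume *: "\<nexists>q t. a - 1 / Suc n < q \<and> q < a \<and> t \<in> S \<and> e \<le> dist (f q t) c"
    have "eventually (\<lambda>q. q \<in> {a - 1 / Suc n <..< a}) (at_left a)"
      by (rule eventually_at_left_real) simp
    then have "\<forall>\<^sub>F q in at_left a. \<forall>t\<in>S. dist (f q t) c < e"
      by eventually_elim (use * in force)
    with n show False by simp
  qed
  then obtain q t where qt: "\<And>n. a - 1 / Suc n < q n \<and> q n < a \<and> t n \<in> S \<and> e \<le> dist (f (q n) (t n)) c"
    by metis
  have "q \<longlonglongrightarrow> a"
  proof (rule tendsto_sandwich[OF _ _ _ tendsto_const])
    show "(\<lambda>n. a - 1 / Suc n) \<longlonglongrightarrow> a"
      using tendsto_diff[OF tendsto_const LIMSEQ_inverse_real_of_nat, of a]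
      by (simp add: inverse_eq_divide)
  qed (use qt in \<open>auto intro: less_imp_le always_eventually\<close>)
  then have "filterlim q (at_left a) sequentially"
    unfolding filterlim_at using qt by (auto intro!: always_eventually simp: less_imp_neq)
  with assms[of q t] qt obtain \<sigma> where s: "strict_mono \<sigma>" "(\<lambda>n. f (q (\<sigma> n)) (t (\<sigma> n))) \<longlonglongrightarrow> c"
    by auto
  from tendstoD[OF s(2) e] obtain n where "dist (f (q (\<sigma> n)) (t (\<sigma> n))) c < e"
    by (auto simp: eventually_sequentially)
  with qt[of "\<sigma> n"] show False by simp
qed


lemma
  assumes "distribution_function G"
  shows distribution_function_mono: "x \<le> y \<Longrightarrow> G x \<le> G y"
    and distribution_function_right_cont: "(G \<longlongrightarrow> G x) (at_right x)"
    and distribution_function_at_top: "(G \<longlongrightarrow> 1) at_top"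
    and distribution_function_at_bot: "(G \<longlongrightarrow> 0) at_bot"
    and distribution_function_le_1: "G x \<le> 1"
    and distribution_function_nonneg: "0 \<le> G x"
proof -
  obtain N where N: "real_distribution N" "G = cdf N"
    using assms unfolding distribution_function_def by blast
  interpret real_distribution N by fact
  show "x \<le> y \<Longrightarrow> G x \<le> G y" using cdf_nondecreasing N by simp
  show "(G \<longlongrightarrow> G x) (at_right x)" using cdf_is_right_cont[of x] N by (simp add: continuous_within)
  show "(G \<longlongrightarrow> 1) at_top" using cdf_lim_at_top_prob N by simp
  show "(G \<longlongrightarrow> 0) at_bot" using cdf_lim_at_bot N by simp
  show "G x \<le> 1" "0 \<le> G x" using N by (simp_all add: cdf_def)
qed

lemma (in prob_space) distribution_function_df:
  "random_variable borel Y \<Longrightarrow> distribution_function (df M Y)"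
  unfolding distribution_function_def df_def by (metis real_distribution_distr)

lemma (in prob_space) tail_df:
  assumes "random_variable borel Y"
  shows "tail (df M Y) x = prob {\<omega> \<in> space M. x < Y \<omega>}"
proof -
  have "df M Y x = prob {\<omega> \<in> space M. Y \<omega> \<le> x}"
    using assms by (simp add: df_def cdf_def measure_distr vimage_def Int_def conj_commute)
  also have "\<dots> = 1 - prob {\<omega> \<in> space M. x < Y \<omega>}"
    using assms by (subst prob_compl[symmetric]) (auto intro!: arg_cong[of _ _ prob])
  finally show ?thesis by (simp add: tail_def)
qed

section \<open>Quantiles of a fixed distribution function\<close>

context
  fixes G assumes G: "distribution_function G"
begin

lemma quantile_le:
  assumes "0 < q" "q \<le> G y"
  shows "gen_inverse G q \<le> y"
proof -
  have "eventually (\<lambda>x. G x < q) at_bot"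
    using order_tendstoD(2)[OF distribution_function_at_bot[OF G] assms(1)] .
  then obtain b where b: "\<And>x. x \<le> b \<Longrightarrow> G x < q" unfolding eventually_at_bot_linorder by auto
  have "bdd_below {y. G y \<ge> q}"
    by (rule bdd_belowI[of _ b]) (use b in \<open>auto simp: not_le[symmetric]\<close>, meson b less_le_not_le linear)
  then show ?thesis unfolding gen_inverse_def using assms(2) by (intro cInf_lower) auto
qed

lemma quantile_set_nonempty: "q < 1 \<Longrightarrow> \<exists>y. q \<le> G y"
  using order_tendstoD(1)[OF distribution_function_at_top[OF G]]
  by (meson eventually_happens' less_imp_le trivial_limit_at_top_linorder)

lemma quantile_ge:
  assumes "q < 1" "G c < q"
  shows "c \<le> gen_inverse G q"
  unfolding gen_inverse_def
proof (rule cInf_greatest)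
  fix y assume "y \<in> {y. q \<le> G y}"
  then show "c \<le> y" using assms(2) distribution_function_mono[OF G, of y c] by fastforce
qed (use quantile_set_nonempty assms in auto)

lemma less_quantile: "0 < q \<Longrightarrow> y < gen_inverse G q \<Longrightarrow> G y < q"
  using quantile_le[of q y] by force

text \<open>Right continuity puts the infimum itself into the superlevel set.\<close>

lemma quantile_attained:
  assumes "0 < q" "q < 1"
  shows "q \<le> G (gen_inverse G q)"
proof (rule tendsto_lowerbound[OF distribution_function_right_cont[OF G]])
  show "\<forall>\<^sub>F y in at_right (gen_inverse G q). q \<le> G y"
    using eventually_at_right_less
  proof eventually_elim
    case (elim y)
    then show ?case using quantile_ge[OF assms(2), of y] by force
  qed
qed simp

end

locale rv_distribution = rv_tail "tail F" \<alpha> for F \<alpha> +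
  assumes F: "distribution_function F"
begin

lemma quantile_at_top: "filterlim (gen_inverse F) at_top (at_left 1)"
  unfolding filterlim_at_top
proof
  fix z
  have "F z < 1" using f_pos[of z] by (simp add: tail_def)
  then have "eventually (\<lambda>q. q \<in> {F z<..<1}) (at_left 1)" by (rule eventually_at_left_real)
  then show "\<forall>\<^sub>F q in at_left 1. z \<le> gen_inverse F q"
    by eventually_elim (auto intro: quantile_ge[OF F])
qed

text \<open>The limit is the factor \<open>c\<close> that solves
  \<open>L * c powr - \<alpha> = 1\<close>: for larger \<open>c\<close> the tail of
  \<open>G n\<close> at \<open>c * g n\<close> drops below the tail of \<open>F\<close> at its
  quantile \<open>g n\<close>, for smaller \<open>c\<close> it stays above. As the distributions
  \<open>G n\<close> vary with \<open>n\<close>, the tail ratio is assumed along every sequence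
  tending to infinity.\<close>

lemma quantile_ratio_tendsto:
  assumes G: "\<And>n. distribution_function (G n)"
    and q: "filterlim q (at_left 1) sequentially"
    and lim: "\<And>x. filterlim x at_top sequentially \<Longrightarrow> (\<lambda>n. tail (G n) (x n) / tail F (x n)) \<longlonglongrightarrow> L"
    and "0 < L"
  shows "(\<lambda>n. gen_inverse (G n) (q n) / gen_inverse F (q n)) \<longlonglongrightarrow> L powr (1 / \<alpha>)"
proof (rule order_tendstoI)
  define g where "g n = gen_inverse F (q n)" for n
  have g: "filterlim g at_top sequentially"
    unfolding g_def by (rule filterlim_compose[OF quantile_at_top q])
  have a0: "0 < \<alpha>" using index_gt_1 by simp
  have ev: "eventually (\<lambda>n. 0 < q n \<and> q n < 1 \<and> 0 < g n) sequentially"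
  proof -
    have "eventually (\<lambda>q. 0 < q \<and> q < 1) (at_left (1::real))"
      using eventually_at_left_real[of 0 "1::real"] by (auto elim: eventually_mono)
    then have "eventually (\<lambda>n. 0 < q n \<and> q n < 1) sequentially"
      using q by (rule eventually_compose_filterlim)
    moreover have "eventually (\<lambda>n. 0 < g n) sequentially" using g by (simp add: filterlim_at_top_dense)
    ultimately show ?thesis by eventually_elim auto
  qed
  have cg: "filterlim (\<lambda>n. c * g n) at_top sequentially" if "0 < c" for c
    using filterlim_tendsto_pos_mult_at_top[OF tendsto_const that g] .
  have key: "(\<lambda>n. tail (G n) (c * g n) / tail F (\<kappa> * g n)) \<longlonglongrightarrow> L * (c powr - \<alpha> / \<kappa> powr - \<alpha>)"
    if "0 < c" "0 < \<kappa>" for c \<kappa>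
  proof -
    have 1: "(\<lambda>n. tail F (b * g n) / tail F (g n)) \<longlonglongrightarrow> b powr - \<alpha>" if "0 < b" for b
      by (rule rv_ratio_seq[OF g tendsto_const that])
    have "(\<lambda>n. tail (G n) (c * g n) / tail F (c * g n) *
        ((tail F (c * g n) / tail F (g n)) / (tail F (\<kappa> * g n) / tail F (g n)))) \<longlonglongrightarrow> L * (c powr - \<alpha> / \<kappa> powr - \<alpha>)"
      using that by (intro tendsto_intros lim cg 1) auto
    moreover have "tail (G n) (c * g n) / tail F (c * g n) *
        ((tail F (c * g n) / tail F (g n)) / (tail F (\<kappa> * g n) / tail F (g n)))
        = tail (G n) (c * g n) / tail F (\<kappa> * g n)" for n
      using f_pos by (simp add: less_imp_neq[THEN not_sym])
    ultimately show ?thesis by simp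
  qed
  {
    fix u assume "L powr (1 / \<alpha>) < u"
    then obtain c where c: "L powr (1 / \<alpha>) < c" "c < u" using dense by blast
    have c0: "0 < c" using c by (smt (verit) powr_ge_zero)
    have "(L powr (1 / \<alpha>)) powr \<alpha> < c powr \<alpha>" using c a0 by (intro powr_less_mono2) auto
    then have "L * (c powr - \<alpha> / 1 powr - \<alpha>) < 1"
      using \<open>0 < L\<close> a0 c0 by (simp add: powr_powr powr_minus field_simps)
    from order_tendstoD(2)[OF key[OF c0 zero_less_one] this] ev
    show "\<forall>\<^sub>F n in sequentially. gen_inverse (G n) (q n) / gen_inverse F (q n) < u"
      unfolding g_def[symmetric]
    proof eventually_elim
      case (elim n)
      have "q n \<le> F (g n)" unfolding g_def using elim by (intro quantile_attained[OF F]) auto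
      moreover have "tail (G n) (c * g n) < tail F (g n)"
        using elim f_pos[of "g n"] by (simp add: field_simps)
      ultimately have "gen_inverse (G n) (q n) \<le> c * g n"
        using elim by (intro quantile_le[OF G]) (auto simp: tail_def)
      then have "gen_inverse (G n) (q n) / g n \<le> c" using elim by (simp add: field_simps)
      then show ?case using c by simp
    qed
  }
  {
    fix u assume u: "u < L powr (1 / \<alpha>)"
    have "max u 0 < L powr (1 / \<alpha>)" using u \<open>0 < L\<close> by simp
    then obtain c where c: "max u 0 < c" "c < L powr (1 / \<alpha>)" using dense by blast
    have c0: "0 < c" using c by simp
    have "c / L powr (1 / \<alpha>) < 1" using c \<open>0 < L\<close> by simp
    \<comment> \<open>\<open>F\<close> may jump at its quantile and exceed \<open>q n\<close> there.
      At \<open>\<kappa> * g n\<close>, strictly to the left, it is below \<open>q n\<close>, and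
      the margin between \<open>c\<close> and the limit absorbs \<kappa>.\<close>
    then obtain \<kappa> where k: "c / L powr (1 / \<alpha>) < \<kappa>" "\<kappa> < 1" using dense by blast
    have k0: "0 < \<kappa>" using k c0 \<open>0 < L\<close> by (smt (verit) divide_pos_pos powr_gt_zero)
    have "c < \<kappa> * L powr (1 / \<alpha>)" using k \<open>0 < L\<close> by (simp add: field_simps)
    then have "c powr \<alpha> < (\<kappa> * L powr (1 / \<alpha>)) powr \<alpha>" using a0 c0 by (intro powr_less_mono2) auto
    then have "1 < L * (c powr - \<alpha> / \<kappa> powr - \<alpha>)"
      using \<open>0 < L\<close> a0 c0 k0 by (simp add: powr_mult powr_powr powr_minus field_simps)
    from order_tendstoD(1)[OF key[OF c0 k0] this] ev
    show "\<forall>\<^sub>F n in sequentially. u < gen_inverse (G n) (q n) / gen_inverse F (q n)"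
      unfolding g_def[symmetric]
    proof eventually_elim
      case (elim n)
      have "F (\<kappa> * g n) < q n"
        using elim k by (intro less_quantile[OF F]) (auto simp: g_def[symmetric])
      moreover have "tail F (\<kappa> * g n) < tail (G n) (c * g n)"
        using elim f_pos[of "\<kappa> * g n"] by (simp add: field_simps)
      ultimately have "c * g n \<le> gen_inverse (G n) (q n)"
        using elim by (intro quantile_ge[OF G]) (auto simp: tail_def)
      then have "c \<le> gen_inverse (G n) (q n) / g n" using elim by (simp add: field_simps)
      then show ?case using c by simp
    qed
  }
qed

end

section \<open>One big jump for randomly weighted sums\<close>

text \<open>Each type \<open>p\<close> carries sequences of claims \<open>X\<close>, discount
  weights \<open>W\<close> and arrival times \<tau>. Independence is assumed only between a claim
  and its own weight and time; different weights may depend on each other arbitrarily, and different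
  claims are linked only through pairs. The geometric moment bound at both exponents controls the
  infinite series.\<close>

locale heavy_tailed_sums = prob_space M + rv_tail f \<alpha> for M :: "'a measure" and f \<alpha> +
  fixes A :: "'b set" and X W \<tau> :: "'b \<Rightarrow> nat \<Rightarrow> 'a \<Rightarrow> real" and G :: "'b \<Rightarrow> real \<Rightarrow> real"
    and a :: "'b \<Rightarrow> real" and \<gamma> \<beta> \<rho> \<kappa> :: real
  assumes finite_A: "finite A"
    and exponents: "1 < \<gamma>" "\<gamma> < \<alpha>" "\<alpha> < \<beta>"
    and X_rv: "p \<in> A \<Longrightarrow> X p i \<in> borel_measurable M"
    and W_rv: "p \<in> A \<Longrightarrow> W p i \<in> borel_measurable M"
    and \<tau>_rv: "p \<in> A \<Longrightarrow> \<tau> p i \<in> borel_measurable M"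
    and X_nonneg: "p \<in> A \<Longrightarrow> \<omega> \<in> space M \<Longrightarrow> 0 \<le> X p i \<omega>"
    and W_pos: "p \<in> A \<Longrightarrow> \<omega> \<in> space M \<Longrightarrow> 0 < W p i \<omega>"
    and X_tail: "p \<in> A \<Longrightarrow> prob {\<omega> \<in> space M. x < X p i \<omega>} = G p x"
    and G_equiv: "p \<in> A \<Longrightarrow> ((\<lambda>x. G p x / f x) \<longlongrightarrow> a p) at_top"
    and a_nonneg: "p \<in> A \<Longrightarrow> 0 \<le> a p"
    and indep: "p \<in> A \<Longrightarrow> 
      distr M (borel \<Otimes>\<^sub>M (borel \<Otimes>\<^sub>M borel)) (\<lambda>\<omega>. (X p i \<omega>, W p i \<omega>, \<tau> p i \<omega>))
      = distr M borel (X p i) \<Otimes>\<^sub>M distr M (borel \<Otimes>\<^sub>M borel) (\<lambda>\<omega>. (W p i \<omega>, \<tau> p i \<omega>))"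
    and pair_negligible: "p \<in> A \<Longrightarrow> q \<in> A \<Longrightarrow> (p, i) \<noteq> (q, j) \<Longrightarrow>
      ((\<lambda>x. prob {\<omega> \<in> space M. x < X p i \<omega> \<and> x < X q j \<omega>} / f x) \<longlongrightarrow> 0) at_top"
    and \<rho>: "0 < \<rho>" "\<rho> < 1"
    and W_moment: "p \<in> A \<Longrightarrow> s \<in> {\<gamma>, \<beta>} \<Longrightarrow> integrable M (\<lambda>\<omega>. W p i \<omega> powr s)"
      "p \<in> A \<Longrightarrow> s \<in> {\<gamma>, \<beta>} \<Longrightarrow> expectation (\<lambda>\<omega>. W p i \<omega> powr s) \<le> \<kappa> * \<rho> ^ i"
begin

lemma f_nonzero: "f x \<noteq> 0"
  using f_pos[of x] by simp

lemma G_bounds: "p \<in> A \<Longrightarrow> 0 \<le> G p x" "p \<in> A \<Longrightarrow> G p x \<le> 1"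
  using X_tail[symmetric] by (metis measure_nonneg, metis prob_le_1)

lemma G_anti: "p \<in> A \<Longrightarrow> x \<le> y \<Longrightarrow> G p y \<le> G p x"
proof -
  assume p: "p \<in> A" and xy: "x \<le> y"
  note [measurable] = X_rv[OF p]
  show ?thesis unfolding X_tail[OF p, of _ 0, symmetric]
    using xy by (intro finite_measure_mono) auto
qed

lemma G_measurable: "p \<in> A \<Longrightarrow> G p \<in> borel_measurable borel"
proof -
  assume p: "p \<in> A"
  have "(\<lambda>x. - G p x) \<in> borel_measurable borel"
    by (intro borel_measurable_mono monoI) (use G_anti[OF p] in auto)
  from borel_measurable_uminus[OF this] show ?thesis by simp
qed

lemma claim_tail_potter:
  obtains C x0 where "0 < C" "0 < x0"
    "\<And>p x w. p \<in> A \<Longrightarrow> x0 \<le> x \<Longrightarrow> 0 < w \<Longrightarrow> G p (x / w) \<le> C * (w powr \<gamma> + w powr \<beta>) * f x"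
proof -
  obtain C x0 where C: "0 < C" "0 < x0"
    and pot: "\<And>x w. x0 \<le> x \<Longrightarrow> 0 < w \<Longrightarrow> f (x / w) \<le> C * (w powr \<gamma> + w powr \<beta>) * f x"
    using rv_potter[of \<gamma> \<beta>] exponents by auto
  have "\<exists>K>0. \<forall>x. G p x \<le> K * f x" if p: "p \<in> A" for p
    using tail_dominated[OF G_equiv[OF p] a_nonneg[OF p] G_bounds(2)[OF p]] by blast
  then obtain K where K: "\<And>p. p \<in> A \<Longrightarrow> 0 < K p" "\<And>p x. p \<in> A \<Longrightarrow> G p x \<le> K p * f x" by metis
  define K0 where "K0 = 1 + (\<Sum>p\<in>A. K p)"
  have K0: "0 < K0" unfolding K0_def using K(1) by (simp add: add_pos_nonneg sum_nonneg less_imp_le)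
  have KK: "K p \<le> K0" if "p \<in> A" for p
    unfolding K0_def using member_le_sum[OF that, of K] K(1) finite_A by (simp add: less_imp_le)
  have "G p (x / w) \<le> K0 * C * (w powr \<gamma> + w powr \<beta>) * f x"
    if "p \<in> A" "x0 \<le> x" "0 < w" for p x w
  proof -
    have "G p (x / w) \<le> K p * f (x / w)" using K that by auto
    also have "\<dots> \<le> K0 * f (x / w)" using KK that f_pos by (intro mult_right_mono) (auto intro: less_imp_le)
    also have "\<dots> \<le> K0 * (C * (w powr \<gamma> + w powr \<beta>) * f x)" using pot that K0 by (intro mult_left_mono) auto
    finally show ?thesis by (simp add: mult.assoc)
  qed
  then show ?thesis using that[of "K0 * C" x0] K0 C by simp
qed

text \<open>Choosing the Potter constants once gives all later estimates a common threshold
  \<open>potter_x\<close>, valid for every type.\<close>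

definition potter_C where "potter_C = (SOME C. \<exists>x0. 0 < C \<and> 0 < x0 \<and>
    (\<forall>p x w. p \<in> A \<longrightarrow> x0 \<le> x \<longrightarrow> 0 < w \<longrightarrow> G p (x / w) \<le> C * (w powr \<gamma> + w powr \<beta>) * f x))"

definition potter_x where "potter_x = (SOME x0. 0 < potter_C \<and> 0 < x0 \<and>
    (\<forall>p x w. p \<in> A \<longrightarrow> x0 \<le> x \<longrightarrow> 0 < w \<longrightarrow> G p (x / w) \<le> potter_C * (w powr \<gamma> + w powr \<beta>) * f x))"

lemma potter:
  shows "0 < potter_C" "0 < potter_x"
    and "p \<in> A \<Longrightarrow> potter_x \<le> x \<Longrightarrow> 0 < w \<Longrightarrow> G p (x / w) \<le> potter_C * (w powr \<gamma> + w powr \<beta>) * f x"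
proof -
  have "\<exists>C x0. 0 < C \<and> 0 < x0 \<and>
    (\<forall>p x w. p \<in> A \<longrightarrow> x0 \<le> x \<longrightarrow> 0 < w \<longrightarrow> G p (x / w) \<le> C * (w powr \<gamma> + w powr \<beta>) * f x)"
    by (rule claim_tail_potter) (intro exI conjI allI impI)
  then have "\<exists>x0. 0 < potter_C \<and> 0 < x0 \<and>
    (\<forall>p x w. p \<in> A \<longrightarrow> x0 \<le> x \<longrightarrow> 0 < w \<longrightarrow> G p (x / w) \<le> potter_C * (w powr \<gamma> + w powr \<beta>) * f x)"
    unfolding potter_C_def by (rule someI_ex)
  then have "0 < potter_C \<and> 0 < potter_x \<and>
    (\<forall>p x w. p \<in> A \<longrightarrow> potter_x \<le> x \<longrightarrow> 0 < w \<longrightarrow> G p (x / w) \<le> potter_C * (w powr \<gamma> + w powr \<beta>) * f x)"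
    unfolding potter_x_def by (rule someI_ex)
  then show "0 < potter_C" "0 < potter_x"
    "p \<in> A \<Longrightarrow> potter_x \<le> x \<Longrightarrow> 0 < w \<Longrightarrow> G p (x / w) \<le> potter_C * (w powr \<gamma> + w powr \<beta>) * f x" by auto
qed

lemma W_moment_\<alpha>:
  assumes p: "p \<in> A"
  shows "integrable M (\<lambda>\<omega>. W p i \<omega> powr \<alpha>)" "expectation (\<lambda>\<omega>. W p i \<omega> powr \<alpha>) \<le> 2 * \<kappa> * \<rho> ^ i"
proof -
  note [measurable] = W_rv[OF p]
  have le: "w powr \<alpha> \<le> w powr \<gamma> + w powr \<beta>" if "0 < w" for w :: real
  proof (cases "w \<le> 1")
    case True
    then have "w powr \<alpha> \<le> w powr \<gamma>" using that exponents by (intro powr_mono') auto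
    then show ?thesis by (simp add: add_increasing2)
  next
    case False
    then have "w powr \<alpha> \<le> w powr \<beta>" using exponents by (intro powr_mono) auto
    then show ?thesis by (simp add: add_increasing)
  qed
  have int: "integrable M (\<lambda>\<omega>. W p i \<omega> powr \<gamma> + W p i \<omega> powr \<beta>)"
    using W_moment[OF p] by (intro Bochner_Integration.integrable_add) auto
  show "integrable M (\<lambda>\<omega>. W p i \<omega> powr \<alpha>)"
    by (rule Bochner_Integration.integrable_bound[OF int]) (use le W_pos[OF p] in auto)
  then have "expectation (\<lambda>\<omega>. W p i \<omega> powr \<alpha>) \<le> expectation (\<lambda>\<omega>. W p i \<omega> powr \<gamma> + W p i \<omega> powr \<beta>)"
    using int le W_pos[OF p] by (intro integral_mono) auto
  also have "\<dots> = expectation (\<lambda>\<omega>. W p i \<omega> powr \<gamma>) + expectation (\<lambda>\<omega>. W p i \<omega> powr \<beta>)"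
    using W_moment[OF p] by (intro Bochner_Integration.integral_add) auto
  finally show "expectation (\<lambda>\<omega>. W p i \<omega> powr \<alpha>) \<le> 2 * \<kappa> * \<rho> ^ i"
    using W_moment(2)[OF p, of \<gamma> i] W_moment(2)[OF p, of \<beta> i] by simp
qed

text \<open>With weight and time frozen, the event says that the claim exceeds \<open>y / w\<close>,
  and Tonelli integrates its tail over the law of the pair. A set \<open>H\<close> in both
  coordinates serves arrival windows as well as cuts on the size of the weight.\<close>

lemma prob_product:
  assumes p: "p \<in> A" and H: "H \<in> sets (borel \<Otimes>\<^sub>M borel)"
  shows "prob {\<omega> \<in> space M. y < X p i \<omega> * W p i \<omega> \<and> (W p i \<omega>, \<tau> p i \<omega>) \<in> H}
    = expectation (\<lambda>\<omega>. G p (y / W p i \<omega>) * indicator H (W p i \<omega>, \<tau> p i \<omega>))"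
proof -
  note [measurable] = X_rv[OF p, of i] W_rv[OF p, of i] \<tau>_rv[OF p, of i] H G_measurable[OF p]
  let ?U = "\<lambda>\<omega>. (W p i \<omega>, \<tau> p i \<omega>)"
  let ?E = "{(x, w, t). y < x * w \<and> (w, t) \<in> H \<and> 0 < w} :: (real \<times> real \<times> real) set"
  interpret D: prob_space "distr M borel (X p i)" by (rule prob_space_distr) measurable
  interpret D2: prob_space "distr M (borel \<Otimes>\<^sub>M borel) ?U" by (rule prob_space_distr) measurable
  interpret pair_sigma_finite "distr M borel (X p i)" "distr M (borel \<Otimes>\<^sub>M borel) ?U" by unfold_locales
  have "?E = {z \<in> space (borel \<Otimes>\<^sub>M (borel \<Otimes>\<^sub>M borel)). y < fst z * fst (snd z) \<and> snd z \<in> H \<and> 0 < fst (snd z)}"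
    by (auto simp: space_pair_measure)
  also have "\<dots> \<in> sets (borel \<Otimes>\<^sub>M (borel \<Otimes>\<^sub>M borel))" by measurable
  finally have E[measurable]: "?E \<in> sets (borel \<Otimes>\<^sub>M (borel \<Otimes>\<^sub>M borel))" .
  have "emeasure M {\<omega> \<in> space M. y < X p i \<omega> * W p i \<omega> \<and> ?U \<omega> \<in> H}
     = emeasure (distr M (borel \<Otimes>\<^sub>M (borel \<Otimes>\<^sub>M borel)) (\<lambda>\<omega>. (X p i \<omega>, ?U \<omega>))) ?E"
    by (subst emeasure_distr) (use W_pos[OF p] in \<open>auto intro!: arg_cong[of _ _ "emeasure M"]\<close>)
  also have "distr M (borel \<Otimes>\<^sub>M (borel \<Otimes>\<^sub>M borel)) (\<lambda>\<omega>. (X p i \<omega>, ?U \<omega>))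
      = distr M borel (X p i) \<Otimes>\<^sub>M distr M (borel \<Otimes>\<^sub>M borel) ?U"
    by (rule indep[OF p])
  also have "emeasure \<dots> ?E = (\<integral>\<^sup>+u. emeasure (distr M borel (X p i)) ((\<lambda>x. (x, u)) -` ?E) \<partial>distr M (borel \<Otimes>\<^sub>M borel) ?U)"
    by (rule emeasure_pair_measure_alt2) measurable
  also have "\<dots> = (\<integral>\<^sup>+\<omega>. emeasure (distr M borel (X p i)) ((\<lambda>x. (x, ?U \<omega>)) -` ?E) \<partial>M)"
    by (rule nn_integral_distr) measurable
  also have "\<dots> = (\<integral>\<^sup>+\<omega>. ennreal (G p (y / W p i \<omega>) * indicator H (?U \<omega>)) \<partial>M)"
  proof (rule nn_integral_cong)
    fix \<omega> assume \<omega>: "\<omega> \<in> space M"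
    note w = W_pos[OF p \<omega>, of i]
    have "(\<lambda>x. (x, ?U \<omega>)) -` ?E = (if ?U \<omega> \<in> H then {y / W p i \<omega> <..} else {})"
      using w by (auto simp: field_simps)
    moreover have "emeasure (distr M borel (X p i)) {y / W p i \<omega> <..} = ennreal (G p (y / W p i \<omega>))"
      by (simp add: emeasure_distr emeasure_eq_measure X_tail[OF p, of _ i, symmetric] vimage_def Int_def conj_commute)
    ultimately show "emeasure (distr M borel (X p i)) ((\<lambda>x. (x, ?U \<omega>)) -` ?E) =
        ennreal (G p (y / W p i \<omega>) * indicator H (?U \<omega>))" by simp
  qed
  finally have *: "emeasure M {\<omega> \<in> space M. y < X p i \<omega> * W p i \<omega> \<and> ?U \<omega> \<in> H} = \<dots>" .
  show ?thesis
    unfolding measure_def *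
    by (subst integral_eq_nn_integral) (use G_bounds[OF p] in auto)
qed

text \<open>The factor \<open>s\<close> is absorbed into the weight,
  \<open>s * x / w = x / (w / s)\<close>, so that arbitrarily small \<open>s\<close> share the one
  threshold \<open>potter_x\<close>.\<close>

lemma prob_product_le:
  assumes p: "p \<in> A" and H: "H \<in> sets (borel \<Otimes>\<^sub>M borel)" and "potter_x \<le> x" "0 < s"
  shows "prob {\<omega> \<in> space M. s * x < X p i \<omega> * W p i \<omega> \<and> (W p i \<omega>, \<tau> p i \<omega>) \<in> H}
    \<le> potter_C * f x * expectation (\<lambda>\<omega>. ((W p i \<omega> / s) powr \<gamma> + (W p i \<omega> / s) powr \<beta>) * indicator H (W p i \<omega>, \<tau> p i \<omega>))"
proof -
  note [measurable] = X_rv[OF p, of i] W_rv[OF p, of i] \<tau>_rv[OF p, of i] H G_measurable[OF p]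
  have W: "0 \<le> W p i \<omega>" if "\<omega> \<in> space M" for \<omega> using W_pos[OF p that] by (simp add: less_imp_le)
  have int: "integrable M (\<lambda>\<omega>. ((W p i \<omega> / s) powr \<gamma> + (W p i \<omega> / s) powr \<beta>))"
  proof (rule Bochner_Integration.integrable_cong[THEN iffD2, OF refl])
    show "integrable M (\<lambda>\<omega>. W p i \<omega> powr \<gamma> / s powr \<gamma> + W p i \<omega> powr \<beta> / s powr \<beta>)"
      using W_moment(1)[OF p] by auto
  qed (use assms W in \<open>auto simp: powr_divide\<close>)
  have int': "integrable M (\<lambda>\<omega>. ((W p i \<omega> / s) powr \<gamma> + (W p i \<omega> / s) powr \<beta>) * indicator H (W p i \<omega>, \<tau> p i \<omega>))"
    by (rule Bochner_Integration.integrable_bound[OF int]) (auto simp: indicator_def)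
  have "expectation (\<lambda>\<omega>. G p (s * x / W p i \<omega>) * indicator H (W p i \<omega>, \<tau> p i \<omega>))
    \<le> expectation (\<lambda>\<omega>. potter_C * f x * (((W p i \<omega> / s) powr \<gamma> + (W p i \<omega> / s) powr \<beta>) * indicator H (W p i \<omega>, \<tau> p i \<omega>)))"
  proof (rule integral_mono)
    show "integrable M (\<lambda>\<omega>. G p (s * x / W p i \<omega>) * indicator H (W p i \<omega>, \<tau> p i \<omega>))"
      by (rule integrable_const_bound[of _ 1]) (use G_bounds[OF p] in \<open>auto simp: indicator_def\<close>)
    show "integrable M (\<lambda>\<omega>. potter_C * f x * (((W p i \<omega> / s) powr \<gamma> + (W p i \<omega> / s) powr \<beta>) * indicator H (W p i \<omega>, \<tau> p i \<omega>)))"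
      using int' by simp
    fix \<omega> assume \<omega>: "\<omega> \<in> space M"
    show "G p (s * x / W p i \<omega>) * indicator H (W p i \<omega>, \<tau> p i \<omega>)
      \<le> potter_C * f x * (((W p i \<omega> / s) powr \<gamma> + (W p i \<omega> / s) powr \<beta>) * indicator H (W p i \<omega>, \<tau> p i \<omega>))"
      using potter(3)[OF p assms(3), of "W p i \<omega> / s"] W_pos[OF p \<omega>, of i] \<open>0 < s\<close>
      by (auto simp: indicator_def mult_ac)
  qed
  then show ?thesis by (simp add: prob_product[OF p H])
qed

text \<open>Breiman's lemma, phrased as a vanishing difference because the windows
  \<open>B n\<close> vary and the weights need not converge. The integrand \<open>h n\<close> tends
  to 0 pointwise whatever the windows are, and Potter's bound dominates it by powers of the weight
  of orders \<gamma>, \<beta> and \<alpha>.\<close>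

lemma breiman:
  assumes p: "p \<in> A" and B: "\<And>n::nat. B n \<in> sets borel"
    and x: "filterlim x at_top sequentially" and v: "0 < v"
  shows "(\<lambda>n. prob {\<omega> \<in> space M. v * x n < X p i \<omega> * W p i \<omega> \<and> \<tau> p i \<omega> \<in> B n} / f (x n)
     - v powr - \<alpha> * (a p * expectation (\<lambda>\<omega>. W p i \<omega> powr \<alpha> * indicator (B n) (\<tau> p i \<omega>)))) \<longlonglongrightarrow> 0"
proof -
  note [measurable] = X_rv[OF p, of i] W_rv[OF p, of i] \<tau>_rv[OF p, of i] B G_measurable[OF p]
  define h where "h n \<omega> = (G p (v * x n / W p i \<omega>) / f (x n) - v powr - \<alpha> * a p * W p i \<omega> powr \<alpha>)" for n \<omega>
  have [measurable]: "h n \<in> borel_measurable M" for n unfolding h_def by measurable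
  have intA: "integrable M (\<lambda>\<omega>. W p i \<omega> powr \<alpha> * indicator (B n) (\<tau> p i \<omega>))" for n
    by (rule Bochner_Integration.integrable_bound[OF W_moment_\<alpha>(1)[OF p, of i]]) (auto simp: indicator_def)
  have intG: "integrable M (\<lambda>\<omega>. G p (v * x n / W p i \<omega>) * indicator (B n) (\<tau> p i \<omega>))" for n
    by (rule integrable_const_bound[of _ 1]) (use G_bounds[OF p] in \<open>auto simp: indicator_def\<close>)
  have eq: "prob {\<omega> \<in> space M. v * x n < X p i \<omega> * W p i \<omega> \<and> \<tau> p i \<omega> \<in> B n} / f (x n)
     - v powr - \<alpha> * (a p * expectation (\<lambda>\<omega>. W p i \<omega> powr \<alpha> * indicator (B n) (\<tau> p i \<omega>)))
     = expectation (\<lambda>\<omega>. h n \<omega> * indicator (B n) (\<tau> p i \<omega>))" for n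
  proof -
    have "prob {\<omega> \<in> space M. v * x n < X p i \<omega> * W p i \<omega> \<and> \<tau> p i \<omega> \<in> B n}
       = expectation (\<lambda>\<omega>. G p (v * x n / W p i \<omega>) * indicator (UNIV \<times> B n) (W p i \<omega>, \<tau> p i \<omega>))"
      using prob_product[OF p, of "UNIV \<times> B n" "v * x n" i] by simp
    then have *: "prob {\<omega> \<in> space M. v * x n < X p i \<omega> * W p i \<omega> \<and> \<tau> p i \<omega> \<in> B n}
       = expectation (\<lambda>\<omega>. G p (v * x n / W p i \<omega>) * indicator (B n) (\<tau> p i \<omega>))"
      by (simp add: indicator_times)
    have "expectation (\<lambda>\<omega>. h n \<omega> * indicator (B n) (\<tau> p i \<omega>)) =
       expectation (\<lambda>\<omega>. 1 / f (x n) * (G p (v * x n / W p i \<omega>) * indicator (B n) (\<tau> p i \<omega>))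
         - v powr - \<alpha> * a p * (W p i \<omega> powr \<alpha> * indicator (B n) (\<tau> p i \<omega>)))"
      by (intro Bochner_Integration.integral_cong) (auto simp: h_def algebra_simps)
    also have "\<dots> = expectation (\<lambda>\<omega>. 1 / f (x n) * (G p (v * x n / W p i \<omega>) * indicator (B n) (\<tau> p i \<omega>)))
         - expectation (\<lambda>\<omega>. v powr - \<alpha> * a p * (W p i \<omega> powr \<alpha> * indicator (B n) (\<tau> p i \<omega>)))"
      by (intro Bochner_Integration.integral_diff integrable_mult_right intA intG)
    finally show ?thesis by (simp add: *)
  qed
  have "eventually (\<lambda>n. potter_x \<le> x n) sequentially" using x unfolding filterlim_at_top by blast
  \<comment> \<open>Potter's bound starts at \<open>potter_x\<close>; shifting the sequence by
    \<open>n0\<close> makes the domination valid for every index.\<close>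
  then obtain n0 where n0: "\<And>n. n0 \<le> n \<Longrightarrow> potter_x \<le> x n" unfolding eventually_sequentially by blast
  have lim: "(\<lambda>n. expectation (\<lambda>\<omega>. h (n + n0) \<omega> * indicator (B (n + n0)) (\<tau> p i \<omega>))) \<longlonglongrightarrow> expectation (\<lambda>\<omega>. 0)"
  proof (rule integral_dominated_convergence)
    let ?w = "\<lambda>\<omega>. potter_C * (W p i \<omega> powr \<gamma> / v powr \<gamma> + W p i \<omega> powr \<beta> / v powr \<beta>) + v powr - \<alpha> * a p * W p i \<omega> powr \<alpha>"
    show "integrable M ?w" using W_moment(1)[OF p] W_moment_\<alpha>(1)[OF p] by auto
    show "AE \<omega> in M. (\<lambda>n. h (n + n0) \<omega> * indicator (B (n + n0)) (\<tau> p i \<omega>)) \<longlonglongrightarrow> 0"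
    proof (rule AE_I2)
      fix \<omega> assume \<omega>: "\<omega> \<in> space M"
      define w where "w = W p i \<omega>"
      have w: "0 < w" using W_pos[OF p \<omega>] by (simp add: w_def)
      have xw: "filterlim (\<lambda>n. v / w * x n) at_top sequentially"
        by (rule filterlim_tendsto_pos_mult_at_top[OF tendsto_const _ x]) (use w v in simp)
      have "(\<lambda>n. G p (v / w * x n) / f (v / w * x n) * (f (v / w * x n) / f (x n))) \<longlonglongrightarrow> a p * (v / w) powr - \<alpha>"
        by (intro tendsto_mult filterlim_compose[OF G_equiv[OF p] xw] rv_ratio_seq[OF x tendsto_const])
           (use w v in simp)
      moreover have "G p (v / w * x n) / f (v / w * x n) * (f (v / w * x n) / f (x n)) = G p (v * x n / w) / f (x n)" for n
        by (simp add: f_nonzero)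
      moreover have "a p * (v / w) powr - \<alpha> = v powr - \<alpha> * a p * w powr \<alpha>"
        using w v by (simp add: powr_divide powr_minus field_simps)
      ultimately have "(\<lambda>n. G p (v * x n / w) / f (x n)) \<longlonglongrightarrow> v powr - \<alpha> * a p * w powr \<alpha>" by (simp only:)
      from LIM_zero[OF this]
      have "(\<lambda>n. h n \<omega>) \<longlonglongrightarrow> 0" unfolding h_def w_def by simp
      then have "(\<lambda>n. h (n + n0) \<omega>) \<longlonglongrightarrow> 0" by (rule LIMSEQ_ignore_initial_segment)
      then show "(\<lambda>n. h (n + n0) \<omega> * indicator (B (n + n0)) (\<tau> p i \<omega>)) \<longlonglongrightarrow> 0"
        by (rule tendsto_0_le[where K = 1]) (auto simp: indicator_def)
    qed
    fix n
    show "AE \<omega> in M. norm (h (n + n0) \<omega> * indicator (B (n + n0)) (\<tau> p i \<omega>)) \<le> ?w \<omega>"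
    proof (rule AE_I2)
      fix \<omega> assume \<omega>: "\<omega> \<in> space M"
      have "G p (x (n + n0) / (W p i \<omega> / v)) \<le> potter_C * ((W p i \<omega> / v) powr \<gamma> + (W p i \<omega> / v) powr \<beta>) * f (x (n + n0))"
        using W_pos[OF p \<omega>, of i] v n0 by (intro potter(3)[OF p]) auto
      then have "G p (v * x (n + n0) / W p i \<omega>) / f (x (n + n0)) \<le> potter_C * (W p i \<omega> powr \<gamma> / v powr \<gamma> + W p i \<omega> powr \<beta> / v powr \<beta>)"
        using W_pos[OF p \<omega>, of i] v f_pos[of "x (n + n0)"] by (simp add: field_simps powr_divide)
      moreover have "0 \<le> G p (v * x (n + n0) / W p i \<omega>) / f (x (n + n0))"
        using G_bounds(1)[OF p] f_pos by (simp add: less_imp_le)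
      moreover have "0 \<le> v powr - \<alpha> * a p * W p i \<omega> powr \<alpha>" using a_nonneg[OF p] by simp
      ultimately have "\<bar>h (n + n0) \<omega>\<bar> \<le> ?w \<omega>" unfolding h_def by linarith
      then show "norm (h (n + n0) \<omega> * indicator (B (n + n0)) (\<tau> p i \<omega>)) \<le> ?w \<omega>"
        by (auto simp: indicator_def)
    qed
  qed (auto)
  then have "(\<lambda>n. expectation (\<lambda>\<omega>. h (n + n0) \<omega> * indicator (B (n + n0)) (\<tau> p i \<omega>))) \<longlonglongrightarrow> 0" by simp
  from LIMSEQ_offset[OF this] show ?thesis unfolding eq .
qed

end

section \<open>Sums with at most one large term, and Bonferroni's inequality\<close>

lemma sum_le_one_large:
  fixes T :: "'i \<Rightarrow> real" and b e :: real
  assumes "finite J" and le: "\<And>i. i \<in> J \<Longrightarrow> T i \<le> b" and "0 \<le> b" "0 \<le> e"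
    and one: "\<And>i j. i \<in> J \<Longrightarrow> j \<in> J \<Longrightarrow> i \<noteq> j \<Longrightarrow> T i \<le> e \<or> T j \<le> e"
  shows "sum T J \<le> b + card J * e"
proof (cases "\<exists>i\<in>J. e < T i")
  case True
  then obtain i where i: "i \<in> J" "e < T i" by blast
  have "sum T J = T i + sum T (J - {i})" using i assms(1) by (simp add: sum.remove)
  also have "sum T (J - {i}) \<le> (\<Sum>j\<in>J - {i}. e)"
    by (intro sum_mono) (use one i in fastforce)
  also have "\<dots> \<le> card J * e" using assms by (auto intro!: mult_right_mono card_mono)
  finally show ?thesis using le[OF i(1)] by simp
next
  case False
  then have "sum T J \<le> (\<Sum>j\<in>J. e)" by (intro sum_mono) auto
  then show ?thesis using assms by simp
qed

text \<open>Counting ordered pairs doubles a sum that turns out to be negligible, and makes sense on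
  an index set without order.\<close>

lemma (in prob_space) bonferroni_lower:
  assumes "finite J" "\<And>i. i \<in> J \<Longrightarrow> E i \<in> events"
  shows "(\<Sum>i\<in>J. prob (E i)) \<le> prob (\<Union>i\<in>J. E i) + (\<Sum>i\<in>J. \<Sum>j\<in>J - {i}. prob (E i \<inter> E j))"
  using assms
proof (induction J)
  case (insert k J)
  have U: "(\<Union>i\<in>J. E i) \<in> events" using insert by (intro sets.finite_UN) auto
  have "prob (E k \<inter> (\<Union>i\<in>J. E i)) = prob (\<Union>i\<in>J. E k \<inter> E i)" by (intro arg_cong[of _ _ prob]) auto
  also have "\<dots> \<le> (\<Sum>i\<in>J. prob (E k \<inter> E i))"
    using insert by (intro measure_UNION_le) auto
  finally have 1: "prob (E k \<inter> (\<Union>i\<in>J. E i)) \<le> (\<Sum>i\<in>J. prob (E k \<inter> E i))" .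
  have "prob (\<Union>i\<in>insert k J. E i) = prob (E k) + prob (\<Union>i\<in>J. E i) - prob (E k \<inter> (\<Union>i\<in>J. E i))"
    using measure_Un3[of "E k" M "\<Union>i\<in>J. E i"] insert U by (simp add: fmeasurable_eq_sets)
  moreover have "(\<Sum>i\<in>J. \<Sum>j\<in>J - {i}. prob (E i \<inter> E j)) \<le> (\<Sum>i\<in>J. \<Sum>j\<in>insert k J - {i}. prob (E i \<inter> E j))"
    by (intro sum_mono sum_mono2) (use insert in auto)
  ultimately show ?case using insert 1 by simp
qed simp

section \<open>Two large claims, and late claims\<close>

context heavy_tailed_sums
begin

abbreviation V where "V p i \<omega> \<equiv> X p i \<omega> * W p i \<omega>"

lemma V_rv: "p \<in> A \<Longrightarrow> V p i \<in> borel_measurable M"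
  using X_rv W_rv by measurable

lemma V_nonneg: "p \<in> A \<Longrightarrow> \<omega> \<in> space M \<Longrightarrow> 0 \<le> V p i \<omega>"
  using X_nonneg W_pos by (simp add: less_imp_le)

lemma f_ratio: "filterlim x at_top sequentially \<Longrightarrow> 0 < v \<Longrightarrow>
    (\<lambda>n. f (v * x n) / f (x n)) \<longlonglongrightarrow> v powr - \<alpha>"
  by (rule rv_ratio_seq) auto

text \<open>By Potter's bound the part with a weight above \<open>Suc m\<close> is of order
  \<open>large p i m * f (x n)\<close>, small for large \<open>m\<close>. If both weights are at
  most \<open>Suc m\<close>, two large products force both claims above a fixed multiple of
  \<open>x n\<close>, and \<open>pair_negligible\<close> applies. The dependence between the two
  weights never enters.\<close>

lemma two_large_negligible:
  assumes p: "p \<in> A" and q: "q \<in> A" and ne: "(p, i) \<noteq> (q, j)"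
    and x: "filterlim x at_top sequentially" and v: "0 < v"
  shows "(\<lambda>n. prob {\<omega> \<in> space M. v * x n < V p i \<omega> \<and> v * x n < V q j \<omega>} / f (x n)) \<longlonglongrightarrow> 0"
proof -
  note [measurable] = X_rv[OF p, of i] W_rv[OF p, of i] X_rv[OF q, of j] W_rv[OF q, of j]
    \<tau>_rv[OF p, of i] \<tau>_rv[OF q, of j]
  define large where "large p i m = expectation (\<lambda>\<omega>. ((W p i \<omega> / v) powr \<gamma> + (W p i \<omega> / v) powr \<beta>)
      * indicator ({real (Suc m)<..} \<times> UNIV) (W p i \<omega>, \<tau> p i \<omega>))" for p i and m :: nat
  have large_lim: "large p i \<longlonglongrightarrow> 0" if p: "p \<in> A" for p i
  proof -
    note [measurable] = W_rv[OF p, of i] \<tau>_rv[OF p, of i]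
    have W: "0 \<le> W p i \<omega>" if "\<omega> \<in> space M" for \<omega> using W_pos[OF p that] by (simp add: less_imp_le)
    have int: "integrable M (\<lambda>\<omega>. ((W p i \<omega> / v) powr \<gamma> + (W p i \<omega> / v) powr \<beta>))"
    proof (rule Bochner_Integration.integrable_cong[THEN iffD2, OF refl])
      show "integrable M (\<lambda>\<omega>. W p i \<omega> powr \<gamma> / v powr \<gamma> + W p i \<omega> powr \<beta> / v powr \<beta>)"
        using W_moment(1)[OF p] by auto
    qed (use v W in \<open>auto simp: powr_divide\<close>)
    have "large p i \<longlonglongrightarrow> expectation (\<lambda>\<omega>. 0)"
      unfolding large_def
    proof (rule integral_dominated_convergence[OF _ _ int])
      show "AE \<omega> in M. (\<lambda>m. ((W p i \<omega> / v) powr \<gamma> + (W p i \<omega> / v) powr \<beta>)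
          * indicator ({real (Suc m)<..} \<times> UNIV) (W p i \<omega>, \<tau> p i \<omega>)) \<longlonglongrightarrow> 0"
      proof (rule AE_I2)
        fix \<omega>
        have "eventually (\<lambda>m. W p i \<omega> \<le> real (Suc m)) sequentially"
          using eventually_ge_at_top[of "nat \<lceil>W p i \<omega>\<rceil>"] by eventually_elim linarith
        then show "(\<lambda>m. ((W p i \<omega> / v) powr \<gamma> + (W p i \<omega> / v) powr \<beta>)
          * indicator ({real (Suc m)<..} \<times> UNIV) (W p i \<omega>, \<tau> p i \<omega>)) \<longlonglongrightarrow> 0"
          by (intro tendsto_eventually, eventually_elim) simp
      qed
    qed (auto simp: indicator_def)
    then show ?thesis by simp
  qed
  have evx: "eventually (\<lambda>n. potter_x \<le> x n) sequentially" using x unfolding filterlim_at_top by blast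
  show ?thesis
  proof (rule LIMSEQ_I)
      fix e :: real assume e: "0 < e"
      have "(\<lambda>m. potter_C * large p i m + potter_C * large q j m) \<longlonglongrightarrow> potter_C * 0 + potter_C * 0"
        using large_lim p q by (intro tendsto_intros) auto
      then have "eventually (\<lambda>m. potter_C * large p i m + potter_C * large q j m < e / 2) sequentially"
        using e by (intro order_tendstoD(2)) auto
      then obtain m where m: "potter_C * large p i m + potter_C * large q j m < e / 2"
        by (auto simp: eventually_sequentially)
      \<comment> \<open>A product above \<open>v * x n\<close> with a weight of at most
        \<open>Suc m\<close> forces the claim alone above \<open>b * x n\<close>.\<close>
      define b where "b = v / Suc m"
      have b: "0 < b" using v by (simp add: b_def)
      have bx: "filterlim (\<lambda>n. b * x n) at_top sequentially"
        by (rule filterlim_tendsto_pos_mult_at_top[OF tendsto_const b x])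
      let ?P = "\<lambda>y. prob {\<omega> \<in> space M. y < X p i \<omega> \<and> y < X q j \<omega>}"
      have "(\<lambda>n. ?P (b * x n) / f (b * x n) * (f (b * x n) / f (x n))) \<longlonglongrightarrow> 0 * b powr - \<alpha>"
        by (intro tendsto_mult filterlim_compose[OF pair_negligible[OF p q ne] bx] f_ratio[OF x b])
      then have "(\<lambda>n. ?P (b * x n) / f (x n)) \<longlonglongrightarrow> 0" by (simp add: f_nonzero)
      then have "eventually (\<lambda>n. ?P (b * x n) / f (x n) < e / 2) sequentially"
        using e by (intro order_tendstoD(2)) auto
      then have "eventually (\<lambda>n. prob {\<omega> \<in> space M. v * x n < V p i \<omega> \<and> v * x n < V q j \<omega>} / f (x n) < e) sequentially"
        using evx
      proof eventually_elim
        case (elim n)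
        let ?L = "\<lambda>p i. {\<omega> \<in> space M. v * x n < V p i \<omega> \<and> (W p i \<omega>, \<tau> p i \<omega>) \<in> {real (Suc m)<..} \<times> UNIV}"
        have sub: "b * x n < X p i \<omega>" if "p \<in> A" "\<omega> \<in> space M" "v * x n < V p i \<omega>" "W p i \<omega> \<le> real (Suc m)" for p i \<omega>
        proof -
          have "v * x n < X p i \<omega> * real (Suc m)"
            using that X_nonneg[OF that(1,2)] by (meson less_le_trans mult_left_mono)
          then show ?thesis by (simp add: b_def field_simps)
        qed
        have "prob {\<omega> \<in> space M. v * x n < V p i \<omega> \<and> v * x n < V q j \<omega>}
           \<le> prob ({\<omega> \<in> space M. b * x n < X p i \<omega> \<and> b * x n < X q j \<omega>} \<union> (?L p i \<union> ?L q j))"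
        proof (rule finite_measure_mono)
          show "{\<omega> \<in> space M. v * x n < V p i \<omega> \<and> v * x n < V q j \<omega>}
             \<subseteq> {\<omega> \<in> space M. b * x n < X p i \<omega> \<and> b * x n < X q j \<omega>} \<union> (?L p i \<union> ?L q j)"
            using sub[OF p, of _ i] sub[OF q, of _ j] by (auto simp del: of_nat_Suc) (metis not_less)+
        qed measurable
        also have "\<dots> \<le> ?P (b * x n) + (prob (?L p i) + prob (?L q j))"
          by (intro order_trans[OF measure_Un_le] add_mono order_refl measure_Un_le) measurable
        also have "\<dots> \<le> ?P (b * x n) + (potter_C * f (x n) * large p i m + potter_C * f (x n) * large q j m)"
          unfolding large_def using elim v p q by (intro add_mono order_refl prob_product_le) auto
        finally have "prob {\<omega> \<in> space M. v * x n < V p i \<omega> \<and> v * x n < V q j \<omega>} / f (x n)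
           \<le> ?P (b * x n) / f (x n) + (potter_C * large p i m + potter_C * large q j m)"
          using f_pos[of "x n"] by (simp add: field_simps)
        then show ?case using elim m by linarith
      qed
      moreover have "0 \<le> prob {\<omega> \<in> space M. v * x n < V p i \<omega> \<and> v * x n < V q j \<omega>} / f (x n)" for n
        using f_pos[of "x n"] by simp
      ultimately show "\<exists>no. \<forall>n\<ge>no. norm (prob {\<omega> \<in> space M. v * x n < V p i \<omega> \<and> v * x n < V q j \<omega>} / f (x n) - 0) < e"
      unfolding eventually_sequentially by (simp add: abs_of_pos f_pos)
  qed
qed

text \<open>The sum of the \<open>V p i\<close> over \<open>i \<ge> N\<close> can exceed \<open>\<delta> * x\<close> only if some summand exceeds its share
  \<open>\<delta> * share i * x\<close>. The shares decrease so slowly that \<open>\<rho> ^ i * share i powr - \<beta>\<close> is still summable, so a union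
  bound suffices; no joint law of the claims is needed.\<close>

definition share :: "nat \<Rightarrow> real" where "share i = (1 - \<rho> powr (1 / (2 * \<beta>))) * (\<rho> powr (1 / (2 * \<beta>))) ^ i"

definition late_jump where "late_jump \<delta> N x = {\<omega> \<in> space M. \<exists>p\<in>A. \<exists>i\<ge>N. \<delta> * share i * x < V p i \<omega>}"

text \<open>The exponent \<open>1 / (2 * \<beta>)\<close> in the shares makes
  \<open>share i powr - \<beta>\<close> grow like \<open>\<rho> powr (- i / 2)\<close>; against
  moments of order \<open>\<rho> ^ i\<close> the ratio \<open>sqrt \<rho>\<close> is left.\<close>

definition share_ratio where "share_ratio = sqrt \<rho>"

lemma share_ratio: "0 < share_ratio" "share_ratio < 1" using \<rho> by (auto simp: share_ratio_def)

lemma share: "0 < share i" "share i \<le> 1" "share sums 1"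
proof -
  define s where "s = \<rho> powr (1 / (2 * \<beta>))"
  have s: "0 < s" "s < 1"
    unfolding s_def using \<rho> exponents powr_less_mono2[of "1 / (2 * \<beta>)" \<rho> 1] by auto
  show "0 < share i" using s by (simp add: share_def s_def[symmetric])
  show "share i \<le> 1" using s unfolding share_def s_def[symmetric] by (intro mult_le_one power_le_one) auto
  have "(\<lambda>i. (1 - s) * s ^ i) sums ((1 - s) * (1 / (1 - s)))"
    using s by (intro sums_mult geometric_sums) auto
  then show "share sums 1" using s by (simp add: share_def[abs_def] s_def[symmetric])
qed

lemma late_jump_event: "late_jump \<delta> N x \<in> events"
proof -
  have "late_jump \<delta> N x = (\<Union>p\<in>A. \<Union>i\<in>{N..}. {\<omega> \<in> space M. \<delta> * share i * x < V p i \<omega>})"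
    by (auto simp: late_jump_def)
  also have "\<dots> \<in> events"
    using finite_A V_rv by (intro sets.finite_UN sets.countable_UN' borel_measurable_less) auto
  finally show ?thesis .
qed

text \<open>Each single event costs moments of \<open>W / (\<delta> * share i)\<close>, which decay
  like \<open>share_ratio ^ i\<close>; summing from \<open>N\<close> on gives the geometric factor.
  One constant serves all \<open>N\<close> and \<open>x\<close>, so \<open>N\<close> can be fixed
  before the level grows.\<close>

lemma prob_late_jump_le:
  assumes "0 < \<delta>"
  obtains K where "0 \<le> K" "\<And>N x. potter_x \<le> x \<Longrightarrow> prob (late_jump \<delta> N x) \<le> K * share_ratio ^ N * f x"
proof -
  define s where "s = \<rho> powr (1 / (2 * \<beta>))"
  have s: "0 < s" "s < 1"
    unfolding s_def using \<rho> exponents powr_less_mono2[of "1 / (2 * \<beta>)" \<rho> 1] by auto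
  have \<kappa>: "0 \<le> \<kappa>" if "p \<in> A" for p
  proof -
    have "0 \<le> expectation (\<lambda>\<omega>. W p 0 \<omega> powr \<gamma>)" by (intro integral_nonneg_AE) auto
    also have "\<dots> \<le> \<kappa>" using W_moment(2)[OF that, of \<gamma> 0] by simp
    finally show ?thesis .
  qed
  define c where "c = (\<delta> powr - \<gamma> + \<delta> powr - \<beta>) * (1 - s) powr - \<beta> * \<kappa>"
  have single: "prob {\<omega> \<in> space M. \<delta> * share i * x < V p i \<omega>} \<le> potter_C * c * share_ratio ^ i * f x"
    if p: "p \<in> A" and x: "potter_x \<le> x" for p i x
  proof -
    note [measurable] = X_rv[OF p, of i] W_rv[OF p, of i]
    have W: "0 \<le> W p i \<omega>" if "\<omega> \<in> space M" for \<omega> using W_pos[OF p that] by (simp add: less_imp_le)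
    have dw: "0 < \<delta> * share i" using assms share(1) by simp
    \<comment> \<open>The shares are at most 1, so \<beta> is the worst exponent;
      \<open>(s ^ i) powr - \<beta> = \<rho> powr (- i / 2)\<close> consumes half of the decay
      \<open>\<rho> ^ i\<close>.\<close>
    have wtb: "share i powr - e * \<rho> ^ i \<le> (1 - s) powr - \<beta> * share_ratio ^ i" if "e \<le> \<beta>" for e
    proof -
      have "share i powr - e \<le> share i powr - \<beta>" using that share(1,2)[of i] by (intro powr_mono') auto
      also have "share i powr - \<beta> = (1 - s) powr - \<beta> * (s ^ i) powr - \<beta>"
        using s unfolding share_def s_def[symmetric] by (subst powr_mult) auto
      also have "(s ^ i) powr - \<beta> = \<rho> powr (- 1 / 2 * i)"
        unfolding s_def using \<rho> exponents by (simp add: powr_realpow[symmetric] powr_powr)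
      finally have "share i powr - e * \<rho> ^ i \<le> (1 - s) powr - \<beta> * (\<rho> powr (- 1 / 2 * i) * \<rho> ^ i)"
        using \<rho> by (simp add: mult_right_mono mult.assoc)
      also have "\<rho> powr (- 1 / 2 * i) * \<rho> ^ i = \<rho> powr (1 / 2 * i)"
        using \<rho> by (simp add: powr_realpow[symmetric] powr_add[symmetric])
      also have "\<dots> = (\<rho> powr (1 / 2)) ^ i" using \<rho> by (simp add: powr_realpow[symmetric] powr_powr)
      finally show ?thesis using \<rho> by (simp add: share_ratio_def powr_half_sqrt)
    qed
    have mom: "expectation (\<lambda>\<omega>. (W p i \<omega> / (\<delta> * share i)) powr e) \<le> \<delta> powr - e * ((1 - s) powr - \<beta> * share_ratio ^ i * \<kappa>)"
      and int: "integrable M (\<lambda>\<omega>. (W p i \<omega> / (\<delta> * share i)) powr e)"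
      if e: "e \<in> {\<gamma>, \<beta>}" for e
    proof -
      have eq: "(W p i \<omega> / (\<delta> * share i)) powr e = (\<delta> powr - e * share i powr - e) * W p i \<omega> powr e" if "\<omega> \<in> space M" for \<omega>
        using W[OF that] assms share(1)[of i] by (simp add: powr_divide powr_mult powr_minus field_simps)
      show "integrable M (\<lambda>\<omega>. (W p i \<omega> / (\<delta> * share i)) powr e)"
        by (rule Bochner_Integration.integrable_cong[THEN iffD2, OF refl eq]) (use W_moment(1)[OF p e] in auto)
      have "expectation (\<lambda>\<omega>. (W p i \<omega> / (\<delta> * share i)) powr e) = (\<delta> powr - e * share i powr - e) * expectation (\<lambda>\<omega>. W p i \<omega> powr e)"
        using eq by (simp cong: Bochner_Integration.integral_cong)
      also have "\<dots> \<le> (\<delta> powr - e * share i powr - e) * (\<kappa> * \<rho> ^ i)"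
        using W_moment(2)[OF p e] by (intro mult_left_mono) auto
      also have "\<dots> = \<delta> powr - e * \<kappa> * (share i powr - e * \<rho> ^ i)" by simp
      also have "\<dots> \<le> \<delta> powr - e * \<kappa> * ((1 - s) powr - \<beta> * share_ratio ^ i)"
        using wtb[of e] e exponents \<kappa>[OF p] by (intro mult_left_mono) auto
      finally show "expectation (\<lambda>\<omega>. (W p i \<omega> / (\<delta> * share i)) powr e) \<le> \<delta> powr - e * ((1 - s) powr - \<beta> * share_ratio ^ i * \<kappa>)"
        by (simp add: mult_ac)
    qed
    have "prob {\<omega> \<in> space M. \<delta> * share i * x < V p i \<omega>} \<le>
       potter_C * f x * expectation (\<lambda>\<omega>. (W p i \<omega> / (\<delta> * share i)) powr \<gamma> + (W p i \<omega> / (\<delta> * share i)) powr \<beta>)"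
      using prob_product_le[OF p _ x dw, of UNIV i] sets.top[of "borel \<Otimes>\<^sub>M borel :: (real \<times> real) measure"]
      by (simp add: space_pair_measure)
    also have "\<dots> = potter_C * f x * (expectation (\<lambda>\<omega>. (W p i \<omega> / (\<delta> * share i)) powr \<gamma>) + expectation (\<lambda>\<omega>. (W p i \<omega> / (\<delta> * share i)) powr \<beta>))"
      using int by (subst Bochner_Integration.integral_add) auto
    also have "\<dots> \<le> potter_C * f x * (\<delta> powr - \<gamma> * ((1 - s) powr - \<beta> * share_ratio ^ i * \<kappa>) + \<delta> powr - \<beta> * ((1 - s) powr - \<beta> * share_ratio ^ i * \<kappa>))"
      using mom potter(1) f_pos[of x] by (intro mult_left_mono add_mono) auto
    also have "\<dots> = potter_C * c * share_ratio ^ i * f x" by (simp add: c_def algebra_simps)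
    finally show ?thesis .
  qed
  \<comment> \<open>The sign of \<kappa> is known only when \<open>A\<close> is nonempty; the
    absolute value keeps the constant nonnegative in every case.\<close>
  have bound: "prob (late_jump \<delta> N x) \<le> (card A * (potter_C * \<bar>c\<bar> / (1 - share_ratio))) * share_ratio ^ N * f x" if x: "potter_x \<le> x" for N x
  proof -
    have g: "(\<lambda>i. potter_C * c * share_ratio ^ (i + N) * f x) sums (potter_C * c * share_ratio ^ N * f x * (1 / (1 - share_ratio)))"
      using sums_mult[OF geometric_sums[of share_ratio], of "potter_C * c * share_ratio ^ N * f x"] share_ratio by (simp add: power_add mult_ac)
    have *: "prob (\<Union>i. {\<omega> \<in> space M. \<delta> * share (i + N) * x < V p (i + N) \<omega>}) \<le> potter_C * c * share_ratio ^ N * f x * (1 / (1 - share_ratio))"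
      if p: "p \<in> A" for p
    proof -
      have summ: "summable (\<lambda>i. prob {\<omega> \<in> space M. \<delta> * share (i + N) * x < V p (i + N) \<omega>})"
        using single[OF p x] by (intro summable_comparison_test'[OF sums_summable[OF g], of 0]) auto
      have "prob (\<Union>i. {\<omega> \<in> space M. \<delta> * share (i + N) * x < V p (i + N) \<omega>})
         \<le> (\<Sum>i. prob {\<omega> \<in> space M. \<delta> * share (i + N) * x < V p (i + N) \<omega>})"
        using V_rv[OF p] summ by (intro finite_measure_subadditive_countably) auto
      also have "\<dots> \<le> (\<Sum>i. potter_C * c * share_ratio ^ (i + N) * f x)"
        using single[OF p x] by (intro suminf_le summ sums_summable[OF g])
      finally show ?thesis using sums_unique[OF g] by simp
    qed
    have "late_jump \<delta> N x = (\<Union>p\<in>A. \<Union>i. {\<omega> \<in> space M. \<delta> * share (i + N) * x < V p (i + N) \<omega>})"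
      by (auto simp: late_jump_def) (metis add.commute le_Suc_ex, meson le_add2)
    also have "prob \<dots> \<le> (\<Sum>p\<in>A. prob (\<Union>i. {\<omega> \<in> space M. \<delta> * share (i + N) * x < V p (i + N) \<omega>}))"
      using finite_A V_rv by (intro measure_UNION_le sets.countable_UN') auto
    also have "\<dots> \<le> (\<Sum>p\<in>A. potter_C * c * share_ratio ^ N * f x * (1 / (1 - share_ratio)))" by (intro sum_mono *)
    also have "\<dots> = (card A * (potter_C * c / (1 - share_ratio))) * share_ratio ^ N * f x" by simp
    also have "\<dots> \<le> (card A * (potter_C * \<bar>c\<bar> / (1 - share_ratio))) * share_ratio ^ N * f x"
      using share_ratio potter(1) f_pos[of x] by (intro mult_right_mono mult_left_mono divide_right_mono) auto
    finally show ?thesis .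
  qed
  show ?thesis
    by (rule that[of "card A * (potter_C * \<bar>c\<bar> / (1 - share_ratio))"]) (use share_ratio potter(1) bound in auto)
qed

text \<open>Off the event, every summand from \<open>N\<close> on lies below its share, and the
  shares sum to 1. A general \<open>T\<close> below \<open>V\<close> covers the series with and
  without the indicator of a window.\<close>

lemma no_late_jump:
  assumes "\<omega> \<in> space M" "\<omega> \<notin> late_jump \<delta> N x" "p \<in> A" "0 \<le> \<delta> * x" and T: "\<And>i. 0 \<le> T i" "\<And>i. T i \<le> V p i \<omega>"
  shows "summable T" "(\<Sum>i. T (i + N)) \<le> \<delta> * x" "suminf T \<le> (\<Sum>i<N. T i) + \<delta> * x"
proof -
  have le: "T (i + N) \<le> \<delta> * x * share (i + N)" for i
  proof -
    have "V p (i + N) \<omega> \<le> \<delta> * share (i + N) * x"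
      using assms(1-3) by (auto simp: late_jump_def not_less)
    then show ?thesis using T(2)[of "i + N"] by (simp add: mult_ac)
  qed
  have sw: "summable (\<lambda>i. \<delta> * x * share (i + N))"
    using share(3) by (intro summable_mult summable_ignore_initial_segment sums_summable)
  have s: "summable (\<lambda>i. T (i + N))"
    by (rule summable_comparison_test'[OF sw, of 0]) (use T le in auto)
  then show s0: "summable T" by (rule summable_iff_shift[THEN iffD1])
  have "(\<Sum>i. T (i + N)) \<le> (\<Sum>i. \<delta> * x * share (i + N))" by (rule suminf_le[OF le s sw])
  also have "\<dots> = \<delta> * x * (\<Sum>i. share (i + N))"
    using share(3) by (intro suminf_mult summable_ignore_initial_segment sums_summable)
  also have "(\<Sum>i. share (i + N)) \<le> 1"
  proof -
    have "(\<Sum>i. share (i + N)) = 1 - (\<Sum>i<N. share i)"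
      using suminf_minus_initial_segment[OF sums_summable[OF share(3)], of N] sums_unique[OF share(3)] by simp
    then show ?thesis using share(1) by (simp add: sum_nonneg less_imp_le)
  qed
  finally show *: "(\<Sum>i. T (i + N)) \<le> \<delta> * x" using assms(4) by (simp add: mult_left_mono)
  show "suminf T \<le> (\<Sum>i<N. T i) + \<delta> * x"
    using suminf_split_initial_segment[OF s0, of N] * by simp
qed

text \<open>A Borel-Cantelli argument at the fixed level \<open>potter_x\<close>: the probability of
  a jump later than \<open>N\<close> tends to 0 with \<open>N\<close>, so almost every outcome has
  some \<open>N\<close> without late jumps, and from there on the summands lie below the
  shares.\<close>

lemma AE_summable: "AE \<omega> in M. \<forall>p\<in>A. summable (\<lambda>i. V p i \<omega>)"
proof -
  obtain K where K: "0 \<le> K" "\<And>N x. potter_x \<le> x \<Longrightarrow> prob (late_jump 1 N x) \<le> K * share_ratio ^ N * f x"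
    using prob_late_jump_le[of 1] by auto
  have ev: "(\<Inter>N. late_jump 1 N potter_x) \<in> events" using late_jump_event by auto
  have "prob (\<Inter>N. late_jump 1 N potter_x) \<le> K * share_ratio ^ N * f potter_x" for N
    using K(2)[of potter_x N] finite_measure_mono[OF INT_lower[of N UNIV "\<lambda>N. late_jump 1 N potter_x"] late_jump_event] by simp
  moreover have "(\<lambda>N. K * share_ratio ^ N * f potter_x) \<longlonglongrightarrow> K * 0 * f potter_x"
    using share_ratio by (intro tendsto_intros LIMSEQ_power_zero) auto
  ultimately have "prob (\<Inter>N. late_jump 1 N potter_x) \<le> 0"
    using LIMSEQ_le_const[of "\<lambda>N. K * share_ratio ^ N * f potter_x" 0] by auto
  then have "prob (\<Inter>N. late_jump 1 N potter_x) = 0" by (simp add: measure_le_0_iff)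
  then have "AE \<omega> in M. \<omega> \<notin> (\<Inter>N. late_jump 1 N potter_x)"
    using ev by (simp add: prob_eq_0)
  then show ?thesis
  proof (rule AE_mp, intro AE_I2 impI ballI)
    fix \<omega> p assume \<omega>: "\<omega> \<in> space M" "\<omega> \<notin> (\<Inter>N. late_jump 1 N potter_x)" "p \<in> A"
    then obtain N where "\<omega> \<notin> late_jump 1 N potter_x" by auto
    from no_late_jump(1)[OF \<omega>(1) this \<omega>(3), of "\<lambda>i. V p i \<omega>"] show "summable (\<lambda>i. V p i \<omega>)"
      using potter(2) V_nonneg[OF \<omega>(3,1)] by auto
  qed
qed

end

section \<open>Sums over arrival windows and the one-big-jump inclusion\<close>

context heavy_tailed_sums
begin

text \<open>The inner series converge almost surely by \<open>AE_summable\<close>. On the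
  exceptional null set \<open>suminf\<close> carries no meaning, so \<open>S\<close> is estimated
  only almost everywhere or off \<open>late_jump\<close>.\<close>

definition S :: "'b set \<Rightarrow> real set \<Rightarrow> 'a \<Rightarrow> real" where
  "S K B \<omega> = (\<Sum>p\<in>K. \<Sum>i. V p i \<omega> * indicator B (\<tau> p i \<omega>))"

definition weight :: "'b \<Rightarrow> nat \<Rightarrow> real set \<Rightarrow> real" where
  "weight p i B = expectation (\<lambda>\<omega>. W p i \<omega> powr \<alpha> * indicator B (\<tau> p i \<omega>))"

text \<open>The constant in the tail of \<open>S K B\<close>. For one business line and the window
  up to \<open>t\<close> it is \<open>ell\<close>.\<close>

definition total_weight :: "'b set \<Rightarrow> real set \<Rightarrow> real" where
  "total_weight K B = (\<Sum>p\<in>K. a p * (\<Sum>i. weight p i B))"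

lemma weight_bounds:
  assumes p: "p \<in> A" and B: "B \<in> sets borel"
  shows "0 \<le> weight p i B" "weight p i B \<le> 2 * \<kappa> * \<rho> ^ i"
proof -
  note [measurable] = W_rv[OF p, of i] \<tau>_rv[OF p, of i] B
  show "0 \<le> weight p i B" unfolding weight_def by (intro integral_nonneg_AE) auto
  have "weight p i B \<le> expectation (\<lambda>\<omega>. W p i \<omega> powr \<alpha>)" unfolding weight_def
  proof (rule integral_mono[OF _ W_moment_\<alpha>(1)[OF p]])
    show "integrable M (\<lambda>\<omega>. W p i \<omega> powr \<alpha> * indicator B (\<tau> p i \<omega>))"
      by (rule Bochner_Integration.integrable_bound[OF W_moment_\<alpha>(1)[OF p, of i]]) (auto simp: indicator_def)
  qed (auto simp: indicator_def)
  then show "weight p i B \<le> 2 * \<kappa> * \<rho> ^ i" using W_moment_\<alpha>(2)[OF p, of i] by simp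
qed

lemma weight_summable:
  assumes "p \<in> A" "B \<in> sets borel"
  shows "summable (\<lambda>i. weight p i B)"
proof (rule summable_comparison_test'[of "\<lambda>i. 2 * \<kappa> * \<rho> ^ i" 0])
  show "summable (\<lambda>i. 2 * \<kappa> * \<rho> ^ i)" using \<rho> by (intro summable_mult summable_geometric) simp
  show "norm (weight p i B) \<le> 2 * \<kappa> * \<rho> ^ i" for i
    using weight_bounds[OF assms, of i] by simp
qed

lemma total_weight_truncated:
  assumes "K \<subseteq> A" "B \<in> sets borel"
  shows "(\<Sum>p\<in>K. \<Sum>i<N. a p * weight p i B) \<le> total_weight K B"
  unfolding total_weight_def sum_distrib_left[symmetric]
  using assms a_nonneg weight_bounds(1)
  by (intro sum_mono mult_left_mono sum_le_suminf weight_summable) auto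

text \<open>The remainder is geometric with a constant independent of the window, so one truncation
  index serves a whole sequence of windows.\<close>

lemma total_weight_remainder:
  assumes "K \<subseteq> A"
  obtains C where "\<And>N B. B \<in> sets borel \<Longrightarrow>
    total_weight K B - C * \<rho> ^ N \<le> (\<Sum>p\<in>K. \<Sum>i<N. a p * weight p i B)"
proof
  fix N :: nat and B :: "real set" assume B: "B \<in> sets borel"
  have "a p * (\<Sum>i. weight p i B) - a p * (2 * \<kappa> / (1 - \<rho>)) * \<rho> ^ N \<le> (\<Sum>i<N. a p * weight p i B)" if p: "p \<in> K" for p
  proof -
    have pA: "p \<in> A" using p assms by auto
    have g: "(\<lambda>i. 2 * \<kappa> * \<rho> ^ (i + N)) sums (2 * \<kappa> * \<rho> ^ N * (1 / (1 - \<rho>)))"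
      using sums_mult[OF geometric_sums[of \<rho>], of "2 * \<kappa> * \<rho> ^ N"] \<rho> by (simp add: power_add mult_ac)
    have "(\<Sum>i. weight p (i + N) B) \<le> (\<Sum>i. 2 * \<kappa> * \<rho> ^ (i + N))"
      using weight_bounds(2)[OF pA B] weight_summable[OF pA B] sums_summable[OF g]
      by (intro suminf_le summable_ignore_initial_segment) auto
    then have "(\<Sum>i. weight p i B) \<le> (\<Sum>i<N. weight p i B) + 2 * \<kappa> / (1 - \<rho>) * \<rho> ^ N"
      using suminf_split_initial_segment[OF weight_summable[OF pA B], of N] sums_unique[OF g] by simp
    from mult_left_mono[OF this a_nonneg[OF pA]] show ?thesis
      by (simp add: algebra_simps sum_distrib_left)
  qed
  then have "(\<Sum>p\<in>K. a p * (\<Sum>i. weight p i B) - a p * (2 * \<kappa> / (1 - \<rho>)) * \<rho> ^ N) \<le> (\<Sum>p\<in>K. \<Sum>i<N. a p * weight p i B)"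
    by (rule sum_mono)
  then show "total_weight K B - (\<Sum>p\<in>K. a p * (2 * \<kappa> / (1 - \<rho>))) * \<rho> ^ N \<le> (\<Sum>p\<in>K. \<Sum>i<N. a p * weight p i B)"
    by (simp add: total_weight_def sum_subtractf sum_distrib_right)
qed

lemma single_event:
  assumes p: "p \<in> A" and "B \<in> sets borel"
  shows "{\<omega> \<in> space M. c < V p i \<omega> \<and> \<tau> p i \<omega> \<in> B} \<in> events"
proof -
  note [measurable] = X_rv[OF p, of i] W_rv[OF p, of i] \<tau>_rv[OF p, of i] assms(2)
  show ?thesis by measurable
qed

lemma pair_event:
  assumes p: "p \<in> A" and q: "q \<in> A"
  shows "{\<omega> \<in> space M. c < V p i \<omega> \<and> c < V q j \<omega>} \<in> events"
proof -
  note [measurable] = X_rv[OF p, of i] W_rv[OF p, of i] X_rv[OF q, of j] W_rv[OF q, of j]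
  show ?thesis by measurable
qed

text \<open>Each of the at most \<open>card A\<close> series may contribute a late remainder of
  \<open>\<delta> / Suc (card A) * x\<close>; the successor avoids a zero denominator.\<close>

lemma S_le_truncated:
  assumes "\<omega> \<in> space M" "K \<subseteq> A" "0 < \<delta>" "0 < x" "\<omega> \<notin> late_jump (\<delta> / Suc (card A)) N x"
  shows "S K B \<omega> \<le> (\<Sum>(p, i)\<in>K \<times> {..<N}. V p i \<omega> * indicator B (\<tau> p i \<omega>)) + \<delta> * x"
proof -
  have "S K B \<omega> \<le> (\<Sum>p\<in>K. (\<Sum>i<N. V p i \<omega> * indicator B (\<tau> p i \<omega>)) + \<delta> / Suc (card A) * x)"
    unfolding S_def
    using assms V_nonneg
    by (intro sum_mono no_late_jump(3)[OF assms(1,5)]) (auto simp: indicator_def)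
  also have "\<dots> = (\<Sum>(p, i)\<in>K \<times> {..<N}. V p i \<omega> * indicator B (\<tau> p i \<omega>)) + card K * (\<delta> / Suc (card A) * x)"
    unfolding sum.distrib sum.cartesian_product by simp
  also have "card K * (\<delta> / Suc (card A) * x) \<le> Suc (card A) * (\<delta> / Suc (card A) * x)"
    using assms finite_A by (intro mult_right_mono of_nat_mono le_SucI card_mono) auto
  also have "\<dots> = \<delta> * x" by simp
  finally show ?thesis by simp
qed

text \<open>Truncation at \<open>N = 0\<close> with \<delta> = 1 leaves an empty sum, so exceeding
  \<open>x\<close> is itself a late jump.\<close>

lemma tail_bound:
  obtains C where "0 \<le> C" "\<And>K B Z x. K \<subseteq> A \<Longrightarrow> (AE \<omega> in M. Z \<omega> \<le> S K B \<omega>) \<Longrightarrow> potter_x \<le> x \<Longrightarrow>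
    prob {\<omega> \<in> space M. x < Z \<omega>} \<le> C * f x"
proof -
  obtain C where C: "0 \<le> C" "\<And>N x. potter_x \<le> x \<Longrightarrow> prob (late_jump (1 / Suc (card A)) N x) \<le> C * share_ratio ^ N * f x"
    using prob_late_jump_le[of "1 / Suc (card A)"] by auto
  have "prob {\<omega> \<in> space M. x < Z \<omega>} \<le> C * f x"
    if "K \<subseteq> A" and Z: "AE \<omega> in M. Z \<omega> \<le> S K B \<omega>" and x: "potter_x \<le> x" for K B Z x
  proof -
    have "prob {\<omega> \<in> space M. x < Z \<omega>} \<le> prob (late_jump (1 / Suc (card A)) 0 x)"
      using Z
    proof (intro finite_measure_mono_AE late_jump_event, elim AE_mp, intro AE_I2 impI)
      fix \<omega> assume "\<omega> \<in> space M" "Z \<omega> \<le> S K B \<omega>" "\<omega> \<in> {\<omega> \<in> space M. x < Z \<omega>}"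
      then show "\<omega> \<in> late_jump (1 / Suc (card A)) 0 x"
        using S_le_truncated[of \<omega> K 1 x 0 B] x potter(2) that(1) by fastforce
    qed
    then show ?thesis using C(2)[OF x, of 0] by simp
  qed
  then show ?thesis using C(1) that by blast
qed

text \<open>The pathwise core. Off late jumps, at most one of the finitely many early summands is
  above \<open>e\<close>. If it belongs to \<open>K' - K\<close>, then \<open>S K B\<close> stays
  below \<open>2 * \<delta> * x \<le> u * x\<close>. Otherwise all summands of \<open>K'\<close> are
  at most \<open>(max u 1 - 2 * \<delta>) * x\<close>, both sums are at most
  \<open>max u 1 * x\<close>, and one inequality fails: the first if \<open>1 \<le> u\<close>, the
  second if \<open>u \<le> 1\<close>. One \<delta> pays for the late claims, the other for the small
  ones.\<close>

lemma one_big_jump_inclusion: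
  assumes \<omega>: "\<omega> \<in> space M" and K: "K \<subseteq> K'" "K' \<subseteq> A" and \<delta>: "0 < \<delta>" "2 * \<delta> \<le> u" "3 * \<delta> \<le> 1" and x: "0 < x"
    and late_jump: "\<omega> \<notin> late_jump (\<delta> / Suc (card A)) N x"
    and two: "\<And>p i q j. (p, i) \<in> A \<times> {..<N} \<Longrightarrow> (q, j) \<in> A \<times> {..<N} \<Longrightarrow> (p, i) \<noteq> (q, j) \<Longrightarrow>
       V p i \<omega> \<le> \<delta> / Suc (card (A \<times> {..<N})) * x \<or> V q j \<omega> \<le> \<delta> / Suc (card (A \<times> {..<N})) * x"
    and one: "\<And>p i. (p, i) \<in> K \<times> {..<N} \<Longrightarrow> \<tau> p i \<omega> \<in> B \<Longrightarrow> V p i \<omega> \<le> (max u 1 - 2 * \<delta>) * x"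
  shows "\<not> (u * x < S K B \<omega> \<and> x < S K' B \<omega>)"
proof -
  define T where "T = (\<lambda>(p, i). V p i \<omega> * indicator B (\<tau> p i \<omega>))"
  define e where "e = \<delta> / Suc (card (A \<times> {..<N})) * x"
  have cardle: "real (card (J \<times> {..<N})) \<le> real (Suc (card (A \<times> {..<N})))" if "J \<subseteq> A" for J
    using that finite_A by (intro of_nat_mono le_SucI card_mono) auto
  have e: "0 \<le> e" "e \<le> \<delta> * x" using \<delta> x by (auto simp: e_def divide_le_eq mult_left_le)
  have TV: "T (p, i) \<le> V p i \<omega>" "0 \<le> T (p, i)" if "p \<in> A" for p i
    using V_nonneg[OF that \<omega>] by (auto simp: T_def indicator_def)
  have two': "T a \<le> e \<or> T b \<le> e" if "a \<in> A \<times> {..<N}" "b \<in> A \<times> {..<N}" "a \<noteq> b" for a b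
  proof -
    obtain p i q j where ab: "a = (p, i)" "b = (q, j)" by (cases a, cases b)
    have "p \<in> A" "q \<in> A" using that ab by auto
    then show ?thesis using two[of p i q j] that TV(1)[of p i] TV(1)[of q j] unfolding ab e_def by fastforce
  qed
  have main: "S J B \<omega> \<le> b + 2 * \<delta> * x" if J: "J \<subseteq> A" and b: "0 \<le> b" "\<And>a. a \<in> J \<times> {..<N} \<Longrightarrow> T a \<le> b" for J b
  proof -
    have fin: "finite (J \<times> {..<N})"
      using J by (intro finite_cartesian_product finite_subset[OF _ finite_A]) auto
    have "S J B \<omega> \<le> sum T (J \<times> {..<N}) + \<delta> * x"
      unfolding T_def using S_le_truncated[OF \<omega> J \<delta>(1) x late_jump] .
    also have "sum T (J \<times> {..<N}) \<le> b + card (J \<times> {..<N}) * e"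
      using J by (intro sum_le_one_large fin b e two') auto
    also have "card (J \<times> {..<N}) * e \<le> Suc (card (A \<times> {..<N})) * e"
      by (intro mult_right_mono cardle J e(1))
    also have "\<dots> = \<delta> * x" by (simp add: e_def)
    finally show ?thesis by simp
  qed
  show ?thesis
  proof (cases "\<exists>a\<in>(K' - K) \<times> {..<N}. e < T a")
    case True
    then obtain a where a: "a \<in> (K' - K) \<times> {..<N}" "e < T a" by blast
    have "S K B \<omega> \<le> 0 + 2 * \<delta> * x"
    proof -
      have fin: "finite (K \<times> {..<N})"
        using K by (intro finite_cartesian_product finite_subset[OF _ finite_A]) auto
      have le: "T b \<le> e" if "b \<in> K \<times> {..<N}" for b using two'[of a b] a that K by fastforce
      have "S K B \<omega> \<le> sum T (K \<times> {..<N}) + \<delta> * x"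
        unfolding T_def using S_le_truncated[OF \<omega> _ \<delta>(1) x late_jump] K by auto
      also have "sum T (K \<times> {..<N}) \<le> card (K \<times> {..<N}) * e"
        using sum_bounded_above[of "K \<times> {..<N}" T e] le by simp
      also have "card (K \<times> {..<N}) * e \<le> Suc (card (A \<times> {..<N})) * e"
        using K by (intro mult_right_mono cardle e(1)) auto
      also have "\<dots> = \<delta> * x" by (simp add: e_def)
      finally show ?thesis by simp
    qed
    also have "\<dots> \<le> u * x" using \<delta> x by (simp add: mult_right_mono)
    finally show ?thesis by simp
  next
    case False
    define b where "b = (max u 1 - 2 * \<delta>) * x"
    \<comment> \<open>This is where \<open>3 * \<delta> \<le> 1\<close> enters: it gives
      \<open>\<delta> \<le> max u 1 - 2 * \<delta>\<close>.\<close>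
    have eb: "e \<le> b"
    proof -
      have "\<delta> * x \<le> b" unfolding b_def using \<delta> x by (intro mult_right_mono) auto
      then show ?thesis using e by simp
    qed
    have Tb: "T a \<le> b" if a: "a \<in> K' \<times> {..<N}" for a
    proof (cases "a \<in> K \<times> {..<N}")
      case True
      then show ?thesis using one[of "fst a" "snd a"] eb e unfolding b_def T_def
        by (auto simp: indicator_def split: prod.splits)
    next
      case F: False
      then have "T a \<le> e" using a False by (auto simp: not_less)
      then show ?thesis using eb by simp
    qed
    have b: "b + 2 * \<delta> * x = max u 1 * x" by (simp add: b_def algebra_simps)
    have "S K B \<omega> \<le> max u 1 * x" "S K' B \<omega> \<le> max u 1 * x"
      using main[of K b] main[of K' b] K Tb eb e b by auto
    then show ?thesis by (auto simp: max_def split: if_splits)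
  qed
qed

end

text \<open>Both losses are squeezed between a window sum and that sum minus \<open>Q\<close>, which
  stands for the premiums. With \<open>K \<subseteq> K'\<close> the setting covers a line against
  the total, a line against itself and the total against itself. The limit is assumed for the weight
  of \<open>K\<close>, because the claims that raise both sums are those of
  \<open>K\<close>.\<close>

locale heavy_tailed_losses = heavy_tailed_sums M f \<alpha> A X W \<tau> G a \<gamma> \<beta> \<rho> \<kappa>
  for M :: "'a measure" and f \<alpha> and A :: "'b set" and X W \<tau> G a \<gamma> \<beta> \<rho> \<kappa> +
  fixes K K' :: "'b set" and B :: "nat \<Rightarrow> real set" and x :: "nat \<Rightarrow> real" and Q :: "'a \<Rightarrow> real"
    and Z Z' :: "nat \<Rightarrow> 'a \<Rightarrow> real" and lam :: real
  assumes K: "K \<subseteq> K'" "K' \<subseteq> A"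
    and B: "\<And>n. B n \<in> sets borel"
    and x: "filterlim x at_top sequentially"
    and Z_rv: "\<And>n. Z n \<in> borel_measurable M" "\<And>n. Z' n \<in> borel_measurable M"
    and Q_rv: "Q \<in> borel_measurable M"
    and Z_lower: "\<And>n. AE \<omega> in M. S K (B n) \<omega> - Q \<omega> \<le> Z n \<omega>" "\<And>n. AE \<omega> in M. S K' (B n) \<omega> - Q \<omega> \<le> Z' n \<omega>"
    and Z_upper: "\<And>n. AE \<omega> in M. Z n \<omega> \<le> S K (B n) \<omega>" "\<And>n. AE \<omega> in M. Z' n \<omega> \<le> S K' (B n) \<omega>"
    and Q_negligible: "((\<lambda>x. prob {\<omega> \<in> space M. x < Q \<omega>} / f x) \<longlongrightarrow> 0) at_top"
    and lam: "(\<lambda>n. total_weight K (B n)) \<longlonglongrightarrow> lam"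
begin

lemma x_large: "\<forall>\<^sub>F n in sequentially. potter_x \<le> x n"
  using x unfolding filterlim_at_top by blast

lemma KA: "K \<subseteq> A" using K by auto

lemma fin_K: "finite (K \<times> {..<N::nat})"
  using KA by (intro finite_cartesian_product finite_subset[OF _ finite_A]) auto

lemma breiman_sum:
  assumes "0 < v"
  shows "(\<lambda>n. (\<Sum>(p, i)\<in>K \<times> {..<N}. prob {\<omega> \<in> space M. v * x n < V p i \<omega> \<and> \<tau> p i \<omega> \<in> B n} / f (x n))
     - v powr - \<alpha> * (\<Sum>p\<in>K. \<Sum>i<N. a p * weight p i (B n))) \<longlonglongrightarrow> 0"
proof -
  have "(\<lambda>n. \<Sum>(p, i)\<in>K \<times> {..<N}. prob {\<omega> \<in> space M. v * x n < V p i \<omega> \<and> \<tau> p i \<omega> \<in> B n} / f (x n)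
      - v powr - \<alpha> * (a p * weight p i (B n))) \<longlonglongrightarrow> 0"
    using breiman[OF _ B x assms] KA by (intro tendsto_null_sum) (auto simp: weight_def)
  then show ?thesis
    by (simp add: sum.cartesian_product sum_subtractf sum_distrib_left case_prod_unfold)
qed

lemma pairs_negligible:
  assumes "0 < v" "J \<subseteq> A \<times> {..<N}"
  shows "(\<lambda>n. (\<Sum>a\<in>J. \<Sum>b\<in>J - {a}. prob {\<omega> \<in> space M. v * x n < V (fst a) (snd a) \<omega> \<and> v * x n < V (fst b) (snd b) \<omega>}) / f (x n)) \<longlonglongrightarrow> 0"
  unfolding sum_divide_distrib
  using assms by (intro tendsto_null_sum two_large_negligible x) auto

text \<open>The constants are chosen in the order \<delta>, \<open>N\<close>, \<open>n\<close>:
  \<delta> by continuity of the power, the truncation by the geometric bound, and only then the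
  level. The event is covered by a late jump, by two large claims, or by one claim of
  \<open>K\<close> in the window above \<open>(max u 1 - 2 * \<delta>) * x n\<close>.\<close>

lemma joint_tail_upper:
  assumes u: "0 < u" and \<eta>: "0 < \<eta>"
  shows "\<forall>\<^sub>F n in sequentially. prob {\<omega> \<in> space M. u * x n < Z n \<omega> \<and> x n < Z' n \<omega>} / f (x n)
    < lam * max u 1 powr - \<alpha> + \<eta>"
proof -
  define v where "v = max u 1"
  have v: "0 < v" "u \<le> v" "1 \<le> v" by (auto simp: v_def)
  have "((\<lambda>\<delta>. (v - 2 * \<delta>) powr - \<alpha> * lam) \<longlongrightarrow> (v - 2 * 0) powr - \<alpha> * lam) (at_right 0)"
    using v by (intro tendsto_intros) auto
  then have "\<forall>\<^sub>F \<delta> in at_right 0. (v - 2 * \<delta>) powr - \<alpha> * lam < v powr - \<alpha> * lam + \<eta> / 4"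
    using \<eta> by (intro order_tendstoD(2)) auto
  moreover have "\<forall>\<^sub>F \<delta> in at_right 0. \<delta> \<in> {0<..<min (u / 2) (1 / 3)}"
    using u by (intro eventually_at_right_real) auto
  ultimately have "\<forall>\<^sub>F \<delta> in at_right 0. (v - 2 * \<delta>) powr - \<alpha> * lam < v powr - \<alpha> * lam + \<eta> / 4 \<and> \<delta> \<in> {0<..<min (u / 2) (1 / 3)}"
    by (rule eventually_conj)
  then obtain \<delta> where \<delta>: "(v - 2 * \<delta>) powr - \<alpha> * lam < v powr - \<alpha> * lam + \<eta> / 4" "0 < \<delta>" "2 * \<delta> \<le> u" "3 * \<delta> \<le> 1"
    using eventually_happens'[OF trivial_limit_at_right_real] by (force simp: less_imp_le)
  have w: "0 < v - 2 * \<delta>" using \<delta> v by linarith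
  obtain C where C: "0 \<le> C" "\<And>N x. potter_x \<le> x \<Longrightarrow> prob (late_jump (\<delta> / Suc (card A)) N x) \<le> C * share_ratio ^ N * f x"
    using prob_late_jump_le[of "\<delta> / Suc (card A)"] \<delta> by auto
  have "(\<lambda>N. C * share_ratio ^ N) \<longlonglongrightarrow> C * 0" using share_ratio by (intro tendsto_intros LIMSEQ_power_zero) auto
  then have "\<forall>\<^sub>F N in sequentially. C * share_ratio ^ N < \<eta> / 4" using \<eta> by (intro order_tendstoD(2)) auto
  then obtain N where N: "C * share_ratio ^ N < \<eta> / 4" by (auto simp: eventually_sequentially)
  define I where "I = A \<times> {..<N}"
  have finI: "finite I" using finite_A by (simp add: I_def)
  define e where "e = \<delta> / Suc (card I)"
  have e: "0 < e" using \<delta> by (simp add: e_def)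
  define pairs where "pairs n = (\<Sum>a\<in>I. \<Sum>b\<in>I - {a}. prob {\<omega> \<in> space M. e * x n < V (fst a) (snd a) \<omega> \<and> e * x n < V (fst b) (snd b) \<omega>})" for n
  define sing where "sing n = (\<Sum>(p, i)\<in>K \<times> {..<N}. prob {\<omega> \<in> space M. (v - 2 * \<delta>) * x n < V p i \<omega> \<and> \<tau> p i \<omega> \<in> B n} / f (x n))" for n
  have lim_pairs: "(\<lambda>n. pairs n / f (x n)) \<longlonglongrightarrow> 0"
    unfolding pairs_def by (rule pairs_negligible[OF e, of I N]) (simp add: I_def)
  have lim_sing: "(\<lambda>n. sing n - (v - 2 * \<delta>) powr - \<alpha> * (\<Sum>p\<in>K. \<Sum>i<N. a p * weight p i (B n))) \<longlonglongrightarrow> 0"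
    unfolding sing_def by (rule breiman_sum[OF w])
  have lim_lam: "(\<lambda>n. (v - 2 * \<delta>) powr - \<alpha> * total_weight K (B n)) \<longlonglongrightarrow> (v - 2 * \<delta>) powr - \<alpha> * lam"
    by (intro tendsto_intros lam)
  have bound: "prob {\<omega> \<in> space M. u * x n < Z n \<omega> \<and> x n < Z' n \<omega>} / f (x n) \<le> C * share_ratio ^ N + pairs n / f (x n) + sing n"
    if xn: "potter_x \<le> x n" for n
  proof -
    have x0: "0 < x n" using xn potter(2) by simp
    let ?P = "\<lambda>a b. {\<omega> \<in> space M. e * x n < V (fst a) (snd a) \<omega> \<and> e * x n < V (fst b) (snd b) \<omega>}"
    let ?E = "\<lambda>a. {\<omega> \<in> space M. (v - 2 * \<delta>) * x n < V (fst a) (snd a) \<omega> \<and> \<tau> (fst a) (snd a) \<omega> \<in> B n}"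
    have mP: "?P a b \<in> events" if "a \<in> I" "b \<in> I" for a b
      by (rule pair_event) (use that in \<open>auto simp: I_def\<close>)
    have mE: "?E a \<in> events" if "a \<in> K \<times> {..<N}" for a
      by (rule single_event[OF _ B]) (use that KA in auto)
    have mU: "(\<Union>a\<in>I. \<Union>b\<in>I - {a}. ?P a b) \<in> events" "(\<Union>a\<in>K \<times> {..<N}. ?E a) \<in> events"
    proof -
      show "(\<Union>a\<in>I. \<Union>b\<in>I - {a}. ?P a b) \<in> events"
        by (intro sets.finite_UN finI finite_Diff mP) blast+
      show "(\<Union>a\<in>K \<times> {..<N}. ?E a) \<in> events"
        by (intro sets.finite_UN fin_K mE)
    qed
    have "prob {\<omega> \<in> space M. u * x n < Z n \<omega> \<and> x n < Z' n \<omega>}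
      \<le> prob (late_jump (\<delta> / Suc (card A)) N (x n) \<union> ((\<Union>a\<in>I. \<Union>b\<in>I - {a}. ?P a b) \<union> (\<Union>a\<in>K \<times> {..<N}. ?E a)))"
      using Z_upper[of n]
    proof (intro finite_measure_mono_AE sets.Un late_jump_event mU, elim AE_mp, intro AE_I2 impI)
      fix \<omega> assume \<omega>: "\<omega> \<in> space M" and le: "Z' n \<omega> \<le> S K' (B n) \<omega>" "Z n \<omega> \<le> S K (B n) \<omega>"
        and ev: "\<omega> \<in> {\<omega> \<in> space M. u * x n < Z n \<omega> \<and> x n < Z' n \<omega>}"
      show "\<omega> \<in> late_jump (\<delta> / Suc (card A)) N (x n) \<union> ((\<Union>a\<in>I. \<Union>b\<in>I - {a}. ?P a b) \<union> (\<Union>a\<in>K \<times> {..<N}. ?E a))"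
      proof (rule ccontr)
        assume n: "\<not> ?thesis"
        have "\<not> (u * x n < S K (B n) \<omega> \<and> x n < S K' (B n) \<omega>)"
        proof (rule one_big_jump_inclusion[OF \<omega> K \<delta>(2,3,4) x0])
          show "\<omega> \<notin> late_jump (\<delta> / Suc (card A)) N (x n)" using n by auto
          fix p i q j assume "(p, i) \<in> A \<times> {..<N}" "(q, j) \<in> A \<times> {..<N}" "(p, i) \<noteq> (q, j)"
          then have "\<omega> \<notin> ?P (p, i) (q, j)" using n unfolding I_def by blast
          then show "V p i \<omega> \<le> \<delta> / Suc (card (A \<times> {..<N})) * x n \<or> V q j \<omega> \<le> \<delta> / Suc (card (A \<times> {..<N})) * x n"
            using \<omega> unfolding I_def[symmetric] e_def[symmetric] by auto
        next
          fix p i assume pi: "(p, i) \<in> K \<times> {..<N}" "\<tau> p i \<omega> \<in> B n"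
          then have "\<omega> \<notin> ?E (p, i)" using n by blast
          with pi(2) show "V p i \<omega> \<le> (max u 1 - 2 * \<delta>) * x n"
            using \<omega> unfolding v_def[symmetric] by auto
        qed
        then show False using le ev by auto
      qed
    qed
    also have "\<dots> \<le> prob (late_jump (\<delta> / Suc (card A)) N (x n)) + (prob (\<Union>a\<in>I. \<Union>b\<in>I - {a}. ?P a b) + prob (\<Union>a\<in>K \<times> {..<N}. ?E a))"
      by (intro order_trans[OF measure_Un_le] add_mono order_refl measure_Un_le late_jump_event mU sets.Un)
    also have "prob (\<Union>a\<in>I. \<Union>b\<in>I - {a}. ?P a b) \<le> pairs n"
    proof -
      have "prob (\<Union>a\<in>I. \<Union>b\<in>I - {a}. ?P a b) \<le> (\<Sum>a\<in>I. prob (\<Union>b\<in>I - {a}. ?P a b))"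
        by (intro measure_UNION_le sets.finite_UN finI finite_Diff mP) blast+
      also have "\<dots> \<le> pairs n"
        unfolding pairs_def by (intro sum_mono measure_UNION_le finI finite_Diff mP) blast+
      finally show ?thesis .
    qed
    also have "prob (\<Union>a\<in>K \<times> {..<N}. ?E a) \<le> sing n * f (x n)"
    proof -
      have "prob (\<Union>a\<in>K \<times> {..<N}. ?E a) \<le> (\<Sum>a\<in>K \<times> {..<N}. prob (?E a))"
        by (intro measure_UNION_le fin_K mE)
      also have "\<dots> = sing n * f (x n)"
        unfolding sing_def by (simp add: case_prod_unfold sum_distrib_right f_nonzero)
      finally show ?thesis .
    qed
    also have "prob (late_jump (\<delta> / Suc (card A)) N (x n)) \<le> C * share_ratio ^ N * f (x n)" by (rule C(2)[OF xn])
    finally show ?thesis using f_pos[of "x n"] by (simp add: field_simps)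
  qed
  have tw: "(v - 2 * \<delta>) powr - \<alpha> * (\<Sum>p\<in>K. \<Sum>i<N. a p * weight p i (B n)) \<le> (v - 2 * \<delta>) powr - \<alpha> * total_weight K (B n)" for n
    by (intro mult_left_mono total_weight_truncated[OF KA B]) simp
  have "\<forall>\<^sub>F n in sequentially. pairs n / f (x n) < \<eta> / 8"
    "\<forall>\<^sub>F n in sequentially. sing n - (v - 2 * \<delta>) powr - \<alpha> * (\<Sum>p\<in>K. \<Sum>i<N. a p * weight p i (B n)) < \<eta> / 8"
    "\<forall>\<^sub>F n in sequentially. (v - 2 * \<delta>) powr - \<alpha> * total_weight K (B n) < (v - 2 * \<delta>) powr - \<alpha> * lam + \<eta> / 8"
    using \<eta> by (intro order_tendstoD(2)[OF lim_pairs] order_tendstoD(2)[OF lim_sing] order_tendstoD(2)[OF lim_lam]; simp)+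
  then show ?thesis using x_large
  proof eventually_elim
    case (elim n)
    show ?case
      using bound[OF elim(4)] elim(1-3) tw[of n] N \<delta>(1) \<eta> unfolding v_def[symmetric] mult.commute[of lam] by linarith
  qed
qed

text \<open>One claim of \<open>K\<close> in the window above
  \<open>(max u 1 + \<delta>) * x n\<close> raises both sums, and the surplus \<delta> pays for
  \<open>Q\<close> unless \<open>Q\<close> itself is large. Bonferroni replaces the union of these
  events by the sum of their probabilities, up to pairs.\<close>

lemma joint_tail_lower:
  assumes u: "0 < u" and \<eta>: "0 < \<eta>"
  shows "\<forall>\<^sub>F n in sequentially. lam * max u 1 powr - \<alpha> - \<eta>
    < prob {\<omega> \<in> space M. u * x n < Z n \<omega> \<and> x n < Z' n \<omega>} / f (x n)"
proof -
  define v where "v = max u 1"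
  have v: "0 < v" "u \<le> v" "1 \<le> v" by (auto simp: v_def)
  have "((\<lambda>\<delta>. (v + \<delta>) powr - \<alpha> * lam) \<longlongrightarrow> (v + 0) powr - \<alpha> * lam) (at_right 0)"
    using v by (intro tendsto_intros) auto
  then have "\<forall>\<^sub>F \<delta> in at_right 0. v powr - \<alpha> * lam - \<eta> / 8 < (v + \<delta>) powr - \<alpha> * lam"
    using \<eta> by (intro order_tendstoD(1)) auto
  then have "\<forall>\<^sub>F \<delta> in at_right 0. v powr - \<alpha> * lam - \<eta> / 8 < (v + \<delta>) powr - \<alpha> * lam \<and> 0 < \<delta>"
    using eventually_at_right_less[of "0::real"] by (rule eventually_conj)
  then obtain \<delta> where \<delta>: "v powr - \<alpha> * lam - \<eta> / 8 < (v + \<delta>) powr - \<alpha> * lam" "0 < \<delta>"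
    using eventually_happens'[OF trivial_limit_at_right_real] by force
  have w: "0 < v + \<delta>" using \<delta> v by linarith
  obtain C where C: "\<And>N B. B \<in> sets borel \<Longrightarrow>
    total_weight K B - C * \<rho> ^ N \<le> (\<Sum>p\<in>K. \<Sum>i<N. a p * weight p i B)"
    using total_weight_remainder[OF KA] by blast
  have "(\<lambda>N. (v + \<delta>) powr - \<alpha> * (C * \<rho> ^ N)) \<longlonglongrightarrow> (v + \<delta>) powr - \<alpha> * (C * 0)"
    using \<rho> by (intro tendsto_intros LIMSEQ_power_zero) auto
  then have "\<forall>\<^sub>F N in sequentially. (v + \<delta>) powr - \<alpha> * (C * \<rho> ^ N) < \<eta> / 8" using \<eta> by (intro order_tendstoD(2)) auto
  then obtain N where N: "(v + \<delta>) powr - \<alpha> * (C * \<rho> ^ N) < \<eta> / 8" by (auto simp: eventually_sequentially)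
  define J where "J = K \<times> {..<N}"
  have finJ: "finite J" using fin_K by (simp add: J_def)
  define pairs where "pairs n = (\<Sum>a\<in>J. \<Sum>b\<in>J - {a}. prob {\<omega> \<in> space M. (v + \<delta>) * x n < V (fst a) (snd a) \<omega> \<and> (v + \<delta>) * x n < V (fst b) (snd b) \<omega>})" for n
  define sing where "sing n = (\<Sum>(p, i)\<in>K \<times> {..<N}. prob {\<omega> \<in> space M. (v + \<delta>) * x n < V p i \<omega> \<and> \<tau> p i \<omega> \<in> B n} / f (x n))" for n
  define q where "q n = prob {\<omega> \<in> space M. \<delta> * x n < Q \<omega>}" for n
  have lim_pairs: "(\<lambda>n. pairs n / f (x n)) \<longlonglongrightarrow> 0"
    unfolding pairs_def using KA by (intro pairs_negligible[OF w, of J N]) (auto simp: J_def)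
  have lim_sing: "(\<lambda>n. sing n - (v + \<delta>) powr - \<alpha> * (\<Sum>p\<in>K. \<Sum>i<N. a p * weight p i (B n))) \<longlonglongrightarrow> 0"
    unfolding sing_def by (rule breiman_sum[OF w])
  have lim_lam: "(\<lambda>n. (v + \<delta>) powr - \<alpha> * total_weight K (B n)) \<longlonglongrightarrow> (v + \<delta>) powr - \<alpha> * lam"
    by (intro tendsto_intros lam)
  have dx: "filterlim (\<lambda>n. \<delta> * x n) at_top sequentially"
    by (rule filterlim_tendsto_pos_mult_at_top[OF tendsto_const \<delta>(2) x])
  have "(\<lambda>n. q n / f (\<delta> * x n) * (f (\<delta> * x n) / f (x n))) \<longlonglongrightarrow> 0 * \<delta> powr - \<alpha>"
    unfolding q_def by (intro tendsto_mult filterlim_compose[OF Q_negligible dx] f_ratio[OF x \<delta>(2)])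
  then have lim_q: "(\<lambda>n. q n / f (x n)) \<longlonglongrightarrow> 0" by (simp add: f_nonzero)
  have bound: "sing n - pairs n / f (x n) - q n / f (x n) \<le> prob {\<omega> \<in> space M. u * x n < Z n \<omega> \<and> x n < Z' n \<omega>} / f (x n)"
    if xn: "potter_x \<le> x n" for n
  proof -
    have x0: "0 < x n" using xn potter(2) by simp
    let ?P = "\<lambda>a b. {\<omega> \<in> space M. (v + \<delta>) * x n < V (fst a) (snd a) \<omega> \<and> (v + \<delta>) * x n < V (fst b) (snd b) \<omega>}"
    let ?E = "\<lambda>a. {\<omega> \<in> space M. (v + \<delta>) * x n < V (fst a) (snd a) \<omega> \<and> \<tau> (fst a) (snd a) \<omega> \<in> B n}"
    have JA: "fst a \<in> A" if "a \<in> J" for a using that KA by (auto simp: J_def)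
    have mE: "?E a \<in> events" if "a \<in> J" for a
      by (rule single_event[OF JA[OF that] B])
    note [measurable] = Z_rv Q_rv
    have "(\<Sum>a\<in>J. prob (?E a)) \<le> prob (\<Union>a\<in>J. ?E a) + (\<Sum>a\<in>J. \<Sum>b\<in>J - {a}. prob (?E a \<inter> ?E b))"
      by (rule bonferroni_lower[OF finJ mE])
    also have "(\<Sum>a\<in>J. \<Sum>b\<in>J - {a}. prob (?E a \<inter> ?E b)) \<le> pairs n"
      unfolding pairs_def using JA by (intro sum_mono finite_measure_mono pair_event) auto
    also have "prob (\<Union>a\<in>J. ?E a) \<le> prob ({\<omega> \<in> space M. u * x n < Z n \<omega> \<and> x n < Z' n \<omega>} \<union> {\<omega> \<in> space M. \<delta> * x n < Q \<omega>})"
      using AE_summable Z_lower[of n]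
    proof (intro finite_measure_mono_AE, elim AE_mp, intro AE_I2 impI)
      fix \<omega> assume \<omega>: "\<omega> \<in> space M" and sm: "\<forall>p\<in>A. summable (\<lambda>i. V p i \<omega>)"
        and le: "S K' (B n) \<omega> - Q \<omega> \<le> Z' n \<omega>" "S K (B n) \<omega> - Q \<omega> \<le> Z n \<omega>" and ev: "\<omega> \<in> (\<Union>a\<in>J. ?E a)"
      from ev obtain p i where pi: "p \<in> K" "i < N" "(v + \<delta>) * x n < V p i \<omega>" "\<tau> p i \<omega> \<in> B n"
        unfolding J_def by auto
      have VS: "V p i \<omega> \<le> S L (B n) \<omega>" if L: "p \<in> L" "L \<subseteq> A" for L
      proof -
        have nn: "0 \<le> V q j \<omega> * indicator (B n) (\<tau> q j \<omega>)" if "q \<in> L" for q j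
          using V_nonneg[of q \<omega>] \<omega> that L by (auto simp: indicator_def)
        have sm': "summable (\<lambda>j. V q j \<omega> * indicator (B n) (\<tau> q j \<omega>))" if q: "q \<in> L" for q
        proof (rule summable_comparison_test'[of "\<lambda>j. V q j \<omega>" 0])
          show "summable (\<lambda>j. V q j \<omega>)" using sm q L by auto
        qed (use V_nonneg[of q \<omega>] \<omega> q L in \<open>auto simp: indicator_def\<close>)
        have "V p i \<omega> = (\<Sum>j\<in>{i}. V p j \<omega> * indicator (B n) (\<tau> p j \<omega>))" using pi by simp
        also have "\<dots> \<le> (\<Sum>j. V p j \<omega> * indicator (B n) (\<tau> p j \<omega>))"
          using nn L by (intro sum_le_suminf sm') auto
        also have "\<dots> \<le> S L (B n) \<omega>"
          unfolding S_def
          by (rule member_le_sum[of p L "\<lambda>p. \<Sum>j. V p j \<omega> * indicator (B n) (\<tau> p j \<omega>)"])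
             (use nn L finite_A in \<open>auto intro!: suminf_nonneg sm' intro: finite_subset\<close>)
        finally show ?thesis .
      qed
      have 1: "V p i \<omega> \<le> S K (B n) \<omega>" "V p i \<omega> \<le> S K' (B n) \<omega>" using VS pi K KA by auto
      show "\<omega> \<in> {\<omega> \<in> space M. u * x n < Z n \<omega> \<and> x n < Z' n \<omega>} \<union> {\<omega> \<in> space M. \<delta> * x n < Q \<omega>}"
      proof (cases "\<delta> * x n < Q \<omega>")
        case False
        then have "v * x n < Z n \<omega>" "v * x n < Z' n \<omega>" using 1 le pi(3) by (auto simp: distrib_right)
        moreover have "u * x n \<le> v * x n" "1 * x n \<le> v * x n" using v x0 by (auto intro: mult_right_mono)
        ultimately show ?thesis using \<omega> by simp
      qed (use \<omega> in simp)
    qed measurable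
    also have "\<dots> \<le> prob {\<omega> \<in> space M. u * x n < Z n \<omega> \<and> x n < Z' n \<omega>} + q n"
      unfolding q_def by (rule measure_Un_le) measurable
    finally have "(\<Sum>a\<in>J. prob (?E a)) \<le> prob {\<omega> \<in> space M. u * x n < Z n \<omega> \<and> x n < Z' n \<omega>} + q n + pairs n" by simp
    moreover have "(\<Sum>a\<in>J. prob (?E a)) = sing n * f (x n)"
      unfolding sing_def J_def by (simp add: case_prod_unfold sum_distrib_right f_nonzero)
    ultimately have "sing n \<le> (prob {\<omega> \<in> space M. u * x n < Z n \<omega> \<and> x n < Z' n \<omega>} + q n + pairs n) / f (x n)"
      using f_pos[of "x n"] by (simp add: pos_le_divide_eq)
    then show ?thesis by (simp add: add_divide_distrib)
  qed
  have tw: "(v + \<delta>) powr - \<alpha> * total_weight K (B n) - (v + \<delta>) powr - \<alpha> * (C * \<rho> ^ N) \<le> (v + \<delta>) powr - \<alpha> * (\<Sum>p\<in>K. \<Sum>i<N. a p * weight p i (B n))" for n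
    unfolding right_diff_distrib[symmetric] by (intro mult_left_mono C B) simp
  have "\<forall>\<^sub>F n in sequentially. pairs n / f (x n) < \<eta> / 8" "\<forall>\<^sub>F n in sequentially. q n / f (x n) < \<eta> / 8"
    using \<eta> by (intro order_tendstoD(2)[OF lim_pairs] order_tendstoD(2)[OF lim_q]; simp)+
  moreover have
    "\<forall>\<^sub>F n in sequentially. - \<eta> / 8 < sing n - (v + \<delta>) powr - \<alpha> * (\<Sum>p\<in>K. \<Sum>i<N. a p * weight p i (B n))"
    "\<forall>\<^sub>F n in sequentially. (v + \<delta>) powr - \<alpha> * lam - \<eta> / 8 < (v + \<delta>) powr - \<alpha> * total_weight K (B n)"
    using \<eta> by (intro order_tendstoD(1)[OF lim_sing] order_tendstoD(1)[OF lim_lam]; simp)+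
  ultimately show ?thesis using x_large
  proof eventually_elim
    case (elim n)
    show ?case
      using bound[OF elim(5)] elim(1-4) tw[of n] N \<delta>(1) \<eta> unfolding v_def[symmetric] mult.commute[of lam] by linarith
  qed
qed

lemma joint_tail:
  assumes "0 < u"
  shows "(\<lambda>n. prob {\<omega> \<in> space M. u * x n < Z n \<omega> \<and> x n < Z' n \<omega>} / f (x n)) \<longlonglongrightarrow> lam * max u 1 powr - \<alpha>"
proof (rule order_tendstoI)
  fix c assume "c < lam * max u 1 powr - \<alpha>"
  then show "\<forall>\<^sub>F n in sequentially. c < prob {\<omega> \<in> space M. u * x n < Z n \<omega> \<and> x n < Z' n \<omega>} / f (x n)"
    using joint_tail_lower[OF assms, of "lam * max u 1 powr - \<alpha> - c"] by simp
next
  fix c assume "lam * max u 1 powr - \<alpha> < c"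
  then show "\<forall>\<^sub>F n in sequentially. prob {\<omega> \<in> space M. u * x n < Z n \<omega> \<and> x n < Z' n \<omega>} / f (x n) < c"
    using joint_tail_upper[OF assms, of "c - lam * max u 1 powr - \<alpha>"] by simp
qed

end

section \<open>Expected excesses\<close>

text \<open>The excess over \<open>y\<close> is the length of the set of levels \<open>u\<close>
  with \<open>y \<le> u < Z\<close>; Tonelli exchanges levels and outcomes.\<close>

lemma (in prob_space) nn_integral_excess_layers:
  assumes [measurable]: "Z \<in> borel_measurable M" "E \<in> sets M"
  shows "(\<integral>\<^sup>+\<omega>. ennreal (max (Z \<omega> - y) 0 * indicator E \<omega>) \<partial>M)
    = (\<integral>\<^sup>+u. indicator {y..} u * emeasure M ({\<omega> \<in> space M. u < Z \<omega>} \<inter> E) \<partial>lborel)"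
proof -
  interpret pair_sigma_finite M lborel by unfold_locales
  let ?g = "\<lambda>\<omega> u. (if y \<le> u \<and> u < Z \<omega> then indicator E \<omega> else 0) :: ennreal"
  have "(\<integral>\<^sup>+\<omega>. ennreal (max (Z \<omega> - y) 0 * indicator E \<omega>) \<partial>M) = (\<integral>\<^sup>+\<omega>. \<integral>\<^sup>+u. ?g \<omega> u \<partial>lborel \<partial>M)"
  proof (rule nn_integral_cong)
    fix \<omega>
    have "(\<integral>\<^sup>+u. ?g \<omega> u \<partial>lborel) = (\<integral>\<^sup>+u. indicator E \<omega> * indicator {y..<Z \<omega>} u \<partial>lborel)"
      by (intro nn_integral_cong) (auto simp: indicator_def)
    also have "\<dots> = ennreal (max (Z \<omega> - y) 0 * indicator E \<omega>)"
      unfolding nn_integral_cmult_indicator[of "{y..<Z \<omega>}" lborel "indicator E \<omega>", simplified]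
      by (cases "y \<le> Z \<omega>") (auto simp: indicator_def max_def)
    finally show "ennreal (max (Z \<omega> - y) 0 * indicator E \<omega>) = (\<integral>\<^sup>+u. ?g \<omega> u \<partial>lborel)" by simp
  qed
  also have "\<dots> = (\<integral>\<^sup>+u. \<integral>\<^sup>+\<omega>. ?g \<omega> u \<partial>M \<partial>lborel)"
    by (rule Fubini'[symmetric]) measurable
  also have "\<dots> = (\<integral>\<^sup>+u. indicator {y..} u * emeasure M ({\<omega> \<in> space M. u < Z \<omega>} \<inter> E) \<partial>lborel)"
  proof (rule nn_integral_cong)
    fix u
    have "(\<integral>\<^sup>+\<omega>. ?g \<omega> u \<partial>M) = (\<integral>\<^sup>+\<omega>. indicator {y..} u * indicator ({\<omega> \<in> space M. u < Z \<omega>} \<inter> E) \<omega> \<partial>M)"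
      by (intro nn_integral_cong) (auto simp: indicator_def)
    then show "(\<integral>\<^sup>+\<omega>. ?g \<omega> u \<partial>M) = indicator {y..} u * emeasure M ({\<omega> \<in> space M. u < Z \<omega>} \<inter> E)"
      by (simp add: nn_integral_cmult)
  qed
  finally show ?thesis .
qed

lemma has_bochner_integral_powr_tail:
  fixes p :: real
  assumes "1 < p"
  shows "has_bochner_integral lborel (\<lambda>u. indicator {1..} u * u powr - p) (1 / (p - 1))"
proof (rule has_bochner_integral_nn_integral)
  have "(\<integral>\<^sup>+u. ennreal (u powr - p) * indicator {1..} u \<partial>lborel) = ennreal (0 - (1::real) powr (1 - p) / (1 - p))"
  proof (rule nn_integral_FTC_atLeast[where F = "\<lambda>u. u powr (1 - p) / (1 - p)"])
    show "((\<lambda>u. u powr (1 - p) / (1 - p)) \<longlongrightarrow> 0) at_top"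
      using assms by (intro tendsto_divide_zero tendsto_neg_powr filterlim_ident) auto
    fix u :: real assume "1 \<le> u"
    then show "((\<lambda>u. u powr (1 - p) / (1 - p)) has_real_derivative u powr - p) (at u)"
      using assms by (auto intro!: derivative_eq_intros)
  qed auto
  also have "0 - 1 powr (1 - p) / (1 - p) = 1 / (p - 1)" using assms by (simp add: field_simps)
  finally show "(\<integral>\<^sup>+u. ennreal (indicator {1..} u * u powr - p) \<partial>lborel) = ennreal (1 / (p - 1))"
    by (simp add: ennreal_mult' ennreal_indicator mult.commute)
qed (use assms in auto)

section \<open>Excesses and means on the tail event\<close>

context heavy_tailed_losses
begin

lemma S_nonneg_AE:
  assumes "L \<subseteq> A"
  shows "AE \<omega> in M. 0 \<le> S L (B n) \<omega>"
  using AE_summable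
proof (elim AE_mp, intro AE_I2 impI)
  fix \<omega> assume \<omega>: "\<omega> \<in> space M" and sm: "\<forall>p\<in>A. summable (\<lambda>i. V p i \<omega>)"
  show "0 \<le> S L (B n) \<omega>"
    unfolding S_def
  proof (intro sum_nonneg suminf_nonneg)
    fix p assume p: "p \<in> L"
    show "0 \<le> V p i \<omega> * indicator (B n) (\<tau> p i \<omega>)" for i
      using V_nonneg[of p \<omega>] p assms \<omega> by (auto simp: indicator_def)
    show "summable (\<lambda>j. V p j \<omega> * indicator (B n) (\<tau> p j \<omega>))"
    proof (rule summable_comparison_test'[of "\<lambda>j. V p j \<omega>" 0])
      show "summable (\<lambda>j. V p j \<omega>)" using sm p assms by auto
    qed (use V_nonneg[of p \<omega>] \<omega> p assms in \<open>auto simp: indicator_def\<close>)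
  qed
qed

abbreviation joint where "joint n u \<equiv> prob {\<omega> \<in> space M. u * x n < Z n \<omega> \<and> x n < Z' n \<omega>}"

lemma joint_anti:
  assumes "0 < x n" "u \<le> w"
  shows "joint n w \<le> joint n u"
proof (rule finite_measure_mono)
  have "u * x n \<le> w * x n" using assms by (intro mult_right_mono) auto
  then show "{\<omega> \<in> space M. w * x n < Z n \<omega> \<and> x n < Z' n \<omega>} \<subseteq> {\<omega> \<in> space M. u * x n < Z n \<omega> \<and> x n < Z' n \<omega>}" by auto
qed (use Z_rv in measurable)

lemma joint_measurable:
  assumes "0 < x n"
  shows "joint n \<in> borel_measurable borel"
proof -
  have "(\<lambda>u. - joint n u) \<in> borel_measurable borel"
    by (intro borel_measurable_mono monoI) (use joint_anti[OF assms] in auto)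
  from borel_measurable_uminus[OF this] show ?thesis by simp
qed

lemma expectation_excess_layers:
  assumes "0 < x n"
  shows "expectation (\<lambda>\<omega>. max (Z n \<omega> - y * x n) 0 * indicator {\<omega> \<in> space M. x n < Z' n \<omega>} \<omega>)
      = x n * (LINT u|lborel. indicator {y..} u * joint n u)"
    and "integrable lborel (\<lambda>u. indicator {y..} u * joint n u) \<Longrightarrow>
      integrable M (\<lambda>\<omega>. max (Z n \<omega> - y * x n) 0 * indicator {\<omega> \<in> space M. x n < Z' n \<omega>} \<omega>)"
proof -
  let ?e = "\<lambda>\<omega>. max (Z n \<omega> - y * x n) 0 * indicator {\<omega> \<in> space M. x n < Z' n \<omega>} \<omega>"
  note [measurable] = Z_rv joint_measurable[OF assms]
  let ?E = "{\<omega> \<in> space M. x n < Z' n \<omega>}"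
  have eq: "?e \<omega> = x n * (max (Z n \<omega> / x n - y) 0 * indicator ?E \<omega>)" for \<omega>
  proof -
    have "x n * max (Z n \<omega> / x n - y) 0 = max (Z n \<omega> - y * x n) 0"
      using assms by (auto simp: max_def field_simps)
    then show ?thesis by simp
  qed
  have nn: "(\<integral>\<^sup>+\<omega>. ennreal (max (Z n \<omega> / x n - y) 0 * indicator ?E \<omega>) \<partial>M) = (\<integral>\<^sup>+u. ennreal (indicator {y..} u * joint n u) \<partial>lborel)"
  proof -
    have "(\<integral>\<^sup>+\<omega>. ennreal (max (Z n \<omega> / x n - y) 0 * indicator ?E \<omega>) \<partial>M)
      = (\<integral>\<^sup>+u. indicator {y..} u * emeasure M ({\<omega> \<in> space M. u < Z n \<omega> / x n} \<inter> ?E) \<partial>lborel)"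
      by (rule nn_integral_excess_layers) measurable
    also have "\<dots> = (\<integral>\<^sup>+u. ennreal (indicator {y..} u * joint n u) \<partial>lborel)"
    proof (rule nn_integral_cong)
      fix u
      have "{\<omega> \<in> space M. u < Z n \<omega> / x n} \<inter> ?E = {\<omega> \<in> space M. u * x n < Z n \<omega> \<and> x n < Z' n \<omega>}"
        using assms by (auto simp: field_simps)
      then show "indicator {y..} u * emeasure M ({\<omega> \<in> space M. u < Z n \<omega> / x n} \<inter> ?E) = ennreal (indicator {y..} u * joint n u)"
        by (simp add: emeasure_eq_measure ennreal_mult' ennreal_indicator)
    qed
    finally show ?thesis .
  qed
  have "expectation (\<lambda>\<omega>. max (Z n \<omega> / x n - y) 0 * indicator ?E \<omega>) = (LINT u|lborel. indicator {y..} u * joint n u)"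
    by (subst (1 2) integral_eq_nn_integral) (auto simp: nn)
  then show "expectation (\<lambda>\<omega>. ?e \<omega>) = x n * (LINT u|lborel. indicator {y..} u * joint n u)"
    unfolding eq by simp
  assume int: "integrable lborel (\<lambda>u. indicator {y..} u * joint n u)"
  have "integrable M (\<lambda>\<omega>. max (Z n \<omega> / x n - y) 0 * indicator ?E \<omega>)"
  proof (rule integrableI_nonneg)
    show "(\<integral>\<^sup>+\<omega>. ennreal (max (Z n \<omega> / x n - y) 0 * indicator ?E \<omega>) \<partial>M) < \<infinity>"
      unfolding nn using int by (simp add: integrable_iff_bounded)
  qed auto
  then show "integrable M ?e" unfolding eq by simp
qed

text \<open>Dominates the scaled joint tail as a function of the level \<open>u\<close>: up to 1
  only the event for \<open>Z'\<close> is used, beyond 1 only the event for \<open>Z\<close>.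
  Integrability at infinity rests on \<open>1 < \<gamma>\<close>.\<close>

definition layer_bound :: "real \<Rightarrow> real \<Rightarrow> real" where
  "layer_bound C u = C * (indicator {0..1} u + indicator {1..} u * u powr - \<gamma>)"

lemma layer_bound_integrable: "integrable lborel (layer_bound C)"
  using has_bochner_integral_powr_tail[OF exponents(1)] integrable_real_indicator[of "{0..1::real}" lborel]
  unfolding layer_bound_def[abs_def] by (auto simp: has_bochner_integral_iff)

lemma joint_le_layer_bound:
  obtains C where "\<forall>\<^sub>F n in sequentially. \<forall>u\<ge>0. joint n u / f (x n) \<le> layer_bound C u"
proof -
  obtain C where C: "0 \<le> C" "\<And>K B Z x. K \<subseteq> A \<Longrightarrow> (AE \<omega> in M. Z \<omega> \<le> S K B \<omega>) \<Longrightarrow> potter_x \<le> x \<Longrightarrow>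
    prob {\<omega> \<in> space M. x < Z \<omega>} \<le> C * f x" using tail_bound by blast
  obtain D x1 where D: "0 < D" "0 < x1"
    "\<And>x w. x1 \<le> x \<Longrightarrow> 0 < w \<Longrightarrow> f (x / w) \<le> D * (w powr \<gamma> + w powr \<beta>) * f x"
    using rv_potter[of \<gamma> \<beta>] exponents by auto
  have "\<forall>\<^sub>F n in sequentially. x1 \<le> x n" using x unfolding filterlim_at_top by blast
  with x_large have "\<forall>\<^sub>F n in sequentially. \<forall>u\<ge>0. joint n u / f (x n) \<le> layer_bound (C + C * (D * 2)) u"
  proof eventually_elim
    case (elim n)
    have x0: "0 < x n" using elim potter(2) by simp
    note [measurable] = Z_rv
    show ?case
    proof (intro allI impI)
      fix u :: real assume u: "0 \<le> u"
      have "joint n u \<le> prob {\<omega> \<in> space M. x n < Z' n \<omega>}" by (intro finite_measure_mono) auto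
      also have "\<dots> \<le> C * f (x n)" using C(2)[OF K(2) Z_upper(2) elim(1)] .
      finally have 1: "joint n u / f (x n) \<le> C" using f_pos[of "x n"] by (simp add: field_simps)
      show "joint n u / f (x n) \<le> layer_bound (C + C * (D * 2)) u"
      proof (cases "u \<le> 1")
        case True
        have "C \<le> (C + C * (D * 2)) * 1" using C(1) D by simp
        also have "\<dots> \<le> layer_bound (C + C * (D * 2)) u"
          unfolding layer_bound_def using u True C(1) D by (intro mult_left_mono) (auto simp: indicator_def)
        finally show ?thesis using 1 by linarith
      next
        case False
        have "potter_x \<le> u * x n" using elim(1) False x0 by (smt (verit) mult_less_cancel_right2)
        have "joint n u \<le> prob {\<omega> \<in> space M. u * x n < Z n \<omega>}" by (intro finite_measure_mono) auto
        also have "\<dots> \<le> C * f (u * x n)" using C(2)[OF KA Z_upper(1) \<open>potter_x \<le> u * x n\<close>] .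
        \<comment> \<open>Potter's bound with \<open>w = 1 / u\<close>; as \<open>u > 1\<close>, the
          power with exponent \<gamma> is then the larger one.\<close>
        also have "f (u * x n) \<le> D * (u powr - \<gamma> + u powr - \<beta>) * f (x n)"
          using D(3)[OF elim(2), of "1 / u"] False by (simp add: powr_divide powr_minus_divide mult.commute)
        also have "u powr - \<beta> \<le> u powr - \<gamma>" using False exponents by (intro powr_mono) auto
        finally have "joint n u \<le> C * (D * (2 * u powr - \<gamma>) * f (x n))"
          using C(1) D(1) f_pos[of "x n"] by (simp add: mult_left_mono mult_right_mono)
        then have "joint n u / f (x n) \<le> C * (D * 2) * u powr - \<gamma>"
          using f_pos[of "x n"] by (simp add: field_simps)
        also have "\<dots> \<le> (C + C * (D * 2)) * u powr - \<gamma>" using C(1) by (intro mult_right_mono) auto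
        also have "\<dots> = layer_bound (C + C * (D * 2)) u" using False by (simp add: layer_bound_def)
        finally show ?thesis .
      qed
    qed
  qed
  then show ?thesis by (rule that)
qed

text \<open>Below level 1 the limit is constant in \<open>u\<close> and contributes
  \<open>1 - y\<close>, above it the power tail contributes \<open>1 / (\<alpha> - 1)\<close>. After
  rescaling these become the difference of two powers and the last term in the asymptotics of
  \<open>SES\<close>.\<close>

lemma limit_layer_integral:
  assumes "0 \<le> y" "y \<le> 1"
  shows "(LINT u|lborel. indicator {y..} u * (lam * max u 1 powr - \<alpha>)) = lam * (1 - y + 1 / (\<alpha> - 1))"
proof -
  have "has_bochner_integral lborel (\<lambda>u. indicator {y..<1} u :: real) (1 - y)"
    using assms has_bochner_integral_real_indicator[of "{y..<1}" lborel] by simp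
  from has_bochner_integral_add[OF this has_bochner_integral_powr_tail[OF index_gt_1]]
  have "has_bochner_integral lborel (\<lambda>u. lam * (indicator {y..<1} u + indicator {1..} u * u powr - \<alpha>)) (lam * (1 - y + 1 / (\<alpha> - 1)))"
    by (rule has_bochner_integral_mult_right)
  moreover have "lam * (indicator {y..<1} u + indicator {1..} u * u powr - \<alpha>) = indicator {y..} u * (lam * max u 1 powr - \<alpha>)" for u
    using assms by (auto simp: indicator_def max_def)
  ultimately show ?thesis by (simp add: has_bochner_integral_iff)
qed

text \<open>In the application \<open>y n * x n\<close> is the quantile of a line and
  \<open>x n\<close> that of the total, whence \<open>y0 \<le> 1\<close>. Dominated convergence runs
  over the levels \<open>u\<close>. The integrability assertion justifies splitting an expectation
  in \<open>mean_limit\<close>.\<close>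

lemma excess_limit:
  assumes y: "y \<longlonglongrightarrow> y0" "\<forall>\<^sub>F n in sequentially. 0 \<le> y n" and y0: "0 \<le> y0" "y0 \<le> 1"
  shows "(\<lambda>n. expectation (\<lambda>\<omega>. max (Z n \<omega> - y n * x n) 0 * indicator {\<omega> \<in> space M. x n < Z' n \<omega>} \<omega>) / (x n * f (x n)))
    \<longlonglongrightarrow> lam * (1 - y0 + 1 / (\<alpha> - 1))"
    and "\<forall>\<^sub>F n in sequentially. integrable M (\<lambda>\<omega>. max (Z n \<omega> - y n * x n) 0 * indicator {\<omega> \<in> space M. x n < Z' n \<omega>} \<omega>)"
proof -
  obtain C where "\<forall>\<^sub>F n in sequentially. \<forall>u\<ge>0. joint n u / f (x n) \<le> layer_bound C u"
    by (rule joint_le_layer_bound)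
  with y(2) x_large have "\<forall>\<^sub>F n in sequentially. 0 \<le> y n \<and> potter_x \<le> x n \<and> (\<forall>u\<ge>0. joint n u / f (x n) \<le> layer_bound C u)"
    by eventually_elim auto
  then obtain n0 where n0: "\<And>n. n0 \<le> n \<Longrightarrow> 0 \<le> y n \<and> potter_x \<le> x n \<and> (\<forall>u\<ge>0. joint n u / f (x n) \<le> layer_bound C u)"
    unfolding eventually_sequentially by blast
  have x0: "0 < x n" if "n0 \<le> n" for n using n0[OF that] potter(2) by linarith
  have m: "joint n \<in> borel_measurable borel" if "n0 \<le> n" for n by (rule joint_measurable[OF x0[OF that]])
  have bound: "norm (indicator {y n..} u * (joint n u / f (x n))) \<le> layer_bound C u" if "n0 \<le> n" for n u
  proof (cases "y n \<le> u")
    case True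
    then have "0 \<le> u" using n0[OF that] by linarith
    then show ?thesis using n0[OF that] True f_pos[of "x n"] by auto
  next
    case False
    have "0 \<le> layer_bound C u"
    proof (cases "0 \<le> u")
      case True
      have "0 \<le> joint n u / f (x n)" using f_pos[of "x n"] by simp
      also have "\<dots> \<le> layer_bound C u" using n0[OF that] True by blast
      finally show ?thesis .
    qed (simp add: layer_bound_def)
    then show ?thesis using False by simp
  qed
  have lim: "(\<lambda>n. LINT u|lborel. indicator {y (n + n0)..} u * (joint (n + n0) u / f (x (n + n0))))
     \<longlonglongrightarrow> (LINT u|lborel. indicator {y0..} u * (lam * max u 1 powr - \<alpha>))"
  proof (rule integral_dominated_convergence[OF _ _ layer_bound_integrable])
    show "(\<lambda>u. indicator {y (n + n0)..} u * (joint (n + n0) u / f (x (n + n0)))) \<in> borel_measurable lborel" for n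
      using m[of "n + n0"] by (auto intro!: borel_measurable_times borel_measurable_divide)
    show "(\<lambda>u. indicator {y0..} u * (lam * max u 1 powr - \<alpha>)) \<in> borel_measurable lborel" by measurable
    \<comment> \<open>At \<open>u = y0\<close> the indicators of \<open>{y n..}\<close> may
      oscillate.\<close>
    have "AE u in lborel. u \<noteq> y0" by (rule AE_lborel_singleton)
    then show "AE u in lborel. (\<lambda>n. indicator {y (n + n0)..} u * (joint (n + n0) u / f (x (n + n0))))
       \<longlonglongrightarrow> indicator {y0..} u * (lam * max u 1 powr - \<alpha>)"
    proof eventually_elim
      case (elim u)
      have "(\<lambda>n. indicator {y n..} u * (joint n u / f (x n))) \<longlonglongrightarrow> indicator {y0..} u * (lam * max u 1 powr - \<alpha>)"
      proof (cases "y0 < u")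
        case True
        have "\<forall>\<^sub>F n in sequentially. y n < u" using order_tendstoD(2)[OF y(1) True] .
        then have "\<forall>\<^sub>F n in sequentially. joint n u / f (x n) = indicator {y n..} u * (joint n u / f (x n))"
          by eventually_elim simp
        from Lim_transform_eventually[OF joint_tail this] show ?thesis using True y0(1) by simp
      next
        case False
        then have "u < y0" using elim by simp
        then have "\<forall>\<^sub>F n in sequentially. u < y n" by (rule order_tendstoD(1)[OF y(1)])
        then have "\<forall>\<^sub>F n in sequentially. indicator {y n..} u * (joint n u / f (x n)) = 0"
          by eventually_elim simp
        then show ?thesis using \<open>u < y0\<close> by (simp add: tendsto_eventually)
      qed
      then show ?case by (rule LIMSEQ_ignore_initial_segment)
    qed
    show "AE u in lborel. norm (indicator {y (n + n0)..} u * (joint (n + n0) u / f (x (n + n0)))) \<le> layer_bound C u" for n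
      using bound[of "n + n0"] by auto
  qed
  have eq: "expectation (\<lambda>\<omega>. max (Z n \<omega> - y n * x n) 0 * indicator {\<omega> \<in> space M. x n < Z' n \<omega>} \<omega>) / (x n * f (x n))
      = (LINT u|lborel. indicator {y n..} u * (joint n u / f (x n)))" if "n0 \<le> n" for n
    unfolding expectation_excess_layers(1)[OF x0[OF that]] using x0[OF that] by simp
  show "(\<lambda>n. expectation (\<lambda>\<omega>. max (Z n \<omega> - y n * x n) 0 * indicator {\<omega> \<in> space M. x n < Z' n \<omega>} \<omega>) / (x n * f (x n)))
    \<longlonglongrightarrow> lam * (1 - y0 + 1 / (\<alpha> - 1))"
    by (rule LIMSEQ_offset[of _ n0]) (use lim in \<open>simp add: eq limit_layer_integral[OF y0]\<close>)
  show "\<forall>\<^sub>F n in sequentially. integrable M (\<lambda>\<omega>. max (Z n \<omega> - y n * x n) 0 * indicator {\<omega> \<in> space M. x n < Z' n \<omega>} \<omega>)"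
    unfolding eventually_sequentially
  proof (intro exI allI impI)
    fix n assume n: "n0 \<le> n"
    have "integrable lborel (\<lambda>u. indicator {y n..} u * (joint n u / f (x n)))"
    proof (rule Bochner_Integration.integrable_bound[OF layer_bound_integrable[of C]])
      show "(\<lambda>u. indicator {y n..} u * (joint n u / f (x n))) \<in> borel_measurable lborel"
        using m[OF n] by (auto intro!: borel_measurable_times borel_measurable_divide)
      show "AE u in lborel. norm (indicator {y n..} u * (joint n u / f (x n))) \<le> norm (layer_bound C u)"
        using bound[OF n] by (auto intro: order_trans[OF _ abs_ge_self])
    qed
    from integrable_mult_left[OF this, of "f (x n)"]
    have "integrable lborel (\<lambda>u. indicator {y n..} u * joint n u)" by (simp add: f_nonzero)
    then show "integrable M (\<lambda>\<omega>. max (Z n \<omega> - y n * x n) 0 * indicator {\<omega> \<in> space M. x n < Z' n \<omega>} \<omega>)"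
      by (rule expectation_excess_layers(2)[OF x0[OF n]])
  qed
qed

text \<open>The positive part is an excess over 0. The negative part is at most \<open>Q\<close>: it
  costs \<open>\<epsilon> * x n\<close> on an event of probability at most a multiple of
  \<open>f (x n)\<close>, plus a moment term of order \<open>x n powr (1 - p)\<close>, which is
  negligible against \<open>x n * f (x n)\<close> because \<open>\<alpha> < p\<close>.\<close>

lemma mean_limit:
  assumes Q: "\<And>\<omega>. \<omega> \<in> space M \<Longrightarrow> 0 \<le> Q \<omega>" and p: "\<alpha> < p" and Qp: "integrable M (\<lambda>\<omega>. Q \<omega> powr p)"
  shows "(\<lambda>n. expectation (\<lambda>\<omega>. Z n \<omega> * indicator {\<omega> \<in> space M. x n < Z' n \<omega>} \<omega>) / (x n * f (x n)))
    \<longlonglongrightarrow> lam * (\<alpha> / (\<alpha> - 1))"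
proof -
  note [measurable] = Z_rv Q_rv
  let ?E = "\<lambda>n. {\<omega> \<in> space M. x n < Z' n \<omega>}"
  have p1: "1 < p" using p index_gt_1 by simp
  \<comment> \<open>A pointwise form of Markov's inequality: for \<open>q > s\<close> write
    \<open>q = q powr p * q powr (1 - p)\<close>, where the last exponent is negative.\<close>
  have le: "q \<le> s + q powr p * s powr (1 - p)" if "0 \<le> q" "0 < s" for q s :: real
  proof (cases "q \<le> s")
    case False
    then have "q powr (1 - p) \<le> s powr (1 - p)" using that p1 by (intro powr_mono2') auto
    then have "q powr p * q powr (1 - p) \<le> q powr p * s powr (1 - p)" by (intro mult_left_mono) auto
    then show ?thesis using False that by (simp add: powr_add[symmetric])
  qed (simp add: add_increasing2)
  have intQ: "integrable M Q"
  proof (rule Bochner_Integration.integrable_bound[of M "\<lambda>\<omega>. 1 + Q \<omega> powr p"])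
    show "AE \<omega> in M. norm (Q \<omega>) \<le> norm (1 + Q \<omega> powr p)"
      using le[of _ 1] Q by (intro AE_I2) auto
  qed (use Qp in auto)
  define neg where "neg n = expectation (\<lambda>\<omega>. max (- Z n \<omega>) 0 * indicator (?E n) \<omega>)" for n
  have negQ: "AE \<omega> in M. max (- Z n \<omega>) 0 \<le> Q \<omega>" for n
    using Z_lower(1)[of n] S_nonneg_AE[OF KA, of n] AE_space
    by eventually_elim (use Q in fastforce)
  have int_neg: "integrable M (\<lambda>\<omega>. max (- Z n \<omega>) 0 * indicator (?E n) \<omega>)" for n
    by (rule Bochner_Integration.integrable_bound[OF intQ])
       (use negQ[of n] in \<open>auto elim!: eventually_mono simp: indicator_def\<close>)
  obtain C where C: "0 \<le> C" "\<And>K B Z x. K \<subseteq> A \<Longrightarrow> (AE \<omega> in M. Z \<omega> \<le> S K B \<omega>) \<Longrightarrow> potter_x \<le> x \<Longrightarrow>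
    prob {\<omega> \<in> space M. x < Z \<omega>} \<le> C * f x" using tail_bound by blast
  have neg_bound: "neg n / (x n * f (x n)) \<le> \<epsilon> * C + expectation (\<lambda>\<omega>. Q \<omega> powr p) * \<epsilon> powr (1 - p) * (x n powr - p / f (x n))"
    if xn: "potter_x \<le> x n" and e: "0 < \<epsilon>" for n \<epsilon>
  proof -
    have x0: "0 < x n" using xn potter(2) by simp
    let ?s = "\<epsilon> * x n"
    have "neg n \<le> expectation (\<lambda>\<omega>. ?s * indicator (?E n) \<omega> + Q \<omega> powr p * ?s powr (1 - p))"
      unfolding neg_def
    proof (rule integral_mono_AE[OF int_neg])
      show "AE \<omega> in M. max (- Z n \<omega>) 0 * indicator (?E n) \<omega> \<le> ?s * indicator (?E n) \<omega> + Q \<omega> powr p * ?s powr (1 - p)"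
        using negQ[of n] AE_space
      proof eventually_elim
        case (elim \<omega>)
        have "Q \<omega> \<le> ?s + Q \<omega> powr p * ?s powr (1 - p)" using le[of "Q \<omega>" ?s] Q[OF elim(2)] e x0 by simp
        then show ?case using elim by (auto simp: indicator_def)
      qed
      show "integrable M (\<lambda>\<omega>. ?s * indicator (?E n) \<omega> + Q \<omega> powr p * ?s powr (1 - p))"
        using Qp by (intro Bochner_Integration.integrable_add integrable_mult_right integrable_mult_left integrable_real_indicator)
          (auto simp: emeasure_eq_measure)
    qed
    also have "\<dots> = ?s * prob (?E n) + expectation (\<lambda>\<omega>. Q \<omega> powr p) * ?s powr (1 - p)"
      using Qp by (subst Bochner_Integration.integral_add) (auto simp: emeasure_eq_measure intro!: integrable_mult_right integrable_real_indicator)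
    also have "\<dots> \<le> ?s * (C * f (x n)) + expectation (\<lambda>\<omega>. Q \<omega> powr p) * ?s powr (1 - p)"
      using C(2)[OF K(2) Z_upper(2) xn, of n] e x0 by (intro add_right_mono mult_left_mono) auto
    finally have "neg n / (x n * f (x n)) \<le> (?s * (C * f (x n)) + expectation (\<lambda>\<omega>. Q \<omega> powr p) * ?s powr (1 - p)) / (x n * f (x n))"
      using x0 f_pos[of "x n"] by (intro divide_right_mono) auto
    also have "\<dots> = \<epsilon> * C + expectation (\<lambda>\<omega>. Q \<omega> powr p) * \<epsilon> powr (1 - p) * (x n powr (1 - p) / x n / f (x n))"
      using x0 e f_nonzero[of "x n"] by (simp add: add_divide_distrib powr_mult mult_ac)
    also have "x n powr (1 - p) / x n = x n powr - p"
      using x0 by (simp add: powr_diff powr_minus_divide)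
    finally show ?thesis .
  qed
  have "(\<lambda>n. neg n / (x n * f (x n))) \<longlonglongrightarrow> 0"
  proof (rule order_tendstoI)
    fix c :: real assume "c < 0"
    have "0 \<le> neg n" for n unfolding neg_def by (intro integral_nonneg_AE) auto
    then have "\<forall>\<^sub>F n in sequentially. 0 \<le> neg n / (x n * f (x n))"
      using x_large
      by (elim eventually_mono) (use potter(2) f_pos in \<open>auto intro!: divide_nonneg_nonneg mult_nonneg_nonneg intro: less_imp_le\<close>)
    then show "\<forall>\<^sub>F n in sequentially. c < neg n / (x n * f (x n))"
      by eventually_elim (use \<open>c < 0\<close> in linarith)
  next
    fix c :: real assume c: "0 < c"
    define \<epsilon> where "\<epsilon> = c / (2 * (C + 1))"
    have e: "0 < \<epsilon>" "\<epsilon> * C < c" using c C(1) by (auto simp: \<epsilon>_def field_simps add_strict_increasing2)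
    have "(\<lambda>n. \<epsilon> * C + expectation (\<lambda>\<omega>. Q \<omega> powr p) * \<epsilon> powr (1 - p) * (x n powr - p / f (x n)))
        \<longlonglongrightarrow> \<epsilon> * C + expectation (\<lambda>\<omega>. Q \<omega> powr p) * \<epsilon> powr (1 - p) * 0"
      by (intro tendsto_intros filterlim_compose[OF powr_negligible[OF p] x])
    then have "\<forall>\<^sub>F n in sequentially. \<epsilon> * C + expectation (\<lambda>\<omega>. Q \<omega> powr p) * \<epsilon> powr (1 - p) * (x n powr - p / f (x n)) < c"
      using e by (intro order_tendstoD(2)) auto
    then show "\<forall>\<^sub>F n in sequentially. neg n / (x n * f (x n)) < c" using x_large
      by eventually_elim (use neg_bound[OF _ e(1)] in fastforce)
  qed
  moreover have pos: "(\<lambda>n. expectation (\<lambda>\<omega>. max (Z n \<omega> - 0 * x n) 0 * indicator (?E n) \<omega>) / (x n * f (x n))) \<longlonglongrightarrow> lam * (1 - 0 + 1 / (\<alpha> - 1))"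
    by (rule excess_limit(1)) auto
  ultimately have "(\<lambda>n. expectation (\<lambda>\<omega>. max (Z n \<omega> - 0 * x n) 0 * indicator (?E n) \<omega>) / (x n * f (x n)) - neg n / (x n * f (x n)))
      \<longlonglongrightarrow> lam * (1 - 0 + 1 / (\<alpha> - 1)) - 0" by (intro tendsto_diff)
  moreover have "lam * (1 - 0 + 1 / (\<alpha> - 1)) - 0 = lam * (\<alpha> / (\<alpha> - 1))"
    using index_gt_1 by (simp add: field_simps)
  moreover have "\<forall>\<^sub>F n in sequentially.
      expectation (\<lambda>\<omega>. max (Z n \<omega> - 0 * x n) 0 * indicator (?E n) \<omega>) / (x n * f (x n)) - neg n / (x n * f (x n))
      = expectation (\<lambda>\<omega>. Z n \<omega> * indicator (?E n) \<omega>) / (x n * f (x n))"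
  proof (rule eventually_mono[OF excess_limit(2)[of "\<lambda>_. 0" 0]])
    fix n assume int: "integrable M (\<lambda>\<omega>. max (Z n \<omega> - 0 * x n) 0 * indicator (?E n) \<omega>)"
    have "expectation (\<lambda>\<omega>. Z n \<omega> * indicator (?E n) \<omega>)
      = expectation (\<lambda>\<omega>. max (Z n \<omega> - 0 * x n) 0 * indicator (?E n) \<omega> - max (- Z n \<omega>) 0 * indicator (?E n) \<omega>)"
      by (intro Bochner_Integration.integral_cong) (auto simp: indicator_def max_def)
    also have "\<dots> = expectation (\<lambda>\<omega>. max (Z n \<omega> - 0 * x n) 0 * indicator (?E n) \<omega>) - neg n"
      unfolding neg_def by (rule Bochner_Integration.integral_diff[OF int int_neg])
    finally show "expectation (\<lambda>\<omega>. max (Z n \<omega> - 0 * x n) 0 * indicator (?E n) \<omega>) / (x n * f (x n)) - neg n / (x n * f (x n))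
      = expectation (\<lambda>\<omega>. Z n \<omega> * indicator (?E n) \<omega>) / (x n * f (x n))" by (simp add: diff_divide_distrib)
  qed auto
  ultimately show ?thesis by (simp only: tendsto_cong)
qed

end

section \<open>Independence, cadlag paths and exponential moments of Levy processes\<close>

lemma (in prob_space) distr_pair_indep_set:
  assumes ind: "indep_set (sets N1) (sets N2)" and sp: "space N1 = space M" "space N2 = space M"
    and X: "X \<in> measurable N1 S" and Y: "Y \<in> measurable N2 T"
  shows "distr M (S \<Otimes>\<^sub>M T) (\<lambda>\<omega>. (X \<omega>, Y \<omega>)) = distr M S X \<Otimes>\<^sub>M distr M T Y"
proof -
  have sub: "sets N1 \<subseteq> events" "sets N2 \<subseteq> events"
    and pr: "\<And>a b. a \<in> sets N1 \<Longrightarrow> b \<in> sets N2 \<Longrightarrow> prob (a \<inter> b) = prob a * prob b"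
    using ind unfolding indep_sets2_eq by auto
  have XM[measurable]: "X \<in> measurable M S" and YM[measurable]: "Y \<in> measurable M T"
    using X Y sub sp unfolding measurable_def by auto
  interpret X: prob_space "distr M S X" by (rule prob_space_distr) measurable
  interpret Y: prob_space "distr M T Y" by (rule prob_space_distr) measurable
  show ?thesis
  proof (rule pair_measure_eqI[symmetric])
    fix A B assume A: "A \<in> sets (distr M S X)" and B: "B \<in> sets (distr M T Y)"
    have ab: "X -` A \<inter> space M \<in> sets N1" "Y -` B \<inter> space M \<in> sets N2"
      using measurable_sets[OF X, of A] measurable_sets[OF Y, of B] A B sp by auto
    have "emeasure (distr M (S \<Otimes>\<^sub>M T) (\<lambda>\<omega>. (X \<omega>, Y \<omega>))) (A \<times> B)
        = emeasure M ((X -` A \<inter> space M) \<inter> (Y -` B \<inter> space M))"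
      using A B by (subst emeasure_distr) (auto intro!: arg_cong[of _ _ "emeasure M"])
    also have "\<dots> = ennreal (prob (X -` A \<inter> space M) * prob (Y -` B \<inter> space M))"
      using pr[OF ab] by (simp add: emeasure_eq_measure)
    also have "\<dots> = emeasure (distr M S X) A * emeasure (distr M T Y) B"
      using A B by (simp add: emeasure_distr emeasure_eq_measure ennreal_mult)
    finally show "emeasure (distr M S X) A * emeasure (distr M T Y) B
        = emeasure (distr M (S \<Otimes>\<^sub>M T) (\<lambda>\<omega>. (X \<omega>, Y \<omega>))) (A \<times> B)" ..
  qed (auto intro: X.sigma_finite_measure_axioms Y.sigma_finite_measure_axioms)
qed

text \<open>The identity is viewed as a random element of the space \<open>N2\<close>, so that a
  whole path can be the second argument. Its joint law with \<open>X\<close> is a product, and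
  Tonelli integrates it with \<open>X\<close> held fixed.\<close>

lemma (in prob_space) nn_integral_freeze:
  assumes ind: "indep_set (sets N1) (sets N2)" and sp: "space N1 = space M" "space N2 = space M"
    and X: "X \<in> measurable N1 S" and g: "g \<in> borel_measurable (S \<Otimes>\<^sub>M N2)"
  shows "(\<integral>\<^sup>+\<omega>. g (X \<omega>, \<omega>) \<partial>M) = (\<integral>\<^sup>+\<omega>. \<integral>\<^sup>+\<omega>'. g (X \<omega>, \<omega>') \<partial>M \<partial>M)"
proof -
  have sub: "sets N1 \<subseteq> events" "sets N2 \<subseteq> events"
    using ind unfolding indep_sets2_eq by auto
  have XM[measurable]: "X \<in> measurable M S" and YM[measurable]: "(\<lambda>\<omega>. \<omega>) \<in> measurable M N2"
    using X sub sp unfolding measurable_def by auto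
  note g[measurable]
  interpret Y: prob_space "distr M N2 (\<lambda>\<omega>. \<omega>)" by (rule prob_space_distr) measurable
  have "(\<integral>\<^sup>+\<omega>. g (X \<omega>, \<omega>) \<partial>M) = (\<integral>\<^sup>+z. g z \<partial>distr M (S \<Otimes>\<^sub>M N2) (\<lambda>\<omega>. (X \<omega>, \<omega>)))"
    by (subst nn_integral_distr) auto
  also have "distr M (S \<Otimes>\<^sub>M N2) (\<lambda>\<omega>. (X \<omega>, \<omega>)) = distr M S X \<Otimes>\<^sub>M distr M N2 (\<lambda>\<omega>. \<omega>)"
    by (rule distr_pair_indep_set[OF ind sp X]) simp
  also have "(\<integral>\<^sup>+z. g z \<partial>\<dots>) = (\<integral>\<^sup>+x. \<integral>\<^sup>+\<omega>'. g (x, \<omega>') \<partial>distr M N2 (\<lambda>\<omega>. \<omega>) \<partial>distr M S X)"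
    by (subst Y.nn_integral_fst) auto
  also have "\<dots> = (\<integral>\<^sup>+x. \<integral>\<^sup>+\<omega>'. g (x, \<omega>') \<partial>M \<partial>distr M S X)"
    by (intro nn_integral_cong nn_integral_distr) auto
  also have "\<dots> = (\<integral>\<^sup>+\<omega>. \<integral>\<^sup>+\<omega>'. g (X \<omega>, \<omega>') \<partial>M \<partial>M)"
  proof (rule nn_integral_distr)
    have "(\<lambda>x. \<integral>\<^sup>+\<omega>'. g (x, \<omega>') \<partial>distr M N2 (\<lambda>\<omega>. \<omega>)) \<in> borel_measurable S"
      by (rule Y.borel_measurable_nn_integral_fst) auto
    moreover have "(\<lambda>x. \<integral>\<^sup>+\<omega>'. g (x, \<omega>') \<partial>distr M N2 (\<lambda>\<omega>. \<omega>)) \<in> borel_measurable S \<longleftrightarrow>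
        (\<lambda>x. \<integral>\<^sup>+\<omega>'. g (x, \<omega>') \<partial>M) \<in> borel_measurable S"
      by (intro measurable_cong nn_integral_distr) auto
    ultimately show "(\<lambda>x. \<integral>\<^sup>+\<omega>'. g (x, \<omega>') \<partial>M) \<in> borel_measurable (distr M S X)" by simp
  qed measurable
  finally show ?thesis .
qed

text \<open>A right-continuous path is the limit of its values on a grid, and each approximant
  depends on time through countably many values. Negative times are sent to 0, as nothing is assumed
  about the process there.\<close>

lemma cadlag_joint_measurable:
  assumes R: "\<And>t. 0 \<le> t \<Longrightarrow> R t \<in> borel_measurable N"
    and cad: "\<And>\<omega>. \<omega> \<in> space N \<Longrightarrow> cadlag (\<lambda>t. R t \<omega>)"
  shows "(\<lambda>(s, \<omega>). R (max 0 s) \<omega>) \<in> borel_measurable (borel \<Otimes>\<^sub>M N)"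
proof -
  \<comment> \<open>The grid point lies strictly to the right of \<open>max 0 s\<close>, because
    convergence along \<open>at_right\<close> ignores the point itself.\<close>
  define grid where "grid n s = (real_of_int \<lfloor>real (Suc n) * max 0 s\<rfloor> + 1) / real (Suc n)" for n and s :: real
  have grid: "max 0 s < grid n s" "grid n s \<le> max 0 s + 1 / real (Suc n)" for n s
  proof -
    have "real (Suc n) * max 0 s < real_of_int \<lfloor>real (Suc n) * max 0 s\<rfloor> + 1" by linarith
    then show "max 0 s < grid n s" unfolding grid_def by (subst pos_less_divide_eq) (auto simp: mult.commute)
    have "real_of_int \<lfloor>real (Suc n) * max 0 s\<rfloor> + 1 \<le> real (Suc n) * max 0 s + 1" by linarith
    then have "grid n s \<le> (real (Suc n) * max 0 s + 1) / real (Suc n)"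
      unfolding grid_def by (rule divide_right_mono) simp
    also have "\<dots> = max 0 s + 1 / real (Suc n)" by (simp add: add_divide_distrib del: of_nat_Suc)
    finally show "grid n s \<le> max 0 s + 1 / real (Suc n)" .
  qed
  show ?thesis
  proof (rule borel_measurable_LIMSEQ_real)
    fix z :: "real \<times> 'a" assume z: "z \<in> space (borel \<Otimes>\<^sub>M N)"
    obtain s \<omega> where z': "z = (s, \<omega>)" by (cases z)
    then have \<omega>: "\<omega> \<in> space N" using z by (simp add: space_pair_measure)
    have "(\<lambda>n. grid n s) \<longlonglongrightarrow> max 0 s"
    proof (rule tendsto_sandwich[OF _ _ tendsto_const])
      show "(\<lambda>n. max 0 s + 1 / real (Suc n)) \<longlonglongrightarrow> max 0 s"
        using tendsto_add[OF tendsto_const LIMSEQ_inverse_real_of_nat, of "max 0 s"] by (simp add: inverse_eq_divide)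
      show "\<forall>\<^sub>F n in sequentially. max 0 s \<le> grid n s"
        by (intro always_eventually allI less_imp_le grid(1))
      show "\<forall>\<^sub>F n in sequentially. grid n s \<le> max 0 s + 1 / real (Suc n)"
        by (intro always_eventually allI grid(2))
    qed
    then have "filterlim (\<lambda>n. grid n s) (at_right (max 0 s)) sequentially"
      unfolding filterlim_at using grid(1)[of s]
      by (intro conjI always_eventually allI) (metis greaterThan_iff less_irrefl)+
    moreover have "((\<lambda>t. R t \<omega>) \<longlongrightarrow> R (max 0 s) \<omega>) (at_right (max 0 s))"
      using cad[OF \<omega>] by (simp add: cadlag_def)
    ultimately show "(\<lambda>n. (\<lambda>(s, \<omega>). R (grid n s) \<omega>) z) \<longlonglongrightarrow> (\<lambda>(s, \<omega>). R (max 0 s) \<omega>) z"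
      unfolding z' by (auto intro: filterlim_compose)
  next
    fix n
    have "(\<lambda>z. R (max 0 ((real_of_int k + 1) / real (Suc n))) (snd z)) \<in> borel_measurable (borel \<Otimes>\<^sub>M N)" for k :: int
      by (rule measurable_compose[OF measurable_snd R]) simp
    then have "(\<lambda>z. R (max 0 ((real_of_int \<lfloor>real (Suc n) * max 0 (fst z)\<rfloor> + 1) / real (Suc n))) (snd z)) \<in> borel_measurable (borel \<Otimes>\<^sub>M N)"
      by (rule measurable_compose_countable) measurable
    moreover have "max 0 (grid n s) = grid n s" for s using grid(1)[of s n] by simp
    ultimately show "(\<lambda>(s, \<omega>). R (grid n s) \<omega>) \<in> borel_measurable (borel \<Otimes>\<^sub>M N)"
      by (simp add: case_prod_unfold grid_def[symmetric] del: of_nat_Suc)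
  qed
qed

text \<open>Cauchy's functional equation. Subtracting the linear function leaves an additive
  \<open>h\<close> that vanishes at nonnegative rationals and is bounded below. Multiples would push
  a negative value below any bound, so \<open>h\<close> is nonnegative, and
  \<open>h x + h (real n - x) = 0\<close> forces \<open>h x = 0\<close>.\<close>

lemma additive_bounded_below_linear:
  fixes g :: "real \<Rightarrow> real"
  assumes add: "\<And>s t. 0 \<le> s \<Longrightarrow> 0 \<le> t \<Longrightarrow> g (s + t) = g s + g t"
    and \<delta>: "0 < \<delta>" and lb: "\<And>s. 0 \<le> s \<Longrightarrow> s \<le> \<delta> \<Longrightarrow> b \<le> g s"
    and x: "0 \<le> x"
  shows "g x = x * g 1"
proof -
  define h where "h x = g x - x * g 1" for x
  have hadd: "h (s + t) = h s + h t" if "0 \<le> s" "0 \<le> t" for s t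
    using add[OF that] by (simp add: h_def algebra_simps)
  have h0: "h 0 = 0" using hadd[of 0 0] by simp
  have hmul: "h (real n * s) = real n * h s" if "0 \<le> s" for n s
  proof (induction n)
    case (Suc n)
    then show ?case using hadd[of "real n * s" s] that by (simp add: algebra_simps)
  qed (simp add: h0)
  have hnat: "h (real n) = 0" for n using hmul[of 1 n] by (simp add: h_def)
  have hrat: "h q = 0" if q: "q \<in> \<rat>" "0 \<le> q" for q
  proof -
    obtain m n :: nat where "n \<noteq> 0" "\<bar>q\<bar> = real m / real n" using Rats_abs_nat_div_natE[OF q(1)] by blast
    then have "real n * q = real m" using q(2) by simp
    then show ?thesis using hmul[OF q(2), of n] hnat[of m] \<open>n \<noteq> 0\<close> by simp
  qed
  define K where "K = \<bar>b\<bar> + \<bar>\<delta> * g 1\<bar>"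
  have hsmall: "- K \<le> h s" if "0 \<le> s" "s \<le> \<delta>" for s
  proof -
    have "\<bar>s * g 1\<bar> \<le> \<bar>\<delta> * g 1\<bar>" using that by (simp add: abs_mult mult_right_mono)
    then show ?thesis using lb[OF that] unfolding h_def K_def by linarith
  qed
  have hlb: "- K \<le> h s" if s: "0 \<le> s" for s
  proof (cases "s \<le> \<delta>")
    case False
    then obtain q where q: "q \<in> \<rat>" "s - \<delta> < q" "q < s" using Rats_dense_in_real[of "s - \<delta>" s] \<delta> by auto
    have "h s = h q + h (s - q)" using hadd[of q "s - q"] q False by simp
    then show ?thesis using hrat[OF q(1)] hsmall[of "s - q"] q False by simp
  qed (use hsmall s in simp)
  have hnn: "0 \<le> h s" if s: "0 \<le> s" for s
  proof (rule ccontr)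
    assume "\<not> 0 \<le> h s"
    then obtain n :: nat where "K < real n * (- h s)" using reals_Archimedean3[of "- h s"] by auto
    then show False using hlb[of "real n * s"] hmul[OF s, of n] s by simp
  qed
  obtain n :: nat where n: "x \<le> real n" using real_arch_simple by blast
  have "h x + h (real n - x) = 0" using hadd[of x "real n - x"] hnat[of n] n x by simp
  then have "h x = 0" using hnn[OF x] hnn[of "real n - x"] n by simp
  then show ?thesis by (simp add: h_def)
qed

section \<open>Exponential moments of a Levy process\<close>

context prob_space
begin

text \<open>With values in \<open>ennreal\<close> the multiplicativity in time holds before anything
  is known about finiteness.\<close>

definition levy_mgf :: "(real \<Rightarrow> 'a \<Rightarrow> real) \<Rightarrow> real \<Rightarrow> real \<Rightarrow> ennreal" where
  "levy_mgf R p s = (\<integral>\<^sup>+\<omega>. ennreal (exp (- p * R s \<omega>)) \<partial>M)"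

context
  fixes R :: "real \<Rightarrow> 'a \<Rightarrow> real"
  assumes levy: "levy_process R"
begin

lemma levy_rv: "0 \<le> t \<Longrightarrow> R t \<in> borel_measurable M"
  using levy unfolding levy_process_def by blast

lemma levy_cadlag: "\<omega> \<in> space M \<Longrightarrow> cadlag (\<lambda>t. R t \<omega>)"
  using levy unfolding levy_process_def by blast

lemma levy_0: "AE \<omega> in M. R 0 \<omega> = 0"
  using levy unfolding levy_process_def by blast

lemma levy_mgf_0: "levy_mgf R p 0 = 1"
proof -
  have "levy_mgf R p 0 = (\<integral>\<^sup>+\<omega>. 1 \<partial>M)"
    unfolding levy_mgf_def by (rule nn_integral_cong_AE) (use levy_0 in \<open>auto elim: eventually_mono\<close>)
  then show ?thesis by (simp add: emeasure_space_1)
qed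

lemma levy_mgf_increment:
  assumes "0 \<le> s" "0 \<le> h"
  shows "(\<integral>\<^sup>+\<omega>. ennreal (exp (- p * (R (s + h) \<omega> - R s \<omega>))) \<partial>M) = levy_mgf R p h"
proof -
  note [measurable] = levy_rv[OF assms(1)] levy_rv[OF assms(2)] levy_rv[of 0, simplified]
  have [measurable]: "R (s + h) \<in> borel_measurable M" using levy_rv assms by simp
  have "(\<integral>\<^sup>+\<omega>. ennreal (exp (- p * (R (s + h) \<omega> - R s \<omega>))) \<partial>M)
      = (\<integral>\<^sup>+y. ennreal (exp (- p * y)) \<partial>distr M borel (\<lambda>\<omega>. R (s + h) \<omega> - R s \<omega>))"
    by (subst nn_integral_distr) auto
  also have "distr M borel (\<lambda>\<omega>. R (s + h) \<omega> - R s \<omega>) = distr M borel (\<lambda>\<omega>. R h \<omega> - R 0 \<omega>)"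
    using levy assms unfolding levy_process_def by blast
  also have "(\<integral>\<^sup>+y. ennreal (exp (- p * y)) \<partial>\<dots>) = (\<integral>\<^sup>+\<omega>. ennreal (exp (- p * (R h \<omega> - R 0 \<omega>))) \<partial>M)"
    by (subst nn_integral_distr) auto
  also have "\<dots> = levy_mgf R p h"
    unfolding levy_mgf_def by (rule nn_integral_cong_AE) (use levy_0 in \<open>auto elim: eventually_mono\<close>)
  finally show ?thesis .
qed

lemma levy_mgf_add:
  assumes "0 \<le> s" "0 \<le> h"
  shows "levy_mgf R p (s + h) = levy_mgf R p s * levy_mgf R p h"
proof (cases "s = 0 \<or> h = 0")
  case True
  then show ?thesis using levy_mgf_0 by auto
next
  case False
  then have sh: "0 < s" "0 < h" using assms by auto
  \<comment> \<open>Independence of increments is formulated for strictly increasing sequences over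
    all naturals; the times 0, \<open>s\<close> and \<open>s + h\<close> matter here, and the later
    terms merely continue the sequence. Strictness is why \<open>s = 0\<close> and
    \<open>h = 0\<close> are treated apart.\<close>
  define t where "t n = (case n of 0 \<Rightarrow> 0 | Suc 0 \<Rightarrow> s | Suc (Suc m) \<Rightarrow> s + h + real m)" for n :: nat
  have "strict_mono t" unfolding strict_mono_Suc_iff
    using sh by (auto simp: t_def split: nat.split)
  moreover have "0 \<le> t 0" by (simp add: t_def)
  ultimately have "indep_vars (\<lambda>_. borel) (\<lambda>i \<omega>. R (t (Suc i)) \<omega> - R (t i) \<omega>) {..<2::nat}"
    using levy unfolding levy_process_def by blast
  then have ind: "indep_vars (\<lambda>_. borel) (\<lambda>i \<omega>. ennreal (exp (- p * (R (t (Suc i)) \<omega> - R (t i) \<omega>)))) {..<2::nat}"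
    by (rule indep_vars_compose2) auto
  have "levy_mgf R p (s + h) = (\<integral>\<^sup>+\<omega>. (\<Prod>i<2::nat. ennreal (exp (- p * (R (t (Suc i)) \<omega> - R (t i) \<omega>)))) \<partial>M)"
    unfolding levy_mgf_def
  proof (rule nn_integral_cong_AE)
    show "AE \<omega> in M. ennreal (exp (- p * R (s + h) \<omega>)) = (\<Prod>i<2::nat. ennreal (exp (- p * (R (t (Suc i)) \<omega> - R (t i) \<omega>))))"
      using levy_0
      by eventually_elim
        (simp add: numeral_2_eq_2 t_def ennreal_mult[symmetric] exp_add[symmetric] algebra_simps)
  qed
  also have "\<dots> = (\<Prod>i<2::nat. \<integral>\<^sup>+\<omega>. ennreal (exp (- p * (R (t (Suc i)) \<omega> - R (t i) \<omega>))) \<partial>M)"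
    by (rule indep_vars_nn_integral[OF _ ind]) auto
  also have "\<dots> = levy_mgf R p s * levy_mgf R p h"
    using levy_mgf_increment[of 0 s p] levy_mgf_increment[of s h p] assms by (simp add: numeral_2_eq_2 t_def)
  finally show ?thesis .
qed

lemma levy_mgf_pos: "0 \<le> s \<Longrightarrow> 0 < levy_mgf R p s"
proof (rule ccontr)
  assume s: "0 \<le> s" and "\<not> 0 < levy_mgf R p s"
  then have "(\<integral>\<^sup>+\<omega>. ennreal (exp (- p * R s \<omega>)) \<partial>M) = 0" by (simp add: levy_mgf_def)
  then have "AE \<omega> in M. ennreal (exp (- p * R s \<omega>)) = 0"
    using levy_rv[OF s] by (subst (asm) nn_integral_0_iff_AE) auto
  then have "AE \<omega> in M. False" by (auto elim!: eventually_mono simp: ennreal_eq_0_iff not_le)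
  then show False by simp
qed

context
  fixes p assumes fin: "integrable M (\<lambda>\<omega>. exp (- p * R 1 \<omega>))"
begin

lemma levy_mgf_1: "levy_mgf R p 1 = ennreal (exp (laplace_exponent M R p))"
proof -
  have "levy_mgf R p 1 = ennreal (expectation (\<lambda>\<omega>. exp (- p * R 1 \<omega>)))"
    unfolding levy_mgf_def using fin by (intro nn_integral_eq_integral) auto
  moreover from this have "0 < expectation (\<lambda>\<omega>. exp (- p * R 1 \<omega>))"
    using levy_mgf_pos[of 1 p] by simp
  ultimately show ?thesis by (simp add: laplace_exponent_def)
qed

text \<open>Finiteness at integers follows by multiplication. An infinite value at \<open>s\<close>,
  times the positive value at the complementary time, would make the value at an integer
  infinite.\<close>

lemma levy_mgf_finite:
  assumes "0 \<le> s"
  shows "levy_mgf R p s < \<infinity>"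
proof -
  have nat: "levy_mgf R p (real n) < \<infinity>" for n
  proof (induction n)
    case (Suc n)
    then show ?case
      using levy_mgf_add[of "real n" 1 p] levy_mgf_1 by (simp add: ennreal_mult_less_top add.commute)
  qed (simp add: levy_mgf_0)
  obtain n :: nat where n: "s \<le> real n" using real_arch_simple by blast
  have eq: "levy_mgf R p s * levy_mgf R p (real n - s) = levy_mgf R p (real n)"
    using levy_mgf_add[of s "real n - s" p] n assms by simp
  show ?thesis
  proof (rule ccontr)
    assume "\<not> levy_mgf R p s < \<infinity>"
    then have "levy_mgf R p s = top" by (simp add: less_top[symmetric])
    then have "levy_mgf R p (real n) = top"
      using eq less_imp_neq[OF levy_mgf_pos[of "real n - s" p]] n by (auto simp: ennreal_top_mult)
    then show False using nat[of n] by simp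
  qed
qed

text \<open>Fatou's lemma and right continuity of the paths at 0. The bound excludes the nonlinear solutions of
  Cauchy's functional equation for the logarithm of the moment generating function.\<close>

lemma levy_mgf_lower_bound:
  obtains \<delta> where "0 < \<delta>" "\<And>s. 0 \<le> s \<Longrightarrow> s \<le> \<delta> \<Longrightarrow> ennreal (exp (-1)) \<le> levy_mgf R p s"
proof -
  have "\<exists>\<delta>>0. \<forall>s. 0 \<le> s \<and> s \<le> \<delta> \<longrightarrow> ennreal (exp (-1)) \<le> levy_mgf R p s"
  proof (rule ccontr)
    assume neg: "\<not> ?thesis"
    have "\<exists>s. 0 \<le> s \<and> s \<le> 1 / Suc n \<and> levy_mgf R p s < ennreal (exp (-1))" for n :: nat
      using neg by (auto simp: not_le dest!: spec[of _ "1 / Suc n"])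
    then obtain s where s: "\<And>n. 0 \<le> s n" "\<And>n. s n \<le> 1 / Suc n" "\<And>n. levy_mgf R p (s n) < ennreal (exp (-1))"
      by metis
    have s_pos: "0 < s n" for n
    proof (rule ccontr)
      assume "\<not> 0 < s n"
      then have "s n = 0" using s(1)[of n] by simp
      then show False using s(3)[of n] levy_mgf_0[of p] by (simp add: ennreal_less_iff flip: ennreal_1)
    qed
    have "s \<longlonglongrightarrow> 0"
    proof (rule tendsto_sandwich[OF _ _ tendsto_const])
      show "(\<lambda>n. 1 / real (Suc n)) \<longlonglongrightarrow> 0" using LIMSEQ_inverse_real_of_nat by (simp add: inverse_eq_divide)
    qed (use s in auto)
    then have lim: "filterlim s (at_right 0) sequentially"
      unfolding filterlim_at using s_pos by (auto intro!: always_eventually simp: less_imp_neq[THEN not_sym])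
    note [measurable] = levy_rv[OF s(1)]
    have "(\<integral>\<^sup>+\<omega>. 1 \<partial>M) \<le> (\<integral>\<^sup>+\<omega>. liminf (\<lambda>n. ennreal (exp (- p * R (s n) \<omega>))) \<partial>M)"
    proof (rule nn_integral_mono_AE)
      show "AE \<omega> in M. 1 \<le> liminf (\<lambda>n. ennreal (exp (- p * R (s n) \<omega>)))"
        using levy_0 AE_space
      proof eventually_elim
        case (elim \<omega>)
        have "((\<lambda>t. R t \<omega>) \<longlongrightarrow> R 0 \<omega>) (at_right 0)" using levy_cadlag[OF elim(2)] by (simp add: cadlag_def)
        then have "(\<lambda>n. R (s n) \<omega>) \<longlonglongrightarrow> 0" using lim elim(1) by (auto intro: filterlim_compose)
        then have "(\<lambda>n. ennreal (exp (- p * R (s n) \<omega>))) \<longlonglongrightarrow> ennreal (exp (- p * 0))"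
          by (intro tendsto_intros)
        then show ?case by (simp add: lim_imp_Liminf)
      qed
    qed
    also have "\<dots> \<le> liminf (\<lambda>n. levy_mgf R p (s n))"
      unfolding levy_mgf_def by (rule nn_integral_liminf) measurable
    also have "\<dots> \<le> liminf (\<lambda>n. ennreal (exp (-1)))"
      using s(3) by (intro Liminf_mono always_eventually) (auto intro: less_imp_le)
    also have "\<dots> = ennreal (exp (-1))" by (simp add: Liminf_const)
    finally have "ennreal 1 \<le> ennreal (exp (-1))" by (simp add: emeasure_space_1)
    then show False by (subst (asm) ennreal_le_iff) auto
  qed
  then show ?thesis using that by blast
qed

text \<open>The logarithm is additive in time and bounded below near 0, hence linear; its slope is
  its value at 1.\<close>

lemma levy_mgf_exp:
  assumes s: "0 \<le> s"
  shows "levy_mgf R p s = ennreal (exp (s * laplace_exponent M R p))"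
proof -
  define g where "g t = ln (enn2real (levy_mgf R p t))" for t
  have pos: "0 < enn2real (levy_mgf R p t)" if "0 \<le> t" for t
    using levy_mgf_pos[OF that] levy_mgf_finite[OF that] by (simp add: enn2real_positive_iff)
  obtain \<delta> where \<delta>: "0 < \<delta>" "\<And>s. 0 \<le> s \<Longrightarrow> s \<le> \<delta> \<Longrightarrow> ennreal (exp (-1)) \<le> levy_mgf R p s"
    using levy_mgf_lower_bound by blast
  have "g s = s * g 1"
  proof (rule additive_bounded_below_linear[OF _ \<delta>(1) _ s])
    show "g (s + t) = g s + g t" if "0 \<le> s" "0 \<le> t" for s t
      using levy_mgf_add[OF that] pos[OF that(1)] pos[OF that(2)] by (simp add: g_def enn2real_mult ln_mult)
    show "-1 \<le> g t" if t: "0 \<le> t" "t \<le> \<delta>" for t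
    proof -
      have "exp (-1) \<le> enn2real (levy_mgf R p t)"
        using enn2real_mono[OF \<delta>(2)[OF t]] levy_mgf_finite[OF t(1)] by simp
      then have "ln (exp (-1)) \<le> g t" unfolding g_def using pos[OF t(1)] by (subst ln_le_cancel_iff) auto
      then show ?thesis by simp
    qed
  qed
  moreover have "g 1 = laplace_exponent M R p" unfolding g_def levy_mgf_1 by simp
  ultimately have "enn2real (levy_mgf R p s) = exp (s * laplace_exponent M R p)"
    using pos[OF s] unfolding g_def by (metis exp_ln)
  then show ?thesis using levy_mgf_finite[OF s] by (metis ennreal_enn2real infinity_ennreal_def)
qed

end

text \<open>Monotonicity of moment norms: the moment of order \<open>p\<close> is at most
  \<open>m powr (p / q)\<close>, where \<open>m < 1\<close> is the moment of order \<open>q\<close>.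
  This supplies the moments at \<gamma>, \<alpha> and \<beta> from the single assumption at
  \<open>\<alpha>'\<close>.\<close>

lemma laplace_exponent_smaller:
  assumes fin: "integrable M (\<lambda>\<omega>. exp (- q * R 1 \<omega>))" and neg: "laplace_exponent M R q < 0"
    and p: "0 < p" "p \<le> q"
  shows "integrable M (\<lambda>\<omega>. exp (- p * R 1 \<omega>))" "laplace_exponent M R p < 0"
proof -
  note [measurable] = levy_rv[of 1, simplified]
  show int: "integrable M (\<lambda>\<omega>. exp (- p * R 1 \<omega>))"
  proof (rule Bochner_Integration.integrable_bound[of M "\<lambda>\<omega>. 1 + exp (- q * R 1 \<omega>)"])
    have "exp (- p * y) \<le> 1 + exp (- q * y)" for y
    proof (cases "0 \<le> y")
      case True
      then have "exp (- p * y) \<le> 1" using p by simp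
      then show ?thesis by (simp add: add_increasing2)
    next
      case False
      then have "exp (- p * y) \<le> exp (- q * y)" using p by (simp add: mult_right_mono_neg)
      then show ?thesis by (simp add: add_increasing)
    qed
    then show "AE \<omega> in M. norm (exp (- p * R 1 \<omega>)) \<le> norm (1 + exp (- q * R 1 \<omega>))" by simp
  qed (use fin in auto)
  define m where "m = expectation (\<lambda>\<omega>. exp (- q * R 1 \<omega>))"
  have pos: "0 < expectation (\<lambda>\<omega>. exp (- p * R 1 \<omega>))" if "integrable M (\<lambda>\<omega>. exp (- p * R 1 \<omega>))" for p
  proof -
    have "levy_mgf R p 1 = ennreal (expectation (\<lambda>\<omega>. exp (- p * R 1 \<omega>)))"
      unfolding levy_mgf_def using that by (intro nn_integral_eq_integral) auto
    then show ?thesis using levy_mgf_pos[of 1 p] by simp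
  qed
  have m: "0 < m" "m < 1" using neg pos[OF fin] by (simp_all add: m_def laplace_exponent_def)
  define t where "t = p / q"
  have t: "0 < t" "t \<le> 1" using p by (auto simp: t_def)
  \<comment> \<open>The weighted inequality of arithmetic and geometric means for
    \<open>exp (- q * y) / m\<close> and 1. Division by \<open>m\<close> normalises the mean to 1,
    so that the right-hand side integrates to \<open>m powr t\<close>.\<close>
  have young: "exp (- p * y) \<le> m powr t * (t * (exp (- q * y) / m) + (1 - t))" for y
  proof -
    have "(exp (- q * y) / m) powr t * 1 powr (1 - t) \<le> t * (exp (- q * y) / m) + (1 - t) * 1"
      using t m by (intro Youngs_inequality_0) auto
    moreover have "(exp (- q * y) / m) powr t = exp (- p * y) / m powr t"
      using m p by (simp add: powr_divide exp_powr_real t_def)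
    ultimately have "m powr t * (exp (- p * y) / m powr t) \<le> m powr t * (t * (exp (- q * y) / m) + (1 - t))"
      by (intro mult_left_mono) auto
    then show ?thesis using m by simp
  qed
  have "expectation (\<lambda>\<omega>. exp (- p * R 1 \<omega>)) \<le> expectation (\<lambda>\<omega>. m powr t * (t * (exp (- q * R 1 \<omega>) / m) + (1 - t)))"
    using int fin young by (intro integral_mono) auto
  also have "\<dots> = m powr t * (t * (m / m) + (1 - t))" using fin by (simp add: m_def prob_space)
  also have "\<dots> = m powr t" using m by simp
  also have "\<dots> < 1" using m t powr_less_mono2[of t m 1] by simp
  finally show "laplace_exponent M R p < 0" using pos[OF int] by (simp add: laplace_exponent_def)
qed

end

text \<open>Integrability comes out of the finite power moment through
  \<open>x \<le> 1 + x powr p\<close>. The application is path by path, with an exponential law on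
  the time axis.\<close>

lemma nn_jensen_powr:
  fixes g :: "'a \<Rightarrow> real"
  assumes [measurable]: "g \<in> borel_measurable M" and g: "\<And>\<omega>. \<omega> \<in> space M \<Longrightarrow> 0 < g \<omega>" and p: "1 \<le> p"
    and fin: "(\<integral>\<^sup>+\<omega>. ennreal (g \<omega> powr p) \<partial>M) < \<infinity>"
  shows "integrable M g" "ennreal (expectation g powr p) \<le> (\<integral>\<^sup>+\<omega>. ennreal (g \<omega> powr p) \<partial>M)"
proof -
  have gp: "integrable M (\<lambda>\<omega>. g \<omega> powr p)"
    using fin by (intro integrableI_nonneg) auto
  show ig: "integrable M g"
  proof (rule Bochner_Integration.integrable_bound[of M "\<lambda>\<omega>. 1 + g \<omega> powr p"])
    have "x \<le> 1 + x powr p" if "0 < x" for x :: real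
    proof (cases "x \<le> 1")
      case False
      then have "x powr 1 \<le> x powr p" using p by (intro powr_mono) auto
      then show ?thesis using that by simp
    qed (simp add: add_increasing2)
    then show "AE \<omega> in M. norm (g \<omega>) \<le> norm (1 + g \<omega> powr p)" using g by (intro AE_I2) (simp add: less_imp_le)
  qed (use gp in auto)
  have "expectation g powr p \<le> expectation (\<lambda>\<omega>. g \<omega> powr p)"
    using ig gp g powr_convex[OF p]
    by (intro jensens_inequality[of g "{0<..}" 0 _ "\<lambda>x. x powr p"]) auto
  then show "ennreal (expectation g powr p) \<le> (\<integral>\<^sup>+\<omega>. ennreal (g \<omega> powr p) \<partial>M)"
    using gp by (subst nn_integral_eq_integral) (auto intro: ennreal_leI)
qed

end

section \<open>Discount factors and arrival times\<close>

text \<open>Packaged as a measure so that measurability with respect to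
  \<open>generated_events\<close> can be expressed; only its space and sets matter.\<close>

definition generated_algebra :: "'a measure \<Rightarrow> ('a \<Rightarrow> real) set \<Rightarrow> 'a measure" where
  "generated_algebra M \<Y> = sigma (space M) {Y -` B \<inter> space M | Y B. Y \<in> \<Y> \<and> B \<in> sets borel}"

lemma space_generated_algebra [simp]: "space (generated_algebra M \<Y>) = space M"
  unfolding generated_algebra_def by (rule space_measure_of) auto

lemma sets_generated_algebra: "sets (generated_algebra M \<Y>) = generated_events M \<Y>"
  unfolding generated_algebra_def generated_events_def by (rule sets_measure_of) auto

lemma generated_algebra_measurable:
  assumes "Y \<in> \<Y>"
  shows "Y \<in> borel_measurable (generated_algebra M \<Y>)"
  by (rule measurableI)
     (use assms in \<open>auto simp: sets_generated_algebra generated_events_def intro!: sigma_sets.Basic\<close>)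

lemma generated_events_Un:
  "generated_events M (\<Y> \<union> \<Z>) \<subseteq> sigma_sets (space M) (generated_events M \<Y> \<union> generated_events M \<Z>)"
  unfolding generated_events_def
  by (rule sigma_sets_mono) (auto intro!: sigma_sets.Basic)

lemma upto_time_borel [measurable]: "upto_time t \<in> sets borel"
proof -
  have "upto_time t = {s \<in> space borel. 0 \<le> s \<and> ennreal s \<le> t}" by (auto simp: upto_time_def)
  also have "\<dots> \<in> sets borel" by measurable
  finally show ?thesis .
qed

context renewal_risk_model
begin

abbreviation arrivals_of where "arrivals_of k \<equiv> {\<theta> k j i | j i. j \<in> {1..r} \<and> i \<ge> 1}"
abbreviation returns where "returns \<equiv> {R t | t. t \<ge> 0}"
abbreviation claims where "claims \<equiv> {X k j i | k j i. k \<in> {1..d} \<and> j \<in> {1..r} \<and> i \<ge> 1}"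

lemma source_events_Int_stable: "Int_stable (source_events M d r X \<theta> R s)"
  by (cases s) (auto simp: sets_generated_algebra[symmetric] intro!: Int_stableI)

lemma indep_arrivals_returns:
  assumes "k \<in> {1..d}"
  shows "indep_set (sets (generated_algebra M (arrivals_of k))) (sets (generated_algebra M returns))"
  unfolding indep_sets2_eq
proof (intro conjI ballI)
  have sub: "source_events M d r X \<theta> R s \<subseteq> events" if "s \<in> {Claims, Returns} \<union> Arrivals ` {1..d}" for s
    using sources_indep that unfolding indep_sets_def by blast
  show "sets (generated_algebra M (arrivals_of k)) \<subseteq> events" "sets (generated_algebra M returns) \<subseteq> events"
    using sub[of "Arrivals k"] sub[of Returns] assms by (auto simp: sets_generated_algebra)
  fix a b assume ab: "a \<in> sets (generated_algebra M (arrivals_of k))" "b \<in> sets (generated_algebra M returns)"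
  define c where "c s = (case s of Arrivals _ \<Rightarrow> a | _ \<Rightarrow> b)" for s
  have "prob (\<Inter>s\<in>{Arrivals k, Returns}. c s) = (\<Prod>s\<in>{Arrivals k, Returns}. prob (c s))"
    using ab assms by (intro indep_setsD[OF sources_indep]) (auto simp: c_def sets_generated_algebra)
  then show "prob (a \<inter> b) = prob a * prob b" by (simp add: c_def)
qed

text \<open>A discount factor depends on arrivals and returns together, so the claims must be
  independent of both jointly. Grouping independent families preserves independence because they are
  closed under intersection.\<close>

lemma indep_claims_rest:
  assumes "k \<in> {1..d}"
  shows "indep_set (sets (generated_algebra M claims)) (sets (generated_algebra M (arrivals_of k \<union> returns)))"
proof -
  let ?E = "source_events M d r X \<theta> R"
  let ?I = "\<lambda>b. if b then {Claims} else {Arrivals k, Returns}"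
  have "indep_sets (\<lambda>b. sigma_sets (space M) (\<Union>s\<in>?I b. ?E s)) (UNIV :: bool set)"
  proof (rule indep_sets_collect_sigma[OF indep_sets_mono_index[OF _ sources_indep]])
    show "(\<Union>b\<in>UNIV. ?I b) \<subseteq> {Claims, Returns} \<union> Arrivals ` {1..d}" using assms by auto
    show "disjoint_family_on ?I UNIV" by (auto simp: disjoint_family_on_def)
  qed (rule source_events_Int_stable)
  moreover have "(\<lambda>b. sigma_sets (space M) (\<Union>s\<in>?I b. ?E s)) =
      case_bool (sigma_sets (space M) (?E Claims)) (sigma_sets (space M) (?E (Arrivals k) \<union> ?E Returns))"
    by (auto simp: fun_eq_iff split: bool.split)
  ultimately have "indep_set (sigma_sets (space M) (?E Claims)) (sigma_sets (space M) (?E (Arrivals k) \<union> ?E Returns))"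
    unfolding indep_set_def by simp
  moreover have "sets (generated_algebra M claims) \<subseteq> sigma_sets (space M) (?E Claims)"
    by (auto simp: sets_generated_algebra intro: sigma_sets.Basic)
  moreover have "sets (generated_algebra M (arrivals_of k \<union> returns)) \<subseteq> sigma_sets (space M) (?E (Arrivals k) \<union> ?E Returns)"
    using generated_events_Un[of M "arrivals_of k" returns] by (simp add: sets_generated_algebra)
  ultimately show ?thesis unfolding indep_sets2_eq by blast
qed

lemma subalgebra_measurable:
  assumes "Y \<in> measurable (generated_algebra M \<Y>) S" "generated_events M \<Y> \<subseteq> events"
  shows "Y \<in> measurable M S"
  using assms unfolding measurable_def by (auto simp: sets_generated_algebra)

lemma events_rest: "k \<in> {1..d} \<Longrightarrow> generated_events M (arrivals_of k \<union> returns) \<subseteq> events"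
  using indep_claims_rest unfolding indep_sets2_eq by (auto simp: sets_generated_algebra)

lemma arrival_nonneg:
  "k \<in> {1..d} \<Longrightarrow> j \<in> {1..r} \<Longrightarrow> \<omega> \<in> space M \<Longrightarrow> 0 \<le> arrival \<theta> k j i \<omega>"
  unfolding arrival_def by (intro sum_nonneg interarrival_nonneg) auto

lemma arrival_mono:
  "k \<in> {1..d} \<Longrightarrow> j \<in> {1..r} \<Longrightarrow> \<omega> \<in> space M \<Longrightarrow> m \<le> n \<Longrightarrow> arrival \<theta> k j m \<omega> \<le> arrival \<theta> k j n \<omega>"
  unfolding arrival_def by (intro sum_mono2 interarrival_nonneg) auto

lemma arrival_subalgebra_measurable:
  assumes "j \<in> {1..r}" "arrivals_of k \<subseteq> \<Y>"
  shows "arrival \<theta> k j i \<in> borel_measurable (generated_algebra M \<Y>)"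
  unfolding arrival_def
  using assms by (intro borel_measurable_sum generated_algebra_measurable) auto

lemma arrival_rv:
  assumes "k \<in> {1..d}" "j \<in> {1..r}"
  shows "arrival \<theta> k j i \<in> borel_measurable M"
  by (rule subalgebra_measurable[OF arrival_subalgebra_measurable[OF assms(2), of k "arrivals_of k \<union> returns"] events_rest[OF assms(1)]]) auto

lemma returns_joint_measurable:
  assumes "returns \<subseteq> \<Y>"
  shows "(\<lambda>(s, \<omega>). R (max 0 s) \<omega>) \<in> borel_measurable (borel \<Otimes>\<^sub>M generated_algebra M \<Y>)"
proof (rule cadlag_joint_measurable)
  show "R t \<in> borel_measurable (generated_algebra M \<Y>)" if "0 \<le> t" for t
    using assms that by (intro generated_algebra_measurable) auto
  show "cadlag (\<lambda>t. R t \<omega>)" if "\<omega> \<in> space (generated_algebra M \<Y>)" for \<omega>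
    using levy_cadlag[OF levy] that by simp
qed

lemma returns_joint_rv: "(\<lambda>(s, \<omega>). R (max 0 s) \<omega>) \<in> borel_measurable (borel \<Otimes>\<^sub>M M)"
  by (rule cadlag_joint_measurable) (use levy_rv[OF levy] levy_cadlag[OF levy] in auto)

definition discount :: "nat \<Rightarrow> nat \<Rightarrow> nat \<Rightarrow> 'a \<Rightarrow> real" where
  "discount k j i \<omega> = exp (- R (arrival \<theta> k j i \<omega>) \<omega>)"

text \<open>A path read at a random time is the jointly measurable process composed with the pair of
  time and outcome. Measurability in the small algebra is what brings in the independence of the
  claims.\<close>

lemma discount_subalgebra_measurable:
  assumes "k \<in> {1..d}" "j \<in> {1..r}"
  shows "discount k j i \<in> borel_measurable (generated_algebra M (arrivals_of k \<union> returns))"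
proof -
  let ?N = "generated_algebra M (arrivals_of k \<union> returns)"
  have 1: "(\<lambda>\<omega>. (arrival \<theta> k j i \<omega>, \<omega>)) \<in> measurable ?N (borel \<Otimes>\<^sub>M ?N)"
    using arrival_subalgebra_measurable[OF assms(2), of k "arrivals_of k \<union> returns"]
    by (intro measurable_Pair) auto
  have "(\<lambda>\<omega>. exp (- (\<lambda>(s, \<omega>). R (max 0 s) \<omega>) (arrival \<theta> k j i \<omega>, \<omega>))) \<in> borel_measurable ?N"
    using measurable_compose[OF 1 returns_joint_measurable] by auto
  moreover have "discount k j i \<omega> = exp (- (\<lambda>(s, \<omega>). R (max 0 s) \<omega>) (arrival \<theta> k j i \<omega>, \<omega>))" if "\<omega> \<in> space ?N" for \<omega>
    using arrival_nonneg[OF assms] that by (simp add: discount_def)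
  ultimately show ?thesis by (subst measurable_cong) auto
qed

lemma discount_rv:
  assumes "k \<in> {1..d}" "j \<in> {1..r}"
  shows "discount k j i \<in> borel_measurable M"
  by (rule subalgebra_measurable[OF discount_subalgebra_measurable[OF assms] events_rest[OF assms(1)]])

lemma claim_indep_discount:
  assumes "k \<in> {1..d}" "j \<in> {1..r}" "1 \<le> i"
  shows "distr M (borel \<Otimes>\<^sub>M (borel \<Otimes>\<^sub>M borel)) (\<lambda>\<omega>. (X k j i \<omega>, discount k j n \<omega>, arrival \<theta> k j n \<omega>))
      = distr M borel (X k j i) \<Otimes>\<^sub>M distr M (borel \<Otimes>\<^sub>M borel) (\<lambda>\<omega>. (discount k j n \<omega>, arrival \<theta> k j n \<omega>))"
proof (rule distr_pair_indep_set[OF indep_claims_rest[OF assms(1)]])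
  show "X k j i \<in> borel_measurable (generated_algebra M claims)"
    using assms by (intro generated_algebra_measurable) blast
  show "(\<lambda>\<omega>. (discount k j n \<omega>, arrival \<theta> k j n \<omega>)) \<in> measurable (generated_algebra M (arrivals_of k \<union> returns)) (borel \<Otimes>\<^sub>M borel)"
    using assms by (intro measurable_Pair discount_subalgebra_measurable arrival_subalgebra_measurable) auto
qed simp_all

text \<open>The arrival time is independent of the returns, so it can be frozen; the discount is
  then replaced by the moment generating function at that time. The window involves the arrival time
  alone and is carried along.\<close>

lemma discount_moment:
  assumes kj: "k \<in> {1..d}" "j \<in> {1..r}" and fin: "integrable M (\<lambda>\<omega>. exp (- p * R 1 \<omega>))"
    and B: "B \<in> sets borel"
  shows "(\<integral>\<^sup>+\<omega>. ennreal (discount k j i \<omega> powr p) * indicator B (arrival \<theta> k j i \<omega>) \<partial>M)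
    = (\<integral>\<^sup>+\<omega>. ennreal (exp (arrival \<theta> k j i \<omega> * laplace_exponent M R p)) * indicator B (arrival \<theta> k j i \<omega>) \<partial>M)"
proof -
  let ?N = "generated_algebra M returns"
  define g where "g = (\<lambda>z. ennreal (exp (- p * (\<lambda>(s, \<omega>). R (max 0 s) \<omega>) z)) * indicator B (fst z))"
  note [measurable] = returns_joint_measurable[OF order_refl] B
  have g: "g \<in> borel_measurable (borel \<Otimes>\<^sub>M ?N)" unfolding g_def by measurable
  have "(\<integral>\<^sup>+\<omega>. ennreal (discount k j i \<omega> powr p) * indicator B (arrival \<theta> k j i \<omega>) \<partial>M)
      = (\<integral>\<^sup>+\<omega>. g (arrival \<theta> k j i \<omega>, \<omega>) \<partial>M)"
    using arrival_nonneg[OF kj]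
    by (intro nn_integral_cong) (simp add: g_def discount_def exp_powr_real mult.commute)
  also have "\<dots> = (\<integral>\<^sup>+\<omega>. \<integral>\<^sup>+\<omega>'. g (arrival \<theta> k j i \<omega>, \<omega>') \<partial>M \<partial>M)"
    by (rule nn_integral_freeze[OF indep_arrivals_returns[OF kj(1)] _ _ arrival_subalgebra_measurable[OF kj(2)] g]) auto
  also have "\<dots> = (\<integral>\<^sup>+\<omega>. ennreal (exp (arrival \<theta> k j i \<omega> * laplace_exponent M R p)) * indicator B (arrival \<theta> k j i \<omega>) \<partial>M)"
  proof (rule nn_integral_cong)
    fix \<omega> assume "\<omega> \<in> space M"
    then have nn: "0 \<le> arrival \<theta> k j i \<omega>" by (rule arrival_nonneg[OF kj])
    note [measurable] = levy_rv[OF levy nn]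
    have "(\<integral>\<^sup>+\<omega>'. g (arrival \<theta> k j i \<omega>, \<omega>') \<partial>M) = levy_mgf R p (arrival \<theta> k j i \<omega>) * indicator B (arrival \<theta> k j i \<omega>)"
      using nn unfolding g_def levy_mgf_def by (simp add: nn_integral_multc)
    then show "(\<integral>\<^sup>+\<omega>'. g (arrival \<theta> k j i \<omega>, \<omega>') \<partial>M) = ennreal (exp (arrival \<theta> k j i \<omega> * laplace_exponent M R p)) * indicator B (arrival \<theta> k j i \<omega>)"
      using levy_mgf_exp[OF levy fin nn] by simp
  qed
  finally show ?thesis .
qed

lemma interarrival_rv:
  assumes "k \<in> {1..d}" "j \<in> {1..r}" "1 \<le> i"
  shows "\<theta> k j i \<in> borel_measurable M"
  by (rule subalgebra_measurable[OF generated_algebra_measurable events_rest[OF assms(1)]]) (use assms in blast)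

definition interarrival_laplace :: "nat \<Rightarrow> nat \<Rightarrow> real \<Rightarrow> real" where
  "interarrival_laplace k j b = expectation (\<lambda>\<omega>. exp (- b * \<theta> k j 1 \<omega>))"

text \<open>Strictness: a zero mean of the nonnegative
  \<open>1 - exp (- b * \<theta> k j 1 \<omega>)\<close> would make the interarrival time vanish
  almost surely.\<close>

lemma interarrival_laplace_bounds:
  assumes kj: "k \<in> {1..d}" "j \<in> {1..r}" and b: "0 < b"
  shows "0 \<le> interarrival_laplace k j b" "interarrival_laplace k j b < 1"
    "(\<integral>\<^sup>+\<omega>. ennreal (exp (- b * \<theta> k j 1 \<omega>)) \<partial>M) = ennreal (interarrival_laplace k j b)"
proof -
  note [measurable] = interarrival_rv[OF kj order_refl] interarrival_rv[OF kj order_refl, simplified]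
  have int: "integrable M (\<lambda>\<omega>. exp (- b * \<theta> k j 1 \<omega>))"
    by (rule integrable_const_bound[of _ 1]) (use interarrival_nonneg[OF kj order_refl] b in auto)
  show "0 \<le> interarrival_laplace k j b" unfolding interarrival_laplace_def by (intro integral_nonneg_AE) auto
  show "(\<integral>\<^sup>+\<omega>. ennreal (exp (- b * \<theta> k j 1 \<omega>)) \<partial>M) = ennreal (interarrival_laplace k j b)"
    unfolding interarrival_laplace_def using int by (intro nn_integral_eq_integral) auto
  have nn: "AE \<omega> in M. 0 \<le> 1 - exp (- b * \<theta> k j 1 \<omega>)"
    using interarrival_nonneg[OF kj order_refl] b by (intro AE_I2) simp
  have eq: "expectation (\<lambda>\<omega>. 1 - exp (- b * \<theta> k j 1 \<omega>)) = 1 - interarrival_laplace k j b"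
    unfolding interarrival_laplace_def using int by (simp add: prob_space)
  have "expectation (\<lambda>\<omega>. 1 - exp (- b * \<theta> k j 1 \<omega>)) \<noteq> 0"
  proof
    assume "expectation (\<lambda>\<omega>. 1 - exp (- b * \<theta> k j 1 \<omega>)) = 0"
    then have "AE \<omega> in M. 1 - exp (- b * \<theta> k j 1 \<omega>) = 0"
      using int nn by (subst (asm) integral_nonneg_eq_0_iff_AE) auto
    then have "AE \<omega> in M. \<theta> k j 1 \<omega> = 0" by eventually_elim (use b in simp)
    then show False using interarrival_nondegenerate[OF kj order_refl] by simp
  qed
  moreover have "0 \<le> expectation (\<lambda>\<omega>. 1 - exp (- b * \<theta> k j 1 \<omega>))" using nn by (rule integral_nonneg_AE)
  ultimately show "interarrival_laplace k j b < 1" using eq by linarith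
qed

text \<open>Independence and equality of laws are given for the interarrival vectors; both are
  transferred to the component \<open>j\<close> by projection.\<close>

lemma arrival_laplace:
  assumes kj: "k \<in> {1..d}" "j \<in> {1..r}" and b: "0 < b"
  shows "(\<integral>\<^sup>+\<omega>. ennreal (exp (- b * arrival \<theta> k j n \<omega>)) \<partial>M) = ennreal (interarrival_laplace k j b ^ n)"
proof -
  let ?P = "\<Pi>\<^sub>M j\<in>{1..r}. (borel :: real measure)"
  have "indep_vars (\<lambda>_. borel) (\<lambda>i \<omega>. (\<lambda>v. ennreal (exp (- b * v j))) (\<lambda>j\<in>{1..r}. \<theta> k j i \<omega>)) {1..}"
    by (rule indep_vars_compose2[OF interarrival_indep[OF kj(1)]]) (use kj(2) in measurable)
  then have ind: "indep_vars (\<lambda>_. borel) (\<lambda>i \<omega>. ennreal (exp (- b * \<theta> k j i \<omega>))) {1..n}"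
    using kj(2) by (auto intro: indep_vars_subset)
  have same: "(\<integral>\<^sup>+\<omega>. ennreal (exp (- b * \<theta> k j i \<omega>)) \<partial>M) = ennreal (interarrival_laplace k j b)" if i: "1 \<le> i" for i
  proof -
    have rv: "(\<lambda>\<omega>. \<lambda>j\<in>{1..r}. \<theta> k j i \<omega>) \<in> measurable M ?P" if "1 \<le> i" for i
      using interarrival_indep[OF kj(1)] that unfolding indep_vars_def by auto
    have *: "(\<integral>\<^sup>+\<omega>. ennreal (exp (- b * \<theta> k j i \<omega>)) \<partial>M) = (\<integral>\<^sup>+v. ennreal (exp (- b * v j)) \<partial>distr M ?P (\<lambda>\<omega>. \<lambda>j\<in>{1..r}. \<theta> k j i \<omega>))"
      if "1 \<le> i" for i
      using kj(2) by (subst nn_integral_distr[OF rv[OF that]]) auto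
    show ?thesis
      using *[OF i] *[OF order_refl] interarrival_ident[OF kj(1) i] interarrival_laplace_bounds(3)[OF kj b] by simp
  qed
  have "(\<integral>\<^sup>+\<omega>. ennreal (exp (- b * arrival \<theta> k j n \<omega>)) \<partial>M) = (\<integral>\<^sup>+\<omega>. (\<Prod>i\<in>{1..n}. ennreal (exp (- b * \<theta> k j i \<omega>))) \<partial>M)"
    unfolding arrival_def
    by (intro nn_integral_cong) (simp add: prod_ennreal exp_sum[symmetric] sum_distrib_left)
  also have "\<dots> = (\<Prod>i\<in>{1..n}. \<integral>\<^sup>+\<omega>. ennreal (exp (- b * \<theta> k j i \<omega>)) \<partial>M)"
    by (rule indep_vars_nn_integral[OF _ ind]) auto
  also have "\<dots> = ennreal (interarrival_laplace k j b ^ n)"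
    using same interarrival_laplace_bounds(1)[OF kj b] by (simp add: ennreal_power)
  finally show ?thesis .
qed

text \<open>The source of the geometric decay in the index: the negated Laplace exponent acts as the
  Laplace variable of the arrival times.\<close>

lemma discount_moment_geometric:
  assumes kj: "k \<in> {1..d}" "j \<in> {1..r}" and fin: "integrable M (\<lambda>\<omega>. exp (- p * R 1 \<omega>))"
    and neg: "laplace_exponent M R p < 0"
  shows "integrable M (\<lambda>\<omega>. discount k j n \<omega> powr p)"
    "expectation (\<lambda>\<omega>. discount k j n \<omega> powr p) = interarrival_laplace k j (- laplace_exponent M R p) ^ n"
proof -
  note [measurable] = discount_rv[OF kj]
  have b: "0 < - laplace_exponent M R p" using neg by simp
  have eq: "(\<integral>\<^sup>+\<omega>. ennreal (discount k j n \<omega> powr p) \<partial>M) = ennreal (interarrival_laplace k j (- laplace_exponent M R p) ^ n)"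
    using discount_moment[OF kj fin, of UNIV n] arrival_laplace[OF kj b, of n] by (simp add: mult.commute)
  show "integrable M (\<lambda>\<omega>. discount k j n \<omega> powr p)"
    by (rule integrableI_nonneg) (use eq in auto)
  show "expectation (\<lambda>\<omega>. discount k j n \<omega> powr p) = interarrival_laplace k j (- laplace_exponent M R p) ^ n"
    using eq interarrival_laplace_bounds(1)[OF kj b] by (subst integral_eq_nn_integral) auto
qed

end

section \<open>The renewal measure and joint claim tails\<close>

context renewal_risk_model
begin

text \<open>Arrival times are nondecreasing, so the admissible \<open>m\<close> form an initial
  segment of the naturals, possibly all of them. It always contains 0, whereas the series counts its
  positive members \<open>Suc i\<close>.\<close>

lemma claim_count_eq_suminf:
  assumes kj: "k \<in> {1..d}" "j \<in> {1..r}" and \<omega>: "\<omega> \<in> space M"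
  shows "claim_count \<theta> k j t \<omega> = (\<Sum>i. indicator (upto_time t) (arrival \<theta> k j (Suc i) \<omega>))"
proof -
  let ?a = "\<lambda>m. arrival \<theta> k j m \<omega>"
  define D where "D = {m. ennreal (?a m) \<le> t}"
  have down: "m \<in> D" if "n \<in> D" "m \<le> n" for m n
    using that arrival_mono[OF kj \<omega> that(2)] unfolding D_def by (auto intro: order_trans ennreal_leI)
  have 0: "0 \<in> D" by (simp add: D_def arrival_def)
  have ind: "(indicator (upto_time t) (?a (Suc i)) :: ennreal) = (if Suc i \<in> D then 1 else 0)" for i
    using arrival_nonneg[OF kj \<omega>] by (auto simp: indicator_def upto_time_def D_def)
  have full: "(\<Sum>i<m. if Suc i \<in> D then 1 else 0 :: ennreal) = of_nat m" if "m \<in> D" for m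
  proof -
    have "(\<Sum>i<m. if Suc i \<in> D then 1 else 0 :: ennreal) = (\<Sum>i<m. 1)"
      using down[OF that] by (intro sum.cong) auto
    then show ?thesis by simp
  qed
  have part: "\<exists>m\<in>D. (\<Sum>i<n. if Suc i \<in> D then 1 else 0 :: ennreal) = of_nat m" for n
  proof (induction n)
    case 0
    then show ?case using \<open>0 \<in> D\<close> by (intro bexI[of _ 0]) auto
  next
    case (Suc n)
    show ?case
    proof (cases "Suc n \<in> D")
      case True
      then show ?thesis using full[OF True] by blast
    qed (use Suc in auto)
  qed
  have "claim_count \<theta> k j t \<omega> = (SUP m\<in>D. of_nat m)" by (simp add: claim_count_def D_def)
  also have "\<dots> = (SUP n. \<Sum>i<n. if Suc i \<in> D then 1 else 0)"
  proof (rule antisym)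
    show "(SUP m\<in>D. of_nat m) \<le> (SUP n. \<Sum>i<n. if Suc i \<in> D then 1 else 0 :: ennreal)"
    proof (rule SUP_mono)
      fix m assume "m \<in> D"
      then show "\<exists>n\<in>UNIV. of_nat m \<le> (\<Sum>i<n. if Suc i \<in> D then 1 else 0 :: ennreal)"
        by (intro bexI[of _ m]) (simp_all add: full)
    qed
    show "(SUP n. \<Sum>i<n. if Suc i \<in> D then 1 else 0 :: ennreal) \<le> (SUP m\<in>D. of_nat m)"
    proof (rule SUP_mono)
      fix n
      from part[of n] show "\<exists>m\<in>D. (\<Sum>i<n. if Suc i \<in> D then 1 else 0 :: ennreal) \<le> of_nat m"
        by (metis order_refl)
    qed
  qed
  also have "\<dots> = (\<Sum>i. indicator (upto_time t) (?a (Suc i)))"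
    by (simp add: suminf_eq_SUP ind)
  finally show ?thesis .
qed

text \<open>The intensity measure of the arrivals, that is, the sum of the laws of all arrival times
  with index at least 1. As an image of one product measure it is open to Tonelli.\<close>

definition arrival_measure :: "nat \<Rightarrow> nat \<Rightarrow> real measure" where
  "arrival_measure k j = distr (count_space (UNIV :: nat set) \<Otimes>\<^sub>M M) borel (\<lambda>(i, \<omega>). arrival \<theta> k j (Suc i) \<omega>)"

lemma sets_arrival_measure [simp, measurable_cong]: "sets (arrival_measure k j) = sets borel"
  by (simp add: arrival_measure_def)

lemma space_arrival_measure [simp]: "space (arrival_measure k j) = UNIV"
  by (simp add: arrival_measure_def)

lemma nn_integral_arrival_measure:
  assumes kj: "k \<in> {1..d}" "j \<in> {1..r}" and [measurable]: "h \<in> borel_measurable borel"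
  shows "(\<integral>\<^sup>+s. h s \<partial>arrival_measure k j) = (\<Sum>i. \<integral>\<^sup>+\<omega>. h (arrival \<theta> k j (Suc i) \<omega>) \<partial>M)"
proof -
  note [measurable] = arrival_rv[OF kj]
  have m[measurable]: "(\<lambda>(i, \<omega>). arrival \<theta> k j (Suc i) \<omega>) \<in> borel_measurable (count_space (UNIV :: nat set) \<Otimes>\<^sub>M M)"
    by (rule measurable_pair_measure_countable1) auto
  have "(\<integral>\<^sup>+s. h s \<partial>arrival_measure k j) = (\<integral>\<^sup>+z. h (case z of (i, \<omega>) \<Rightarrow> arrival \<theta> k j (Suc i) \<omega>) \<partial>(count_space UNIV \<Otimes>\<^sub>M M))"
    unfolding arrival_measure_def by (rule nn_integral_distr) auto
  also have "\<dots> = (\<integral>\<^sup>+i. \<integral>\<^sup>+\<omega>. h (arrival \<theta> k j (Suc i) \<omega>) \<partial>M \<partial>count_space UNIV)"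
    by (subst nn_integral_fst[symmetric]) auto
  finally show ?thesis by (simp add: nn_integral_count_space_nat)
qed

lemma renewal_function_eq:
  assumes kj: "k \<in> {1..d}" "j \<in> {1..r}"
  shows "renewal_function M \<theta> k j t = emeasure (arrival_measure k j) (upto_time t)"
proof -
  note [measurable] = arrival_rv[OF kj]
  have "renewal_function M \<theta> k j t = (\<integral>\<^sup>+\<omega>. (\<Sum>i. indicator (upto_time t) (arrival \<theta> k j (Suc i) \<omega>)) \<partial>M)"
    unfolding renewal_function_def using claim_count_eq_suminf[OF kj] by (intro nn_integral_cong) auto
  also have "\<dots> = (\<Sum>i. \<integral>\<^sup>+\<omega>. indicator (upto_time t) (arrival \<theta> k j (Suc i) \<omega>) \<partial>M)"
    by (rule nn_integral_suminf) measurable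
  also have "\<dots> = (\<integral>\<^sup>+s. indicator (upto_time t) s \<partial>arrival_measure k j)"
    by (rule nn_integral_arrival_measure[OF kj, symmetric]) measurable
  finally show ?thesis by simp
qed

text \<open>Chernoff's bound with parameter 1: the indicator of an arrival up to \<open>s\<close> is
  at most the exponential of \<open>s\<close> minus the arrival time, and these have geometrically
  decreasing expectations.\<close>

lemma arrival_measure_atMost_finite:
  assumes kj: "k \<in> {1..d}" "j \<in> {1..r}"
  shows "emeasure (arrival_measure k j) {..s} < \<infinity>"
proof -
  note [measurable] = arrival_rv[OF kj]
  define \<rho> where "\<rho> = interarrival_laplace k j 1"
  have \<rho>: "0 \<le> \<rho>" "\<rho> < 1" unfolding \<rho>_def using interarrival_laplace_bounds[OF kj zero_less_one] by auto
  have "emeasure (arrival_measure k j) {..s} = (\<integral>\<^sup>+u. indicator {..s} u \<partial>arrival_measure k j)" by simp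
  also have "\<dots> = (\<Sum>i. \<integral>\<^sup>+\<omega>. indicator {..s} (arrival \<theta> k j (Suc i) \<omega>) \<partial>M)"
    by (rule nn_integral_arrival_measure[OF kj]) measurable
  also have "\<dots> \<le> (\<Sum>i. ennreal (exp s * \<rho> ^ Suc i))"
  proof (rule suminf_le)
    fix i
    have "(\<integral>\<^sup>+\<omega>. indicator {..s} (arrival \<theta> k j (Suc i) \<omega>) \<partial>M)
        \<le> (\<integral>\<^sup>+\<omega>. ennreal (exp s) * ennreal (exp (- 1 * arrival \<theta> k j (Suc i) \<omega>)) \<partial>M)"
      by (rule nn_integral_mono)
         (auto simp: indicator_def ennreal_mult[symmetric] exp_add[symmetric] simp flip: ennreal_1 intro!: ennreal_leI)
    also have "\<dots> = ennreal (exp s) * (\<integral>\<^sup>+\<omega>. ennreal (exp (- 1 * arrival \<theta> k j (Suc i) \<omega>)) \<partial>M)"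
      by (rule nn_integral_cmult) measurable
    also have "\<dots> = ennreal (exp s * \<rho> ^ Suc i)"
      unfolding arrival_laplace[OF kj zero_less_one] \<rho>_def[symmetric] using \<rho> by (simp add: ennreal_mult)
    finally show "(\<integral>\<^sup>+\<omega>. indicator {..s} (arrival \<theta> k j (Suc i) \<omega>) \<partial>M) \<le> ennreal (exp s * \<rho> ^ Suc i)" .
  qed auto
  also have "\<dots> = ennreal (\<Sum>i. exp s * \<rho> ^ Suc i)"
    using \<rho> by (intro suminf_ennreal2 summable_mult summable_ignore_initial_segment[of _ 1, simplified] summable_geometric) auto
  also have "\<dots> < \<infinity>" by simp
  finally show ?thesis .
qed

lemma arrival_measure_negative:
  assumes kj: "k \<in> {1..d}" "j \<in> {1..r}"
  shows "emeasure (arrival_measure k j) {..<0} = 0"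
proof -
  note [measurable] = arrival_rv[OF kj]
  have "emeasure (arrival_measure k j) {..<0} = (\<integral>\<^sup>+u. indicator {..<0} u \<partial>arrival_measure k j)" by simp
  also have "\<dots> = (\<Sum>i. \<integral>\<^sup>+\<omega>. indicator {..<0} (arrival \<theta> k j (Suc i) \<omega>) \<partial>M)"
    by (rule nn_integral_arrival_measure[OF kj]) measurable
  also have "\<dots> = (\<Sum>i. \<integral>\<^sup>+\<omega>. 0 \<partial>M)"
    using arrival_nonneg[OF kj] by (intro suminf_cong nn_integral_cong) (auto simp: indicator_def not_less)
  finally show ?thesis by simp
qed

text \<open>Both measures agree on half-open intervals, a generator on which they are finite.
  Extending the renewal function by 0 to negative times turns arrivals at time 0 into a jump of
  \<open>F\<close>, so the atom at 0 is kept.\<close>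

lemma renewal_measure_eq:
  assumes kj: "k \<in> {1..d}" "j \<in> {1..r}"
  shows "renewal_measure M \<theta> k j = arrival_measure k j"
proof -
  let ?\<nu> = "arrival_measure k j"
  define F where "F s = measure ?\<nu> {..s}" for s
  have fin: "emeasure ?\<nu> {..s} \<noteq> \<infinity>" for s using arrival_measure_atMost_finite[OF kj, of s] by simp
  have F: "(\<lambda>s. if s < 0 then 0 else enn2real (renewal_function M \<theta> k j (ennreal s))) = F"
  proof
    fix s :: real
    show "(if s < 0 then 0 else enn2real (renewal_function M \<theta> k j (ennreal s))) = F s"
    proof (cases "s < 0")
      case True
      have "emeasure ?\<nu> {..s} \<le> emeasure ?\<nu> {..<0}" using True by (intro emeasure_mono) auto
      then show ?thesis using True arrival_measure_negative[OF kj] by (simp add: F_def measure_def)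
    next
      case False
      have "emeasure ?\<nu> {..s} = emeasure ?\<nu> ({..<0} \<union> {0..s})" using False by (intro arg_cong[of _ _ "emeasure ?\<nu>"]) auto
      also have "\<dots> = emeasure ?\<nu> {..<0} + emeasure ?\<nu> {0..s}" by (intro plus_emeasure[symmetric]) auto
      also have "{0..s} = upto_time (ennreal s)" using False by (auto simp: upto_time_def)
      finally show ?thesis using False arrival_measure_negative[OF kj]
        by (simp add: F_def measure_def renewal_function_eq[OF kj])
    qed
  qed
  have mono: "F s \<le> F t" if "s \<le> t" for s t
    unfolding F_def using that fin by (intro measure_mono_fmeasurable) (auto simp: fmeasurable_def less_top)
  have diff: "emeasure ?\<nu> {s<..t} = ennreal (F t - F s)" if "s \<le> t" for s t
  proof -
    have "emeasure ?\<nu> ({..t} - {..s}) = emeasure ?\<nu> {..t} - emeasure ?\<nu> {..s}"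
      using that fin[of s] by (intro emeasure_Diff) auto
    also have "{..t} - {..s} = {s<..t}" by auto
    also have "emeasure ?\<nu> {..t} - emeasure ?\<nu> {..s} = ennreal (F t - F s)"
      using fin unfolding F_def by (simp add: emeasure_eq_ennreal_measure ennreal_minus)
    finally show ?thesis .
  qed
  have right_cont: "continuous (at_right a) F" for a
  proof -
    \<comment> \<open>The whole measure may be infinite. Restricted to \<open>{..a + 1}\<close> it
      is finite, hence has a right-continuous distribution function, which agrees with
      \<open>F\<close> near \<open>a\<close>.\<close>
    let ?\<mu> = "density ?\<nu> (indicator {..a + 1})"
    have em: "emeasure ?\<mu> B = emeasure ?\<nu> ({..a + 1} \<inter> B)" if "B \<in> sets borel" for B
      using that by (subst emeasure_density) (auto simp: indicator_inter_arith[symmetric])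
    have "finite_measure ?\<mu>" by (rule finite_measureI) (use em[of UNIV] fin in simp)
    then interpret finite_borel_measure ?\<mu>
      by (rule finite_borel_measure.intro) (simp add: finite_borel_measure_axioms_def)
    have eq: "cdf ?\<mu> s = F s" if "s \<le> a + 1" for s
    proof -
      have "{..a + 1} \<inter> {..s} = {..s}" using that by auto
      then show ?thesis using em[of "{..s}"] by (simp add: cdf_def F_def measure_def)
    qed
    have "(cdf ?\<mu> \<longlongrightarrow> cdf ?\<mu> a) (at_right a)"
      using cdf_is_right_cont[of a] by (simp add: continuous_within)
    moreover have "\<forall>\<^sub>F s in at_right a. cdf ?\<mu> s = F s"
      using eventually_at_right_real[of a "a + 1"] by (auto elim!: eventually_mono simp: eq)
    ultimately have "(F \<longlongrightarrow> cdf ?\<mu> a) (at_right a)" by (rule Lim_transform_eventually)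
    then show ?thesis by (simp add: eq continuous_within)
  qed
  show ?thesis
    unfolding renewal_measure_def F
  proof (rule measure_eqI_generator_eq[of "range (\<lambda>(a, b). {a<..b :: real})" UNIV _ _ "\<lambda>i. {- real i<..real i}"])
    show "Int_stable (range (\<lambda>(a, b). {a<..b :: real}))"
      by (auto simp: Int_stable_def)
    show "emeasure (interval_measure F) X = emeasure ?\<nu> X" if X: "X \<in> range (\<lambda>(a, b). {a<..b})" for X
    proof -
      obtain a b where ab: "X = {a<..b}" using X by auto
      show ?thesis
      proof (cases "a \<le> b")
        case True
        have "emeasure (interval_measure F) {a<..b} = F b - F a"
          by (rule emeasure_interval_measure_Ioc[OF True mono right_cont])
        then show ?thesis using diff[OF True] ab by simp
      qed (simp add: ab)
    qed
    show "sets (interval_measure F) = sigma_sets UNIV (range (\<lambda>(a, b). {a<..b :: real}))"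
      "sets ?\<nu> = sigma_sets UNIV (range (\<lambda>(a, b). {a<..b :: real}))"
      by (simp_all add: borel_sigma_sets_Ioc)
    show "(\<Union>i. {- real i<..real i}) = UNIV"
    proof (intro equalityI subsetI UNIV_I)
      fix x :: real
      obtain n :: nat where "\<bar>x\<bar> < real n" using reals_Archimedean2 by blast
      then show "x \<in> (\<Union>i. {- real i<..real i})" by (intro UN_I[of n]) auto
    qed
    show "emeasure (interval_measure F) {- real i<..real i} \<noteq> \<infinity>" for i
      by (subst emeasure_interval_measure_Ioc[OF _ mono right_cont]) auto
  qed auto
qed

text \<open>\<open>discount_moment\<close> read from right to left turns the Stieltjes integral in
  \<open>ell\<close> into the sum of the Breiman weights; the geometric moments make both sides
  finite.\<close>

lemma set_integral_renewal_measure: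
  assumes kj: "k \<in> {1..d}" "j \<in> {1..r}" and fin: "integrable M (\<lambda>\<omega>. exp (- p * R 1 \<omega>))"
    and neg: "laplace_exponent M R p < 0"
  shows "(LINT s:upto_time t|renewal_measure M \<theta> k j. exp (s * laplace_exponent M R p))
    = (\<Sum>i. expectation (\<lambda>\<omega>. discount k j (Suc i) \<omega> powr p * indicator (upto_time t) (arrival \<theta> k j (Suc i) \<omega>)))"
proof -
  note [measurable] = arrival_rv[OF kj] discount_rv[OF kj]
  let ?\<phi> = "laplace_exponent M R p"
  let ?w = "\<lambda>i. expectation (\<lambda>\<omega>. discount k j (Suc i) \<omega> powr p * indicator (upto_time t) (arrival \<theta> k j (Suc i) \<omega>))"
  define \<rho> where "\<rho> = interarrival_laplace k j (- ?\<phi>)"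
  have \<rho>: "0 \<le> \<rho>" "\<rho> < 1" unfolding \<rho>_def using interarrival_laplace_bounds[OF kj, of "- ?\<phi>"] neg by auto
  have int: "integrable M (\<lambda>\<omega>. discount k j (Suc i) \<omega> powr p * indicator (upto_time t) (arrival \<theta> k j (Suc i) \<omega>))" for i
    by (rule Bochner_Integration.integrable_bound[OF discount_moment_geometric(1)[OF kj fin neg, of "Suc i"]])
       (auto simp: indicator_def)
  have w: "0 \<le> ?w i" "?w i \<le> \<rho> ^ Suc i" for i
  proof -
    show "0 \<le> ?w i" by (intro integral_nonneg_AE) auto
    have "?w i \<le> expectation (\<lambda>\<omega>. discount k j (Suc i) \<omega> powr p)"
      using int discount_moment_geometric(1)[OF kj fin neg] by (intro integral_mono) (auto simp: indicator_def)
    then show "?w i \<le> \<rho> ^ Suc i" using discount_moment_geometric(2)[OF kj fin neg, of "Suc i"] by (simp add: \<rho>_def)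
  qed
  have "summable (\<lambda>i. \<rho> ^ Suc i)" using \<rho> by (subst summable_Suc_iff) (auto intro: summable_geometric)
  then have sm: "summable ?w"
    by (rule summable_comparison_test') (use w in auto)
  have "(LINT s:upto_time t|renewal_measure M \<theta> k j. exp (s * ?\<phi>))
      = enn2real (\<integral>\<^sup>+s. ennreal (exp (s * ?\<phi>)) * indicator (upto_time t) s \<partial>arrival_measure k j)"
    unfolding set_lebesgue_integral_def renewal_measure_eq[OF kj]
    by (subst integral_eq_nn_integral)
       (auto intro!: arg_cong[of _ _ enn2real] nn_integral_cong simp: indicator_def)
  also have "(\<integral>\<^sup>+s. ennreal (exp (s * ?\<phi>)) * indicator (upto_time t) s \<partial>arrival_measure k j)
      = (\<Sum>i. \<integral>\<^sup>+\<omega>. ennreal (exp (arrival \<theta> k j (Suc i) \<omega> * ?\<phi>)) * indicator (upto_time t) (arrival \<theta> k j (Suc i) \<omega>) \<partial>M)"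
    by (rule nn_integral_arrival_measure[OF kj]) measurable
  also have "\<dots> = (\<Sum>i. \<integral>\<^sup>+\<omega>. ennreal (discount k j (Suc i) \<omega> powr p) * indicator (upto_time t) (arrival \<theta> k j (Suc i) \<omega>) \<partial>M)"
    by (simp add: discount_moment[OF kj fin upto_time_borel])
  also have "\<dots> = (\<Sum>i. ennreal (?w i))"
  proof (rule suminf_cong)
    fix i
    have "(\<integral>\<^sup>+\<omega>. ennreal (discount k j (Suc i) \<omega> powr p) * indicator (upto_time t) (arrival \<theta> k j (Suc i) \<omega>) \<partial>M)
      = (\<integral>\<^sup>+\<omega>. ennreal (discount k j (Suc i) \<omega> powr p * indicator (upto_time t) (arrival \<theta> k j (Suc i) \<omega>)) \<partial>M)"
      by (intro nn_integral_cong) (auto simp: indicator_def)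
    also have "\<dots> = ennreal (?w i)" by (intro nn_integral_eq_integral int) auto
    finally show "(\<integral>\<^sup>+\<omega>. ennreal (discount k j (Suc i) \<omega> powr p) * indicator (upto_time t) (arrival \<theta> k j (Suc i) \<omega>) \<partial>M) = ennreal (?w i)" .
  qed
  also have "\<dots> = ennreal (\<Sum>i. ?w i)" by (rule suminf_ennreal2) (use w sm in auto)
  finally show ?thesis using w sm by (simp add: suminf_nonneg)
qed

end

text \<open>The quantile levels of the two variables differ, but at the common level
  \<open>1 / max (tail G\<^sub>1 x) (tail G\<^sub>2 x)\<close> both quantiles lie below \<open>x\<close>.\<close>

lemma (in prob_space) asymptotically_independent_joint_tail:
  assumes Y: "random_variable borel Y1" "random_variable borel Y2"
    and pos: "\<And>x. 0 < tail (df M Y1) x" "\<And>x. 0 < tail (df M Y2) x"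
    and ai: "asymptotically_independent M Y1 Y2"
    and f: "\<And>x. 0 < f x"
    and K: "\<And>x. tail (df M Y1) x \<le> K * f x" "\<And>x. tail (df M Y2) x \<le> K * f x" "0 \<le> K"
  shows "((\<lambda>x. prob {\<omega> \<in> space M. x < Y1 \<omega> \<and> x < Y2 \<omega>} / f x) \<longlongrightarrow> 0) at_top"
proof -
  note [measurable] = Y
  define U where "U Y = gen_inverse (\<lambda>y. 1 / tail (df M Y) y)" for Y
  let ?m = "\<lambda>x. max (tail (df M Y1) x) (tail (df M Y2) x)"
  let ?P = "\<lambda>x. prob {\<omega> \<in> space M. U Y1 x < Y1 \<omega> \<and> U Y2 x < Y2 \<omega>}"
  let ?P1 = "\<lambda>x. prob {\<omega> \<in> space M. U Y1 x < Y1 \<omega>}"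
  have lim: "((\<lambda>x. ?P x / ?P1 x) \<longlongrightarrow> 0) at_top"
    using ai unfolding asymptotically_independent_def U_def Let_def .
  have Ule: "U Y y \<le> x" and U_tail: "tail (df M Y) (U Y y) \<le> 1 / y"
    if Y: "random_variable borel Y" and pos: "\<And>x. 0 < tail (df M Y) x" and y: "1 < y" "y \<le> 1 / tail (df M Y) x" for Y x y
  proof -
    note G = distribution_function_df[OF Y]
    \<comment> \<open>\<open>1 / tail\<close> reaches \<open>y\<close> exactly where the
      distribution function reaches \<open>1 - 1 / y\<close>, so \<open>U\<close> is an ordinary
      quantile.\<close>
    have eq: "{z. y \<le> 1 / tail (df M Y) z} = {z. 1 - 1 / y \<le> df M Y z}"
      using pos y(1) by (auto simp: tail_def field_simps)
    have Ueq: "U Y y = gen_inverse (df M Y) (1 - 1 / y)"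
      unfolding U_def gen_inverse_def eq ..
    have q: "0 < 1 - 1 / y" "1 - 1 / y < 1" using y(1) by auto
    have "x \<in> {z. y \<le> 1 / tail (df M Y) z}" using y(2) by simp
    then show "U Y y \<le> x" unfolding eq Ueq by (intro quantile_le[OF G q(1)]) simp
    show "tail (df M Y) (U Y y) \<le> 1 / y"
      using quantile_attained[OF G q] unfolding Ueq by (simp add: tail_def)
  qed
  have m0: "0 < ?m x" for x using pos(1)[of x] by simp
  have tail0: "((\<lambda>x. tail (df M Y) x) \<longlongrightarrow> 0) at_top" if "random_variable borel Y" for Y
    unfolding tail_def using tendsto_diff[OF tendsto_const distribution_function_at_top[OF distribution_function_df[OF that]], of 1] by simp
  have "(?m \<longlongrightarrow> max 0 0) at_top" by (intro tendsto_max tail0 Y)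
  then have "filterlim ?m (at_right 0) at_top"
    unfolding filterlim_at using m0 by (auto intro!: always_eventually simp: less_imp_neq[THEN not_sym])
  then have inv: "filterlim (\<lambda>x. 1 / ?m x) at_top at_top"
    using filterlim_compose[OF filterlim_inverse_at_top_right] by (simp add: inverse_eq_divide)
  have bound: "prob {\<omega> \<in> space M. x < Y1 \<omega> \<and> x < Y2 \<omega>} / f x \<le> K * (?P (1 / ?m x) / ?P1 (1 / ?m x))"
    if y: "1 < 1 / ?m x" for x
  proof -
    let ?y = "1 / ?m x"
    have le: "?y \<le> 1 / tail (df M Y1) x" "?y \<le> 1 / tail (df M Y2) x"
      using pos by (auto intro!: divide_left_mono simp: less_max_iff_disj mult_pos_pos)
    note u1 = Ule[OF Y(1) pos(1) y le(1)] and u2 = Ule[OF Y(2) pos(2) y le(2)] and ut = U_tail[OF Y(1) pos(1) y le(1)]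
    have P1: "?P1 ?y = tail (df M Y1) (U Y1 ?y)" by (simp add: tail_df[OF Y(1)])
    then have P1pos: "0 < ?P1 ?y" using pos(1) by simp
    have "prob {\<omega> \<in> space M. x < Y1 \<omega> \<and> x < Y2 \<omega>} \<le> ?P ?y"
      using u1 u2 by (intro finite_measure_mono) auto
    also have "?P ?y = ?P ?y / ?P1 ?y * ?P1 ?y" using P1pos by simp
    also have "\<dots> \<le> ?P ?y / ?P1 ?y * (K * f x)"
    proof (rule mult_left_mono)
      \<comment> \<open>The quantile at level \<open>?y\<close> leaves a tail of at most
        \<open>1 / ?y\<close>, the larger of the two tails at \<open>x\<close>.\<close>
      have "?P1 ?y \<le> ?m x" using ut P1 by simp
      also have "\<dots> \<le> K * f x" using K by simp
      finally show "?P1 ?y \<le> K * f x" .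
    qed (simp add: divide_nonneg_nonneg)
    finally show ?thesis using f[of x] by (simp add: field_simps)
  qed
  have lim': "((\<lambda>x. K * (?P (1 / ?m x) / ?P1 (1 / ?m x))) \<longlongrightarrow> K * 0) at_top"
    by (intro tendsto_intros filterlim_compose[OF lim inv])
  show ?thesis
  proof (rule tendsto_sandwich[OF _ _ tendsto_const])
    show "((\<lambda>x. K * (?P (1 / ?m x) / ?P1 (1 / ?m x))) \<longlongrightarrow> 0) at_top" using lim' by simp
    have "\<forall>\<^sub>F x in at_top. 1 < 1 / ?m x" using inv unfolding filterlim_at_top_dense by blast
    then show "\<forall>\<^sub>F x in at_top. prob {\<omega> \<in> space M. x < Y1 \<omega> \<and> x < Y2 \<omega>} / f x \<le> K * (?P (1 / ?m x) / ?P1 (1 / ?m x))"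
      by eventually_elim (rule bound)
    show "\<forall>\<^sub>F x in at_top. 0 \<le> prob {\<omega> \<in> space M. x < Y1 \<omega> \<and> x < Y2 \<omega>} / f x"
      using f by (intro always_eventually allI divide_nonneg_nonneg) (auto intro: less_imp_le)
  qed
qed

section \<open>Premiums\<close>

text \<open>With \<open>l = - \<phi> p / p\<close> and \<open>\<mu>\<close> the exponential law of rate \<open>l\<close>, the integral of
  \<open>exp (- R\<^sub>s)\<close> over \<open>[0,\<infinity>)\<close> is the \<open>\<mu>\<close>-mean of \<open>exp (- R\<^sub>s) * exp (l * s) / l\<close>, whose \<open>p\<close>-th power
  has the constant expectation \<open>l powr - p\<close>; Jensen's inequality bounds the \<open>p\<close>-th moment.\<close>

lemma (in renewal_risk_model) premium_dominated:
  assumes p: "1 \<le> p" and fin: "integrable M (\<lambda>\<omega>. exp (- p * R 1 \<omega>))" and neg: "laplace_exponent M R p < 0"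
  obtains P where "P \<in> borel_measurable M" "\<And>\<omega>. 0 \<le> P \<omega>" "integrable M (\<lambda>\<omega>. P \<omega> powr p)"
    "AE \<omega> in M. \<forall>t. 0 \<le> (LINT s:upto_time t|lborel. exp (- R s \<omega>)) \<and> (LINT s:upto_time t|lborel. exp (- R s \<omega>)) \<le> P \<omega>"
proof -
  define l where "l = - laplace_exponent M R p / p"
  have l: "0 < l" using neg p by (simp add: l_def divide_neg_pos)
  have lp: "laplace_exponent M R p + p * l = 0" using p by (simp add: l_def)
  define \<mu> where "\<mu> = density lborel (exponential_density l)"
  interpret \<mu>: prob_space \<mu> unfolding \<mu>_def by (rule prob_space_exponential_density[OF l])
  have sets_\<mu>[measurable_cong, simp]: "sets \<mu> = sets borel" by (simp add: \<mu>_def)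
  have space_\<mu>[simp]: "space \<mu> = UNIV" by (simp add: \<mu>_def)
  have ae_pos: "AE s in \<mu>. 0 \<le> s"
    unfolding \<mu>_def by (subst AE_density) (auto simp: exponential_density_def intro!: AE_I2)
  note [measurable] = returns_joint_rv
  define g where "g \<omega> s = exp (- (\<lambda>(s, \<omega>). R (max 0 s) \<omega>) (s, \<omega>)) * exp (l * s) / l" for \<omega> s
  have g_pos: "0 < g \<omega> s" for \<omega> s using l by (simp add: g_def)
  have g_meas[measurable]: "(\<lambda>(s, \<omega>). g \<omega> s) \<in> borel_measurable (borel \<Otimes>\<^sub>M M)"
    unfolding g_def by measurable
  have g_meas2[measurable]: "(\<lambda>(\<omega>, s). g \<omega> s) \<in> borel_measurable (M \<Otimes>\<^sub>M \<mu>)"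
    unfolding g_def by measurable
  have g_s[measurable]: "g \<omega> \<in> borel_measurable borel" if "\<omega> \<in> space M" for \<omega>
  proof -
    have "(\<lambda>s. (\<lambda>(s, \<omega>). g \<omega> s) (s, \<omega>)) \<in> borel_measurable borel"
      by (rule measurable_compose[OF _ g_meas]) (use that in simp)
    then show ?thesis by simp
  qed
  define P where "P \<omega> = (LINT s|\<mu>. g \<omega> s)" for \<omega>
  have P_meas[measurable]: "P \<in> borel_measurable M"
    unfolding P_def by (rule \<mu>.borel_measurable_lebesgue_integral) measurable
  have P_nonneg: "0 \<le> P \<omega>" for \<omega>
    unfolding P_def using g_pos by (intro integral_nonneg_AE AE_I2) (simp add: less_imp_le)
  interpret PS: pair_sigma_finite M \<mu> by unfold_locales
  have total: "(\<integral>\<^sup>+\<omega>. \<integral>\<^sup>+s. ennreal (g \<omega> s powr p) \<partial>\<mu> \<partial>M) = ennreal (l powr - p)"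
  proof -
    have "(\<integral>\<^sup>+\<omega>. \<integral>\<^sup>+s. ennreal (g \<omega> s powr p) \<partial>\<mu> \<partial>M) = (\<integral>\<^sup>+s. \<integral>\<^sup>+\<omega>. ennreal (g \<omega> s powr p) \<partial>M \<partial>\<mu>)"
      by (rule PS.Fubini'[symmetric]) measurable
    also have "\<dots> = (\<integral>\<^sup>+s. ennreal (l powr - p) \<partial>\<mu>)"
    proof (rule nn_integral_cong_AE)
      show "AE s in \<mu>. (\<integral>\<^sup>+\<omega>. ennreal (g \<omega> s powr p) \<partial>M) = ennreal (l powr - p)"
        using ae_pos
      proof eventually_elim
        case (elim s)
        note [measurable] = levy_rv[OF levy elim]
        have "g \<omega> s powr p = exp (p * l * s) * l powr - p * exp (- p * R s \<omega>)" for \<omega>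
          using elim l unfolding g_def
          by (simp add: powr_divide powr_mult exp_powr_real powr_minus_divide mult_ac)
        then have "(\<integral>\<^sup>+\<omega>. ennreal (g \<omega> s powr p) \<partial>M) = (\<integral>\<^sup>+\<omega>. ennreal (exp (p * l * s) * l powr - p) * ennreal (exp (- p * R s \<omega>)) \<partial>M)"
          by (simp add: ennreal_mult')
        also have "\<dots> = ennreal (exp (p * l * s) * l powr - p) * levy_mgf R p s"
          unfolding levy_mgf_def by (rule nn_integral_cmult) measurable
        also have "\<dots> = ennreal (exp (p * l * s) * l powr - p * exp (s * laplace_exponent M R p))"
          by (simp add: levy_mgf_exp[OF levy fin elim] ennreal_mult)
        also have "exp (p * l * s) * l powr - p * exp (s * laplace_exponent M R p)
            = l powr - p * exp (s * (laplace_exponent M R p + p * l))"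
          by (simp add: exp_add[symmetric] algebra_simps)
        finally show ?case unfolding lp by simp
      qed
    qed
    finally show ?thesis by (simp add: \<mu>.emeasure_space_1[simplified])
  qed
  have "(\<lambda>\<omega>. \<integral>\<^sup>+s. ennreal (g \<omega> s powr p) \<partial>\<mu>) \<in> borel_measurable M"
    by (rule \<mu>.borel_measurable_nn_integral) measurable
  then have ae_fin: "AE \<omega> in M. (\<integral>\<^sup>+s. ennreal (g \<omega> s powr p) \<partial>\<mu>) \<noteq> \<infinity>"
    by (rule nn_integral_PInf_AE) (simp add: total)
  then have jensen: "AE \<omega> in M. integrable \<mu> (g \<omega>) \<and> ennreal (P \<omega> powr p) \<le> (\<integral>\<^sup>+s. ennreal (g \<omega> s powr p) \<partial>\<mu>)"
    using AE_space
  proof eventually_elim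
    case (elim \<omega>)
    have "g \<omega> \<in> borel_measurable \<mu>" using g_s[OF elim(2)] by simp
    from \<mu>.nn_jensen_powr[OF this g_pos p] elim(1) show ?case by (simp add: P_def less_top)
  qed
  have "(\<integral>\<^sup>+\<omega>. ennreal (P \<omega> powr p) \<partial>M) \<le> ennreal (l powr - p)"
    unfolding total[symmetric] by (rule nn_integral_mono_AE) (use jensen in \<open>auto elim: eventually_mono\<close>)
  then have intP: "integrable M (\<lambda>\<omega>. P \<omega> powr p)"
    by (intro integrableI_nonneg) (auto intro: le_less_trans)
  have "AE \<omega> in M. \<forall>t. 0 \<le> (LINT s:upto_time t|lborel. exp (- R s \<omega>)) \<and> (LINT s:upto_time t|lborel. exp (- R s \<omega>)) \<le> P \<omega>"
    using jensen AE_space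
  proof eventually_elim
    case (elim \<omega>)
    note gm = g_s[OF elim(2)]
    \<comment> \<open>The factor \<open>exp (l * s) / l\<close> in \<open>g\<close> cancels the
      exponential density.\<close>
    have dens: "exponential_density l s *\<^sub>R g \<omega> s = indicator {0..} s * exp (- R s \<omega>)" for s
      using l by (simp add: exponential_density_def g_def indicator_def exp_minus field_simps)
    have ih: "integrable lborel (\<lambda>s. indicator {0..} s * exp (- R s \<omega>))"
      using elim(1) gm l unfolding \<mu>_def dens[symmetric]
      by (subst (asm) integrable_density) (auto simp: exponential_density_def)
    have Ph: "P \<omega> = (LINT s|lborel. indicator {0..} s * exp (- R s \<omega>))"
      using gm l unfolding P_def \<mu>_def dens[symmetric]
      by (subst integral_density) (auto simp: exponential_density_def)
    show ?case
    proof (intro allI conjI)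
      fix t
      have ub: "indicator (upto_time t) s * exp (- R s \<omega>) \<le> indicator {0..} s * exp (- R s \<omega>)" for s
        by (auto simp: indicator_def upto_time_def)
      have eq: "indicator (upto_time t) s * exp (- R s \<omega>) = indicator (upto_time t) s * (indicator {0..} s * exp (- R s \<omega>))" for s
        by (auto simp: indicator_def upto_time_def)
      have it: "integrable lborel (\<lambda>s. indicator (upto_time t) s * exp (- R s \<omega>))"
        unfolding eq by (rule Bochner_Integration.integrable_bound[OF ih]) (use ih in \<open>auto simp: indicator_def\<close>)
      show "(LINT s:upto_time t|lborel. exp (- R s \<omega>)) \<le> P \<omega>"
        unfolding set_lebesgue_integral_def Ph using it ih ub by (simp add: integral_mono)
      show "0 \<le> (LINT s:upto_time t|lborel. exp (- R s \<omega>))"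
        unfolding set_lebesgue_integral_def by (intro integral_nonneg_AE AE_I2) simp
    qed
  qed
  then show ?thesis using that[OF P_meas P_nonneg intP] by blast
qed

text \<open>Markov's inequality at an order \<open>p\<close> above the index of the tail.\<close>

lemma (in prob_space) moment_tail_negligible:
  assumes f: "rv_tail f \<alpha>" and p: "\<alpha> < p" and Q: "Q \<in> borel_measurable M" "\<And>\<omega>. 0 \<le> Q \<omega>"
    and int: "integrable M (\<lambda>\<omega>. Q \<omega> powr p)"
  shows "((\<lambda>x. prob {\<omega> \<in> space M. x < Q \<omega>} / f x) \<longlongrightarrow> 0) at_top"
proof -
  interpret rv_tail f \<alpha> by fact
  note [measurable] = Q(1)
  let ?m = "expectation (\<lambda>\<omega>. Q \<omega> powr p)"
  have bound: "prob {\<omega> \<in> space M. x < Q \<omega>} / f x \<le> ?m * (x powr - p / f x)" if x: "0 < x" for x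
  proof -
    have "prob {\<omega> \<in> space M. x < Q \<omega>} \<le> prob {\<omega> \<in> space M. x powr p \<le> Q \<omega> powr p}"
      using x p index_gt_1 by (intro finite_measure_mono) (auto intro!: powr_mono2)
    also have "\<dots> \<le> ?m / x powr p"
      using x int by (intro integral_Markov_inequality_measure[where A = "{}"]) auto
    finally have "prob {\<omega> \<in> space M. x < Q \<omega>} / f x \<le> ?m / x powr p / f x"
      using f_pos[of x] by (intro divide_right_mono) auto
    then show ?thesis by (simp add: powr_minus_divide)
  qed
  show ?thesis
  proof (rule tendsto_sandwich[OF _ _ tendsto_const])
    show "((\<lambda>x. ?m * (x powr - p / f x)) \<longlongrightarrow> 0) at_top"
      using tendsto_mult[OF tendsto_const powr_negligible[OF p], of ?m] by simp
    show "\<forall>\<^sub>F x in at_top. prob {\<omega> \<in> space M. x < Q \<omega>} / f x \<le> ?m * (x powr - p / f x)"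
      using eventually_gt_at_top[of 0] by eventually_elim (rule bound)
    show "\<forall>\<^sub>F x in at_top. 0 \<le> prob {\<omega> \<in> space M. x < Q \<omega>} / f x"
      using f_pos by (intro always_eventually allI divide_nonneg_nonneg) (auto intro: less_imp_le)
  qed
qed

text \<open>A tail that vanishes somewhere vanishes from there on. As division by 0 gives 0, the
  ratio for \<open>y = 1\<close> would then tend to 0 instead of 1.\<close>

lemma regularly_varying_tail_pos:
  assumes rv: "regularly_varying \<rho> (tail G)" and G: "distribution_function G"
  shows "0 < tail G x"
proof (rule ccontr)
  assume "\<not> 0 < tail G x"
  then have "tail G y = 0" if "x \<le> y" for y
    using distribution_function_mono[OF G that] distribution_function_le_1[OF G, of y] by (simp add: tail_def)
  then have "eventually (\<lambda>y. tail G (1 * y) / tail G y = 0) at_top"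
    by (auto simp: eventually_at_top_linorder)
  then have "((\<lambda>y. tail G (1 * y) / tail G y) \<longlongrightarrow> 0) at_top" by (rule tendsto_eventually)
  moreover have "((\<lambda>y. tail G (1 * y) / tail G y) \<longlongrightarrow> 1 powr \<rho>) at_top"
    using rv unfolding regularly_varying_def by (rule allE[of _ 1]) simp
  ultimately show False using tendsto_unique[OF trivial_limit_at_top_linorder] by fastforce
qed

lemma tail_equiv_ratio:
  assumes rv: "regularly_varying \<rho> (tail G)" and G: "distribution_function G"
    and equiv: "tail G \<sim>[at_top] (\<lambda>x. c * tail F x)" and c: "0 < c"
  shows "((\<lambda>x. tail G x / tail F x) \<longlongrightarrow> c) at_top"
proof -
  have "((\<lambda>x. tail G x / (c * tail F x)) \<longlongrightarrow> 1) at_top"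
    using regularly_varying_tail_pos[OF rv G]
    by (intro asymp_equivD_strong[OF equiv] always_eventually allI disjI1) (simp add: less_imp_neq[THEN not_sym])
  from tendsto_mult[OF tendsto_const[of c] this] show ?thesis using c by simp
qed

text \<open>Regular variation passes from a claim distribution to \<open>F\<close>, about which only
  tail equivalence is known. Positivity of its tail again rests on division by 0 giving 0: a
  vanishing tail would make the ratio tend to 0 and not to \<open>c\<close>.\<close>

lemma rv_distribution_of_equiv:
  assumes rv: "regularly_varying (- \<alpha>) (tail G)" and G: "distribution_function G" and F: "distribution_function F"
    and equiv: "tail G \<sim>[at_top] (\<lambda>x. c * tail F x)" and c: "0 < c" and \<alpha>: "1 < \<alpha>"
  shows "rv_distribution F \<alpha>"
proof
  note Gpos = regularly_varying_tail_pos[OF rv G]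
  note ratio = tail_equiv_ratio[OF rv G equiv c]
  show anti: "tail F y \<le> tail F x" if "x \<le> y" for x y
    using distribution_function_mono[OF F that] by (simp add: tail_def)
  show "tail F x \<le> 1" for x using distribution_function_nonneg[OF F] by (simp add: tail_def)
  have nn: "0 \<le> tail F x" for x using distribution_function_le_1[OF F] by (simp add: tail_def)
  have pos: "tail F x \<noteq> 0" for x
  proof
    assume 0: "tail F x = 0"
    then have "tail F y = 0" if "x \<le> y" for y using anti[OF that] nn[of y] by simp
    then have "eventually (\<lambda>y. tail G y / tail F y = 0) at_top" by (auto simp: eventually_at_top_linorder)
    then have "((\<lambda>y. tail G y / tail F y) \<longlongrightarrow> 0) at_top" by (rule tendsto_eventually)
    then show False using tendsto_unique[OF trivial_limit_at_top_linorder ratio] c by fastforce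
  qed
  then show "0 < tail F x" for x using nn[of x] by (simp add: order_less_le)
  show "1 < \<alpha>" "distribution_function F" by fact+
  show "regularly_varying (- \<alpha>) (tail F)"
    unfolding regularly_varying_def
  proof (intro allI impI)
    fix y :: real assume y: "0 < y"
    have "filterlim (\<lambda>x. y * x) at_top at_top"
      using filterlim_tendsto_pos_mult_at_top[OF tendsto_const y filterlim_ident] .
    from filterlim_compose[OF ratio this]
    have 1: "((\<lambda>x. tail G (y * x) / tail F (y * x)) \<longlongrightarrow> c) at_top" .
    have "((\<lambda>x. tail G (y * x) / tail G x * (tail G x / tail F x) / (tail G (y * x) / tail F (y * x))) \<longlongrightarrow> y powr - \<alpha> * c / c) at_top"
      using rv y c unfolding regularly_varying_def by (intro tendsto_intros ratio 1) auto
    moreover have "tail G (y * x) / tail G x * (tail G x / tail F x) / (tail G (y * x) / tail F (y * x)) = tail F (y * x) / tail F x" for x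
      using Gpos[of x] Gpos[of "y * x"] by simp
    ultimately show "((\<lambda>x. tail F (y * x) / tail F x) \<longlongrightarrow> y powr - \<alpha>) at_top" using c by simp
  qed
qed

section \<open>The risk model\<close>

lemma sum_singleton_times: "(\<Sum>p\<in>{k} \<times> B. g p) = (\<Sum>j\<in>B. g (k, j))"
  by (rule sum.reindex_cong[of "Pair k"]) (auto simp: inj_on_def)

lemma sum_times_fibres: "(\<Sum>p\<in>A \<times> B. g p) = (\<Sum>k\<in>A. \<Sum>p\<in>{k} \<times> B. g p)"
  by (simp add: sum_singleton_times sum.cartesian_product)

locale regular_risk_model = renewal_risk_model M d r X Fc \<theta> R c
  for M :: "'a measure" and d r X Fc \<theta> R c +
  fixes F :: "real \<Rightarrow> real" and a :: "nat \<Rightarrow> nat \<Rightarrow> real" and \<alpha> \<alpha>' :: real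
  assumes alpha: "1 < \<alpha>"
    and rv: "\<And>k j. k \<in> {1..d} \<Longrightarrow> j \<in> {1..r} \<Longrightarrow> regularly_varying (- \<alpha>) (tail (Fc k j))"
    and F: "distribution_function F"
    and a_pos: "\<And>k j. k \<in> {1..d} \<Longrightarrow> j \<in> {1..r} \<Longrightarrow> 0 < a k j"
    and tail_equiv: "\<And>k j. k \<in> {1..d} \<Longrightarrow> j \<in> {1..r} \<Longrightarrow> tail (Fc k j) \<sim>[at_top] (\<lambda>x. a k j * tail F x)"
    and alpha': "\<alpha> < \<alpha>'"
    and phi_finite: "integrable M (\<lambda>\<omega>. exp (- \<alpha>' * R 1 \<omega>))"
    and phi_neg: "laplace_exponent M R \<alpha>' < 0"
begin

abbreviation "types \<equiv> {1..d} \<times> {1..r}"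
abbreviation "line k \<equiv> {k} \<times> {1..r}"
text \<open>Midpoints of the intervals from 1 to \<alpha> and from \<alpha> to
  \<open>\<alpha>'\<close>; any exponents inside them would do.\<close>

definition "\<gamma> = (1 + \<alpha>) / 2"
definition "\<beta> = (\<alpha> + \<alpha>') / 2"
text \<open>A common rate for both moments over all lines and types; the entry \<open>1 / 2\<close>
  makes positivity immediate.\<close>

definition "decay = Max (insert (1 / 2) ((\<lambda>((k, j), p). interarrival_laplace k j (- laplace_exponent M R p)) ` (types \<times> {\<gamma>, \<beta>})))"

lemma exponents: "1 < \<gamma>" "\<gamma> < \<alpha>" "\<alpha> < \<beta>" "\<beta> < \<alpha>'"
  using alpha alpha' by (auto simp: \<gamma>_def \<beta>_def)

lemma phi: "0 < p \<Longrightarrow> p \<le> \<alpha>' \<Longrightarrow> integrable M (\<lambda>\<omega>. exp (- p * R 1 \<omega>))"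
  "0 < p \<Longrightarrow> p \<le> \<alpha>' \<Longrightarrow> laplace_exponent M R p < 0"
  using laplace_exponent_smaller[OF levy phi_finite phi_neg] by auto

lemma Fc_df: "k \<in> {1..d} \<Longrightarrow> j \<in> {1..r} \<Longrightarrow> distribution_function (Fc k j)"
  using distribution_function_df[OF claim_rv] claim_df by (metis order_refl)

lemma one_in: "1 \<in> {1..d}" "1 \<in> {1..r}" using d_pos r_pos by auto

sublocale F: rv_distribution F \<alpha>
  by (rule rv_distribution_of_equiv[OF rv[OF one_in] Fc_df[OF one_in] F tail_equiv[OF one_in] a_pos[OF one_in] alpha])

lemma tail_ratio: "k \<in> {1..d} \<Longrightarrow> j \<in> {1..r} \<Longrightarrow> ((\<lambda>x. tail (Fc k j) x / tail F x) \<longlongrightarrow> a k j) at_top"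
  using tail_equiv_ratio rv Fc_df tail_equiv a_pos by blast

lemma claim_tail:
  assumes "k \<in> {1..d}" "j \<in> {1..r}" "1 \<le> i"
  shows "prob {\<omega> \<in> space M. x < X k j i \<omega>} = tail (Fc k j) x"
  using tail_df[OF claim_rv[OF assms]] claim_df[OF assms] by simp

lemma claim_pair_negligible:
  assumes 1: "k \<in> {1..d}" "j \<in> {1..r}" "1 \<le> i" and 2: "k' \<in> {1..d}" "j' \<in> {1..r}" "1 \<le> i'"
    and ne: "(k, j, i) \<noteq> (k', j', i')"
  shows "((\<lambda>x. prob {\<omega> \<in> space M. x < X k j i \<omega> \<and> x < X k' j' i' \<omega>} / tail F x) \<longlongrightarrow> 0) at_top"
proof -
  have le1: "tail (Fc k j) x \<le> 1" if "k \<in> {1..d}" "j \<in> {1..r}" for k j x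
    using distribution_function_nonneg[OF Fc_df[OF that]] by (simp add: tail_def)
  obtain K1 where K1: "0 < K1" "\<And>x. tail (Fc k j) x \<le> K1 * tail F x"
    using F.tail_dominated[OF tail_ratio[OF 1(1,2)] less_imp_le[OF a_pos[OF 1(1,2)]] le1[OF 1(1,2)]] by blast
  obtain K2 where K2: "0 < K2" "\<And>x. tail (Fc k' j') x \<le> K2 * tail F x"
    using F.tail_dominated[OF tail_ratio[OF 2(1,2)] less_imp_le[OF a_pos[OF 2(1,2)]] le1[OF 2(1,2)]] by blast
  show ?thesis
  proof (rule asymptotically_independent_joint_tail[OF claim_rv[OF 1] claim_rv[OF 2] _ _ claim_PAI[OF 1 2 ne]])
    show "0 < tail (df M (X k j i)) x" "0 < tail (df M (X k' j' i')) x" for x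
      unfolding claim_df[OF 1] claim_df[OF 2]
      using regularly_varying_tail_pos rv Fc_df 1 2 by blast+
    show "0 < tail F x" for x by (rule F.f_pos)
    have "K1 * tail F x \<le> (K1 + K2) * tail F x" "K2 * tail F x \<le> (K1 + K2) * tail F x" for x
      using K1 K2 F.f_pos[of x] by (auto intro!: mult_right_mono)
    then show "tail (df M (X k j i)) x \<le> (K1 + K2) * tail F x" "tail (df M (X k' j' i')) x \<le> (K1 + K2) * tail F x" for x
      unfolding claim_df[OF 1] claim_df[OF 2] using K1(2) K2(2) order_trans by blast+
    show "0 \<le> K1 + K2" using K1 K2 by simp
  qed
qed

lemma decay: "0 < decay" "decay < 1"
  "k \<in> {1..d} \<Longrightarrow> j \<in> {1..r} \<Longrightarrow> p \<in> {\<gamma>, \<beta>} \<Longrightarrow> interarrival_laplace k j (- laplace_exponent M R p) \<le> decay"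
proof -
  let ?S = "insert (1 / 2) ((\<lambda>((k, j), p). interarrival_laplace k j (- laplace_exponent M R p)) ` (types \<times> {\<gamma>, \<beta>}))"
  have fin: "finite ?S" by simp
  have "1 / 2 \<le> decay" unfolding decay_def by (rule Max_ge[OF fin]) simp
  then show "0 < decay" by simp
  have "x < 1" if x: "x \<in> ?S" for x
  proof -
    let ?h = "\<lambda>((k, j), p). interarrival_laplace k j (- laplace_exponent M R p)"
    have "x = 1 / 2 \<or> (\<exists>z\<in>types \<times> {\<gamma>, \<beta>}. x = ?h z)" using x by (simp only: insert_iff image_iff)
    then show ?thesis
    proof
      assume "\<exists>z\<in>types \<times> {\<gamma>, \<beta>}. x = ?h z"
      then obtain k j p where z: "k \<in> {1..d}" "j \<in> {1..r}" "p \<in> {\<gamma>, \<beta>}" "x = ?h ((k, j), p)"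
        by (metis (no_types, lifting) SigmaE)
      have "0 < - laplace_exponent M R p" using phi(2)[of p] z(3) exponents by auto
      then show ?thesis using interarrival_laplace_bounds(2)[OF z(1,2)] z(4) by simp
    qed simp
  qed
  then show "decay < 1" unfolding decay_def using Max_in[OF fin] by blast
  assume "k \<in> {1..d}" "j \<in> {1..r}" "p \<in> {\<gamma>, \<beta>}"
  then show "interarrival_laplace k j (- laplace_exponent M R p) \<le> decay"
    unfolding decay_def by (intro Max_ge[OF fin] insertI2 image_eqI[of _ _ "((k, j), p)"]) auto
qed

text \<open>The model counts claims from 1 and the abstract setting from 0, hence
  \<open>Suc i\<close>. The moments are at most \<open>decay ^ Suc i\<close>, so dropping one factor
  allows the constant 1.\<close>

sublocale H: heavy_tailed_sums M "tail F" \<alpha> types "\<lambda>(k, j) i. X k j (Suc i)" "\<lambda>(k, j) i. discount k j (Suc i)"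
    "\<lambda>(k, j) i. arrival \<theta> k j (Suc i)" "\<lambda>(k, j). tail (Fc k j)" "\<lambda>(k, j). a k j" \<gamma> \<beta> decay 1
proof (unfold_locales, goal_cases)
  case 1 show ?case by simp
next
  case 2 show ?case by (rule exponents)
next
  case 3 show ?case by (rule exponents)
next
  case 4 show ?case by (rule exponents)
next
  case (5 p i) then show ?case using claim_rv by auto
next
  case (6 p i) then show ?case using discount_rv by auto
next
  case (7 p i) then show ?case using arrival_rv by auto
next
  case (8 p \<omega> i) then show ?case using claim_nonneg by auto
next
  case (9 p \<omega> i) then show ?case by (auto simp: discount_def)
next
  case (10 p x i) then show ?case using claim_tail by auto
next
  case (11 p) then show ?case using tail_ratio by auto
next
  case (12 p) then show ?case using a_pos by (auto intro: less_imp_le)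
next
  case (13 p i) then show ?case using claim_indep_discount by (auto simp: case_prod_unfold)
next
  case (14 p q i j)
  obtain k1 j1 k2 j2 where pq: "p = (k1, j1)" "q = (k2, j2)" by (cases p, cases q)
  show ?case using 14 claim_pair_negligible[of k1 j1 "Suc i" k2 j2 "Suc j"] unfolding pq by simp
next
  case 15 show ?case by (rule decay)
next
  case 16 show ?case by (rule decay)
next
  case (17 p s i)
  then have "0 < s" "s \<le> \<alpha>'" using exponents by auto
  then show ?case using 17 discount_moment_geometric(1)[OF _ _ phi] by auto
next
  case (18 p s i)
  obtain k j where p: "p = (k, j)" by (cases p)
  have kj: "k \<in> {1..d}" "j \<in> {1..r}" using 18(1) p by auto
  have s: "0 < s" "s \<le> \<alpha>'" using 18(2) exponents by auto
  let ?\<rho> = "interarrival_laplace k j (- laplace_exponent M R s)"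
  have \<rho>: "0 \<le> ?\<rho>" "?\<rho> \<le> decay"
    using interarrival_laplace_bounds(1)[OF kj, of "- laplace_exponent M R s"] phi(2)[OF s] decay(3)[OF kj 18(2)] by auto
  have "?\<rho> ^ Suc i \<le> decay ^ Suc i" using \<rho> by (intro power_mono) auto
  also have "\<dots> \<le> 1 * decay ^ i" using decay by (simp add: mult_left_le_one_le)
  finally show ?case using discount_moment_geometric(2)[OF kj phi[OF s], of "Suc i"] by (simp add: p)
qed

definition premium :: "ennreal \<Rightarrow> 'a \<Rightarrow> real" where
  "premium t \<omega> = (LINT s:upto_time t|lborel. exp (- R s \<omega>))"

abbreviation "loss \<equiv> line_loss r X \<theta> R c"
abbreviation "aggregate \<equiv> total_loss d r X \<theta> R c"

lemma line_loss_eq: "loss k t \<omega> = H.S (line k) (upto_time t) \<omega> - c k * premium t \<omega>"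
proof -
  have "H.S (line k) (upto_time t) \<omega> = (\<Sum>j=1..r. \<Sum>i. X k j (Suc i) \<omega> * exp (- R (arrival \<theta> k j (Suc i) \<omega>) \<omega>)
      * indicator (upto_time t) (arrival \<theta> k j (Suc i) \<omega>))"
    unfolding H.S_def discount_def sum_singleton_times by simp
  then show ?thesis by (simp add: line_loss_def premium_def)
qed

lemma S_types: "H.S types B \<omega> = (\<Sum>k=1..d. H.S (line k) B \<omega>)"
  unfolding H.S_def by (rule sum_times_fibres)

lemma total_loss_eq: "aggregate t \<omega> = H.S types (upto_time t) \<omega> - (\<Sum>k=1..d. c k) * premium t \<omega>"
  unfolding total_loss_def line_loss_eq S_types by (simp add: sum_subtractf sum_distrib_right)

lemma total_weight_line:
  assumes k: "k \<in> {1..d}"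
  shows "H.total_weight (line k) (upto_time t) = ell M r \<theta> R \<alpha> a k t"
proof -
  have "0 < \<alpha>" "\<alpha> \<le> \<alpha>'" using alpha alpha' by auto
  then have "(LINT s:upto_time t|renewal_measure M \<theta> k j. exp (s * laplace_exponent M R \<alpha>)) = (\<Sum>i. H.weight (k, j) i (upto_time t))"
    if "j \<in> {1..r}" for j
    unfolding H.weight_def using set_integral_renewal_measure[OF k that phi] by simp
  then have "ell M r \<theta> R \<alpha> a k t = (\<Sum>j=1..r. a k j * (\<Sum>i. H.weight (k, j) i (upto_time t)))"
    unfolding ell_def by (intro sum.cong) auto
  also have "\<dots> = H.total_weight (line k) (upto_time t)"
    unfolding H.total_weight_def sum_singleton_times by simp
  finally show ?thesis by simp
qed

lemma total_weight_types: "H.total_weight types (upto_time t) = (\<Sum>k=1..d. ell M r \<theta> R \<alpha> a k t)"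
proof -
  have "H.total_weight types (upto_time t) = (\<Sum>k=1..d. H.total_weight (line k) (upto_time t))"
    unfolding H.total_weight_def by (rule sum_times_fibres)
  then show ?thesis using total_weight_line by simp
qed

lemma ell_mono:
  assumes k: "k \<in> {1..d}" and "t \<le> u"
  shows "ell M r \<theta> R \<alpha> a k t \<le> ell M r \<theta> R \<alpha> a k u"
proof -
  have sub: "upto_time t \<subseteq> upto_time u" using assms(2) by (auto simp: upto_time_def)
  have w: "H.weight p i (upto_time t) \<le> H.weight p i (upto_time u)" if p: "p \<in> types" for p i
  proof -
    note [measurable] = H.W_rv[OF p, of i] H.\<tau>_rv[OF p, of i]
    have int: "integrable M (\<lambda>\<omega>. (case p of (k, j) \<Rightarrow> \<lambda>i. discount k j (Suc i)) i \<omega> powr \<alpha> * indicator (upto_time t) ((case p of (k, j) \<Rightarrow> \<lambda>i. arrival \<theta> k j (Suc i)) i \<omega>))" for t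
      by (rule Bochner_Integration.integrable_bound[OF H.W_moment_\<alpha>(1)[OF p, of i]]) (auto simp: indicator_def)
    show ?thesis unfolding H.weight_def
      using sub by (intro integral_mono int) (auto simp: indicator_def)
  qed
  have "line k \<subseteq> types" using k by auto
  then show ?thesis
    unfolding total_weight_line[OF k, symmetric] H.total_weight_def
    using H.a_nonneg w by (intro sum_mono mult_left_mono suminf_le H.weight_summable) auto
qed

text \<open>Discount factors are positive. If all weights of a type vanished, then almost surely
  none of its arrivals would fall into the window, and its renewal function at \<open>t\<close>
  would be 0.\<close>

lemma ell_pos:
  assumes k: "k \<in> {1..d}" and t: "t \<in> admissible_times M d r \<theta>"
  shows "0 < ell M r \<theta> R \<alpha> a k t"
proof -
  have ex: "\<exists>i. 0 < H.weight (k, j) i (upto_time t)" if j: "j \<in> {1..r}" for j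
  proof (rule ccontr)
    assume no: "\<not> ?thesis"
    have p: "(k, j) \<in> types" using k j by auto
    note [measurable] = arrival_rv[OF k j] discount_rv[OF k j]
    have ae: "AE \<omega> in M. arrival \<theta> k j (Suc i) \<omega> \<notin> upto_time t" for i
    proof -
      have "H.weight (k, j) i (upto_time t) = 0"
        using no H.weight_bounds(1)[OF p, of "upto_time t" i] by (auto simp: not_less intro: antisym)
      then have "expectation (\<lambda>\<omega>. discount k j (Suc i) \<omega> powr \<alpha> * indicator (upto_time t) (arrival \<theta> k j (Suc i) \<omega>)) = 0"
        by (simp add: H.weight_def)
      moreover have "integrable M (\<lambda>\<omega>. discount k j (Suc i) \<omega> powr \<alpha> * indicator (upto_time t) (arrival \<theta> k j (Suc i) \<omega>))"
        using H.W_moment_\<alpha>(1)[OF p, of i]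
        by (rule Bochner_Integration.integrable_bound) (auto simp: indicator_def)
      ultimately have "AE \<omega> in M. discount k j (Suc i) \<omega> powr \<alpha> * indicator (upto_time t) (arrival \<theta> k j (Suc i) \<omega>) = 0"
        by (subst (asm) integral_nonneg_eq_0_iff_AE) auto
      then show ?thesis by eventually_elim (auto simp: discount_def indicator_def split: if_splits)
    qed
    have "renewal_function M \<theta> k j t = (\<integral>\<^sup>+s. indicator (upto_time t) s \<partial>arrival_measure k j)"
      by (simp add: renewal_function_eq[OF k j])
    also have "\<dots> = (\<Sum>i. \<integral>\<^sup>+\<omega>. indicator (upto_time t) (arrival \<theta> k j (Suc i) \<omega>) \<partial>M)"
      by (rule nn_integral_arrival_measure[OF k j]) measurable
    also have "\<dots> = (\<Sum>i. \<integral>\<^sup>+\<omega>. 0 \<partial>M)"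
    proof (intro suminf_cong nn_integral_cong_AE)
      fix i
      show "AE \<omega> in M. indicator (upto_time t) (arrival \<theta> k j (Suc i) \<omega>) = (0 :: ennreal)"
        using ae[of i] by eventually_elim simp
    qed
    finally have "renewal_function M \<theta> k j t = 0" by simp
    moreover have "0 < renewal_function M \<theta> k j t" using t k j unfolding admissible_times_def by blast
    ultimately show False by simp
  qed
  have "0 < (\<Sum>i. H.weight (k, j) i (upto_time t))" if j: "j \<in> {1..r}" for j
  proof -
    have p: "(k, j) \<in> types" using k j by auto
    obtain i where "0 < H.weight (k, j) i (upto_time t)" using ex[OF j] by blast
    then show ?thesis
      using H.weight_bounds(1)[OF p] H.weight_summable[OF p] by (intro suminf_pos2[of _ i]) auto
  qed
  then have "0 < (\<Sum>j=1..r. a k j * (\<Sum>i. H.weight (k, j) i (upto_time t)))"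
    using r_pos a_pos k by (intro sum_pos) auto
  also have "\<dots> = H.total_weight (line k) (upto_time t)"
    unfolding H.total_weight_def sum_singleton_times by simp
  finally show ?thesis unfolding total_weight_line[OF k] .
qed

lemma premium_rv: "premium t \<in> borel_measurable M"
proof -
  have eq: "premium t = (\<lambda>\<omega>. LINT s|lborel. indicator (upto_time t) s * exp (- (\<lambda>(s, \<omega>). R (max 0 s) \<omega>) (s, \<omega>)))"
    unfolding premium_def set_lebesgue_integral_def
    by (intro ext Bochner_Integration.integral_cong) (auto simp: indicator_def upto_time_def)
  note [measurable] = returns_joint_rv
  show ?thesis unfolding eq by (rule lborel.borel_measurable_lebesgue_integral) measurable
qed

lemma S_rv:
  assumes "K \<subseteq> types" and [measurable]: "B \<in> sets borel"
  shows "H.S K B \<in> borel_measurable M"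
  unfolding H.S_def[abs_def]
proof (intro borel_measurable_sum borel_measurable_suminf)
  fix p i assume p: "p \<in> K"
  then have p: "p \<in> types" using assms(1) by auto
  note [measurable] = H.X_rv[OF p, of i] H.W_rv[OF p, of i] H.\<tau>_rv[OF p, of i]
  show "(\<lambda>\<omega>. (case p of (k, j) \<Rightarrow> \<lambda>i. X k j (Suc i)) i \<omega> * (case p of (k, j) \<Rightarrow> \<lambda>i. discount k j (Suc i)) i \<omega> *
      indicator B ((case p of (k, j) \<Rightarrow> \<lambda>i. arrival \<theta> k j (Suc i)) i \<omega>)) \<in> borel_measurable M"
    by measurable
qed

lemma loss_rv: "k \<in> {1..d} \<Longrightarrow> loss k t \<in> borel_measurable M"
proof -
  assume "k \<in> {1..d}"
  then have "line k \<subseteq> types" by auto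
  note [measurable] = S_rv[OF this upto_time_borel] premium_rv
  show ?thesis unfolding line_loss_eq[abs_def] by measurable
qed

lemma total_rv: "aggregate t \<in> borel_measurable M"
proof -
  note [measurable] = S_rv[OF order_refl upto_time_borel] premium_rv
  show ?thesis unfolding total_loss_eq[abs_def] by measurable
qed

end

section \<open>Asymptotics of the risk measures\<close>

context regular_risk_model
begin

text \<open>One \<open>Q\<close> serves every line, the total and all horizons: each premium rate is
  at most the sum of the rates, and one variable dominates the premium integrals of all
  horizons.\<close>

lemma losses_bounded:
  obtains Q where "Q \<in> borel_measurable M" "\<And>\<omega>. 0 \<le> Q \<omega>" "integrable M (\<lambda>\<omega>. Q \<omega> powr \<alpha>')"
    "((\<lambda>x. prob {\<omega> \<in> space M. x < Q \<omega>} / tail F x) \<longlongrightarrow> 0) at_top"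
    "\<And>k t. k \<in> {1..d} \<Longrightarrow> AE \<omega> in M. H.S (line k) (upto_time t) \<omega> - Q \<omega> \<le> loss k t \<omega> \<and> loss k t \<omega> \<le> H.S (line k) (upto_time t) \<omega>"
    "\<And>t. AE \<omega> in M. H.S types (upto_time t) \<omega> - Q \<omega> \<le> aggregate t \<omega> \<and> aggregate t \<omega> \<le> H.S types (upto_time t) \<omega>"
proof -
  obtain P where P: "P \<in> borel_measurable M" "\<And>\<omega>. 0 \<le> P \<omega>" "integrable M (\<lambda>\<omega>. P \<omega> powr \<alpha>')"
    and P_ae: "AE \<omega> in M. \<forall>t. 0 \<le> premium t \<omega> \<and> premium t \<omega> \<le> P \<omega>"
    using premium_dominated[OF _ phi_finite phi_neg] alpha alpha' unfolding premium_def by auto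
  define C where "C = (\<Sum>k=1..d. c k)"
  have cC: "0 \<le> c k" "c k \<le> C" if "k \<in> {1..d}" for k
    using that premium_pos member_le_sum[of k "{1..d}" c] unfolding C_def by (auto intro: less_imp_le)
  have C: "0 \<le> C" unfolding C_def using premium_pos by (intro sum_nonneg) (auto intro: less_imp_le)
  define Q where "Q \<omega> = C * P \<omega>" for \<omega>
  have Q: "Q \<in> borel_measurable M" "\<And>\<omega>. 0 \<le> Q \<omega>" using P C by (auto simp: Q_def[abs_def])
  have Qi: "integrable M (\<lambda>\<omega>. Q \<omega> powr \<alpha>')" using P C by (simp add: Q_def powr_mult)
  have small: "0 \<le> c' * premium t \<omega> \<and> c' * premium t \<omega> \<le> Q \<omega>"
    if "0 \<le> c'" "c' \<le> C" "0 \<le> premium t \<omega>" "premium t \<omega> \<le> P \<omega>" for c' t \<omega>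
    using that P(2)[of \<omega>] by (auto simp: Q_def intro: mult_mono)
  show ?thesis
  proof (rule that[OF Q Qi moment_tail_negligible[OF F.rv_tail_axioms alpha' Q Qi]])
    show "AE \<omega> in M. H.S (line k) (upto_time t) \<omega> - Q \<omega> \<le> loss k t \<omega> \<and> loss k t \<omega> \<le> H.S (line k) (upto_time t) \<omega>"
      if "k \<in> {1..d}" for k t
      using P_ae unfolding line_loss_eq by eventually_elim (use small[OF cC[OF that]] in force)
    show "AE \<omega> in M. H.S types (upto_time t) \<omega> - Q \<omega> \<le> aggregate t \<omega> \<and> aggregate t \<omega> \<le> H.S types (upto_time t) \<omega>" for t
      using P_ae unfolding total_loss_eq C_def[symmetric] by eventually_elim (use small[OF C order_refl] in force)
  qed
qed

abbreviation "risk_losses \<equiv> heavy_tailed_losses M (tail F) \<alpha> types (\<lambda>(k, j) i. X k j (Suc i))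
    (\<lambda>(k, j) i. discount k j (Suc i)) (\<lambda>(k, j) i. arrival \<theta> k j (Suc i)) (\<lambda>(k, j). tail (Fc k j))
    (\<lambda>(k, j). a k j) \<gamma> \<beta> decay 1"

context
  fixes k :: nat and t :: "nat \<Rightarrow> ennreal" and q :: "nat \<Rightarrow> real" and lam L :: real
  assumes k: "k \<in> {1..d}"
    and q: "filterlim q (at_left 1) sequentially"
    and lam: "(\<lambda>n. ell M r \<theta> R \<alpha> a k (t n)) \<longlonglongrightarrow> lam"
    and L: "(\<lambda>n. \<Sum>i=1..d. ell M r \<theta> R \<alpha> a i (t n)) \<longlonglongrightarrow> L"
    and lam_L: "0 < lam" "lam \<le> L"
begin

text \<open>The quantiles of line and total grow like \<open>lam powr (1 / \<alpha>)\<close> and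
  \<open>L powr (1 / \<alpha>)\<close> times that of \<open>F\<close>. With the quantile of the
  total as the level, both risk measures become expectations covered by \<open>excess_limit\<close>
  and \<open>mean_limit\<close>, divided by a probability of about \<open>L\<close> times the
  tail.\<close>

lemma risk_measure_limits:
  shows "(\<lambda>n. SES M (q n) (loss k (t n)) (aggregate (t n)) / gen_inverse F (q n))
      \<longlonglongrightarrow> lam / L * (L powr (1 / \<alpha>) - lam powr (1 / \<alpha>) + L powr (1 / \<alpha>) / (\<alpha> - 1))" (is ?SES)
    and "(\<lambda>n. MES M (q n) (loss k (t n)) (aggregate (t n)) / gen_inverse F (q n))
      \<longlonglongrightarrow> \<alpha> / (\<alpha> - 1) * (lam / L powr (1 - 1 / \<alpha>))" (is ?MES)
proof -
  obtain Q where Q: "Q \<in> borel_measurable M" "\<And>\<omega>. 0 \<le> Q \<omega>" "integrable M (\<lambda>\<omega>. Q \<omega> powr \<alpha>')"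
    "((\<lambda>x. prob {\<omega> \<in> space M. x < Q \<omega>} / tail F x) \<longlongrightarrow> 0) at_top"
    "\<And>k t. k \<in> {1..d} \<Longrightarrow> AE \<omega> in M. H.S (line k) (upto_time t) \<omega> - Q \<omega> \<le> loss k t \<omega> \<and> loss k t \<omega> \<le> H.S (line k) (upto_time t) \<omega>"
    "\<And>t. AE \<omega> in M. H.S types (upto_time t) \<omega> - Q \<omega> \<le> aggregate t \<omega> \<and> aggregate t \<omega> \<le> H.S types (upto_time t) \<omega>"
    using losses_bounded by blast
  have lb: "AE \<omega> in M. H.S (line k) (upto_time u) \<omega> - Q \<omega> \<le> loss k u \<omega>"
    "AE \<omega> in M. loss k u \<omega> \<le> H.S (line k) (upto_time u) \<omega>"
    "AE \<omega> in M. H.S types (upto_time u) \<omega> - Q \<omega> \<le> aggregate u \<omega>"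
    "AE \<omega> in M. aggregate u \<omega> \<le> H.S types (upto_time u) \<omega>" for u
    using Q(5)[OF k, of u] Q(6)[of u] by (auto elim: eventually_mono)
  have lineA: "line k \<subseteq> types" using k by auto
  have L0: "0 < L" using lam_L by simp
  have lamw: "(\<lambda>n. H.total_weight (line k) (upto_time (t n))) \<longlonglongrightarrow> lam"
    using lam by (simp only: total_weight_line[OF k])
  have Lw: "(\<lambda>n. H.total_weight types (upto_time (t n))) \<longlonglongrightarrow> L"
    using L by (simp only: total_weight_types)
  \<comment> \<open>The quantiles call for the tail of each loss by itself, the expectations for the
    line against the total.\<close>
  have mixed: "risk_losses (line k) types (\<lambda>n. upto_time (t n)) x Q (\<lambda>n. loss k (t n)) (\<lambda>n. aggregate (t n)) lam"
    and single: "risk_losses (line k) (line k) (\<lambda>n. upto_time (t n)) x Q (\<lambda>n. loss k (t n)) (\<lambda>n. loss k (t n)) lam"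
    and whole: "risk_losses types types (\<lambda>n. upto_time (t n)) x Q (\<lambda>n. aggregate (t n)) (\<lambda>n. aggregate (t n)) L"
    if "filterlim x at_top sequentially" for x
    by (intro heavy_tailed_losses.intro H.heavy_tailed_sums_axioms heavy_tailed_losses_axioms.intro
        lineA order_refl upto_time_borel that loss_rv[OF k] total_rv Q(1,4) lb lamw Lw)+
  have tail_line: "(\<lambda>n. tail (df M (loss k (t n))) (x n) / tail F (x n)) \<longlonglongrightarrow> lam"
    and tail_total: "(\<lambda>n. tail (df M (aggregate (t n))) (x n) / tail F (x n)) \<longlonglongrightarrow> L"
    if "filterlim x at_top sequentially" for x
    using heavy_tailed_losses.joint_tail[OF single[OF that] zero_less_one]
      heavy_tailed_losses.joint_tail[OF whole[OF that] zero_less_one]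
    by (simp_all add: tail_df loss_rv[OF k] total_rv)
  define g where "g n = gen_inverse F (q n)" for n
  define vk where "vk n = VaR M (q n) (loss k (t n))" for n
  define vD where "vD n = VaR M (q n) (aggregate (t n))" for n
  define E where "E n = {\<omega> \<in> space M. vD n < aggregate (t n) \<omega>}" for n
  have g: "filterlim g at_top sequentially"
    unfolding g_def by (rule filterlim_compose[OF F.quantile_at_top q])
  have vk: "(\<lambda>n. vk n / g n) \<longlonglongrightarrow> lam powr (1 / \<alpha>)"
    unfolding vk_def g_def VaR_def
    by (rule F.quantile_ratio_tendsto[OF distribution_function_df q tail_line lam_L(1)]) (rule loss_rv[OF k])
  have vD: "(\<lambda>n. vD n / g n) \<longlonglongrightarrow> L powr (1 / \<alpha>)"
    unfolding vD_def g_def VaR_def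
    by (rule F.quantile_ratio_tendsto[OF distribution_function_df q tail_total L0]) (rule total_rv)
  have g_ev: "\<forall>\<^sub>F n in sequentially. 0 < g n" using g by (simp add: filterlim_at_top_dense)
  have "filterlim (\<lambda>n. vD n / g n * g n) at_top sequentially"
    by (rule filterlim_tendsto_pos_mult_at_top[OF vD _ g]) (use L0 in simp)
  moreover have "\<forall>\<^sub>F n in sequentially. vD n / g n * g n = vD n"
    using g_ev by eventually_elim simp
  ultimately have vD_top: "filterlim vD at_top sequentially" by (simp cong: filterlim_cong)
  have vD_ev: "\<forall>\<^sub>F n in sequentially. 0 < vD n" using vD_top by (simp add: filterlim_at_top_dense)
  have vk_ev: "\<forall>\<^sub>F n in sequentially. 0 < vk n / g n"
    using order_tendstoD(1)[OF vk] lam_L by simp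
  interpret mix: heavy_tailed_losses M "tail F" \<alpha> types "\<lambda>(k, j) i. X k j (Suc i)"
    "\<lambda>(k, j) i. discount k j (Suc i)" "\<lambda>(k, j) i. arrival \<theta> k j (Suc i)" "\<lambda>(k, j). tail (Fc k j)"
    "\<lambda>(k, j). a k j" \<gamma> \<beta> decay 1 "line k" types "\<lambda>n. upto_time (t n)" vD Q
    "\<lambda>n. loss k (t n)" "\<lambda>n. aggregate (t n)" lam
    by (rule mixed[OF vD_top])
  have PE: "(\<lambda>n. prob (E n) / tail F (vD n)) \<longlonglongrightarrow> L"
    using tail_total[OF vD_top] by (simp add: tail_df total_rv E_def)
  let ?a = "L powr (1 / \<alpha>)" and ?b = "lam powr (1 / \<alpha>)"
  have ab: "0 < ?a" "0 < ?b" "?b \<le> ?a" using lam_L alpha by (auto intro!: powr_mono2)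
  \<comment> \<open>The quantile of the line in units of that of the total; the limit is at most 1
    as \<open>lam \<le> L\<close>.\<close>
  have y: "(\<lambda>n. (vk n / g n) / (vD n / g n)) \<longlonglongrightarrow> ?b / ?a"
    using ab by (intro tendsto_intros vk vD) auto
  have y_ev: "\<forall>\<^sub>F n in sequentially. (vk n / g n) / (vD n / g n) * vD n = vk n"
    using vD_ev g_ev by eventually_elim simp
  have "\<forall>\<^sub>F n in sequentially. 0 \<le> (vk n / g n) / (vD n / g n)"
    using vk_ev vD_ev g_ev
  proof eventually_elim
    case (elim n)
    show ?case by (rule divide_nonneg_nonneg[OF less_imp_le[OF elim(1)]]) (use elim in simp)
  qed
  from mix.excess_limit(1)[OF y this]
  have "(\<lambda>n. expectation (\<lambda>\<omega>. max (loss k (t n) \<omega> - (vk n / g n) / (vD n / g n) * vD n) 0 * indicator (E n) \<omega>) / (vD n * tail F (vD n)))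
     \<longlonglongrightarrow> lam * (1 - ?b / ?a + 1 / (\<alpha> - 1))"
    using ab unfolding E_def by simp
  moreover have "\<forall>\<^sub>F n in sequentially. expectation (\<lambda>\<omega>. max (loss k (t n) \<omega> - (vk n / g n) / (vD n / g n) * vD n) 0 * indicator (E n) \<omega>) / (vD n * tail F (vD n))
     = expectation (\<lambda>\<omega>. max (loss k (t n) \<omega> - vk n) 0 * indicator (E n) \<omega>) / (vD n * tail F (vD n))"
    using y_ev by eventually_elim (simp only:)
  ultimately have ex: "(\<lambda>n. expectation (\<lambda>\<omega>. max (loss k (t n) \<omega> - vk n) 0 * indicator (E n) \<omega>) / (vD n * tail F (vD n)))
     \<longlonglongrightarrow> lam * (1 - ?b / ?a + 1 / (\<alpha> - 1))"
    by (rule Lim_transform_eventually)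
  have mean: "(\<lambda>n. expectation (\<lambda>\<omega>. loss k (t n) \<omega> * indicator (E n) \<omega>) / (vD n * tail F (vD n))) \<longlonglongrightarrow> lam * (\<alpha> / (\<alpha> - 1))"
    unfolding E_def by (rule mix.mean_limit[OF Q(2) alpha' Q(3)])
  \<comment> \<open>The tail of \<open>F\<close> at the random-looking level \<open>vD n\<close>
    cancels between the expectation and the probability, leaving only the quantile ratio.\<close>
  have final: "(\<lambda>n. e n / prob (E n) / g n) \<longlonglongrightarrow> l' / L * ?a"
    if "(\<lambda>n. e n / (vD n * tail F (vD n))) \<longlonglongrightarrow> l'" for e l'
  proof -
    have "(\<lambda>n. e n / (vD n * tail F (vD n)) / (prob (E n) / tail F (vD n)) * (vD n / g n)) \<longlonglongrightarrow> l' / L * ?a"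
      using L0 by (intro tendsto_intros that PE vD) auto
    moreover have "\<forall>\<^sub>F n in sequentially. e n / (vD n * tail F (vD n)) / (prob (E n) / tail F (vD n)) * (vD n / g n) = e n / prob (E n) / g n"
      using vD_ev by eventually_elim (simp add: F.f_pos[THEN less_imp_neq, THEN not_sym])
    ultimately show ?thesis by (rule Lim_transform_eventually)
  qed
  have SES: "SES M (q n) (loss k (t n)) (aggregate (t n)) = expectation (\<lambda>\<omega>. max (loss k (t n) \<omega> - vk n) 0 * indicator (E n) \<omega>) / prob (E n)" for n
    by (simp add: SES_def cond_expectation_event_def set_lebesgue_integral_def E_def vk_def vD_def mult.commute)
  have MES: "MES M (q n) (loss k (t n)) (aggregate (t n)) = expectation (\<lambda>\<omega>. loss k (t n) \<omega> * indicator (E n) \<omega>) / prob (E n)" for n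
    by (simp add: MES_def cond_expectation_event_def set_lebesgue_integral_def E_def vD_def mult.commute)
  have "lam * (1 - ?b / ?a + 1 / (\<alpha> - 1)) / L * ?a = lam / L * (?a * (1 - ?b / ?a + 1 / (\<alpha> - 1)))" by simp
  also have "?a * (1 - ?b / ?a + 1 / (\<alpha> - 1)) = ?a - ?b + ?a / (\<alpha> - 1)"
    using ab by (simp add: distrib_left right_diff_distrib)
  finally have e: "lam * (1 - ?b / ?a + 1 / (\<alpha> - 1)) / L * ?a = lam / L * (?a - ?b + ?a / (\<alpha> - 1))" .
  show ?SES using final[OF ex] unfolding SES g_def e .
  have "L powr (1 - 1 / \<alpha>) = L / ?a" using L0 by (simp add: powr_diff)
  then show ?MES using final[OF mean] unfolding MES g_def by (simp add: mult_ac)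
qed

end

text \<open>Monotonicity in \<open>t\<close> confines \<open>(l k t, L t)\<close> to a compact
  rectangle with corners at \<open>T\<close> and \<open>top\<close>. Since \<open>T\<close> is
  admissible, the lower corner is positive, so limit points are positive and the quotients by the
  claimed expressions converge to 1.\<close>

lemma uniform_risk_measures:
  assumes k: "k \<in> {1..d}" and T: "T \<in> admissible_times M d r \<theta>"
  defines "l \<equiv> ell M r \<theta> R \<alpha> a" and "L \<equiv> \<lambda>t. \<Sum>i=1..d. ell M r \<theta> R \<alpha> a i t"
  shows "uniform_limit (admissible_times M d r \<theta> \<inter> {T..})
      (\<lambda>q t. SES M q (loss k t) (aggregate t) /
        (l k t / L t * (L t powr (1 / \<alpha>) - l k t powr (1 / \<alpha>) + L t powr (1 / \<alpha>) / (\<alpha> - 1)) * gen_inverse F q))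
      (\<lambda>_. 1) (at_left 1)" (is "uniform_limit ?S ?f1 _ _")
    and "uniform_limit (admissible_times M d r \<theta> \<inter> {T..})
      (\<lambda>q t. MES M q (loss k t) (aggregate t) /
        (\<alpha> / (\<alpha> - 1) * (l k t / L t powr (1 - 1 / \<alpha>)) * gen_inverse F q))
      (\<lambda>_. 1) (at_left 1)" (is "uniform_limit _ ?f2 _ _")
proof -
  have l_bounds: "l i T \<le> l i u" "l i u \<le> l i top" if "i \<in> {1..d}" "u \<in> ?S" for i u
    unfolding l_def using ell_mono[OF that(1)] that(2) by auto
  have L_bounds: "L T \<le> L u" "L u \<le> L top" if "u \<in> ?S" for u
    using l_bounds[OF _ that] unfolding L_def l_def by (auto intro: sum_mono)
  have lT: "0 < l k T" unfolding l_def by (rule ell_pos[OF k T])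
  have lL: "l k u \<le> L u" if "u \<in> ?S" for u
    unfolding l_def L_def
    by (rule member_le_sum[of k "{1..d}" "\<lambda>i. ell M r \<theta> R \<alpha> a i u"]) (use k ell_pos that in \<open>auto intro: less_imp_le\<close>)
  have both: "\<exists>\<sigma>. strict_mono \<sigma> \<and> (\<lambda>n. ?f1 (q (\<sigma> n)) (t (\<sigma> n))) \<longlonglongrightarrow> 1 \<and> (\<lambda>n. ?f2 (q (\<sigma> n)) (t (\<sigma> n))) \<longlonglongrightarrow> 1"
    if q: "filterlim q (at_left 1) sequentially" and t: "\<And>n::nat. t n \<in> ?S" for q t
  proof -
    have "seq_compact ({l k T..l k top} \<times> {L T..L top})"
      by (intro compact_imp_seq_compact compact_Times compact_Icc)
    moreover have "\<forall>n. (l k (t n), L (t n)) \<in> {l k T..l k top} \<times> {L T..L top}"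
      using l_bounds[OF k t] L_bounds[OF t] by simp
    ultimately obtain z \<sigma> where z: "z \<in> {l k T..l k top} \<times> {L T..L top}" "strict_mono \<sigma>" "((\<lambda>n. (l k (t n), L (t n))) \<circ> \<sigma>) \<longlonglongrightarrow> z"
      by (rule seq_compactE)
    obtain lam L' where z': "z = (lam, L')" by (cases z)
    have lim: "(\<lambda>n. l k (t (\<sigma> n))) \<longlonglongrightarrow> lam" "(\<lambda>n. L (t (\<sigma> n))) \<longlonglongrightarrow> L'"
      using tendsto_fst[OF z(3)] tendsto_snd[OF z(3)] by (simp_all add: z' comp_def)
    have lam: "0 < lam" using z(1) lT by (auto simp: z')
    have lamL: "lam \<le> L'" by (rule LIMSEQ_le[OF lim]) (use lL[OF t] in auto)
    have qs: "filterlim (\<lambda>n. q (\<sigma> n)) (at_left 1) sequentially"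
      using filterlim_compose[OF q filterlim_subseq[OF z(2)]] .
    note limits = risk_measure_limits[OF k qs lim[unfolded l_def L_def] lam lamL]
    have ab: "0 < L' powr (1 / \<alpha>)" "lam powr (1 / \<alpha>) \<le> L' powr (1 / \<alpha>)"
      using lam lamL alpha by (auto intro!: powr_mono2)
    \<comment> \<open>The difference of the powers vanishes if \<open>lam = L'\<close>; this term
      keeps the bracket positive.\<close>
    have "0 < L' powr (1 / \<alpha>) / (\<alpha> - 1)" using ab alpha by simp
    then have den: "lam / L' * (L' powr (1 / \<alpha>) - lam powr (1 / \<alpha>) + L' powr (1 / \<alpha>) / (\<alpha> - 1)) \<noteq> 0"
      using ab lam lamL by auto
    have den2: "\<alpha> / (\<alpha> - 1) * (lam / L' powr (1 - 1 / \<alpha>)) \<noteq> 0" using alpha lam lamL by auto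
    have "(\<lambda>n. SES M (q (\<sigma> n)) (loss k (t (\<sigma> n))) (aggregate (t (\<sigma> n))) / gen_inverse F (q (\<sigma> n)) /
        (l k (t (\<sigma> n)) / L (t (\<sigma> n)) * (L (t (\<sigma> n)) powr (1 / \<alpha>) - l k (t (\<sigma> n)) powr (1 / \<alpha>) + L (t (\<sigma> n)) powr (1 / \<alpha>) / (\<alpha> - 1))))
      \<longlonglongrightarrow> lam / L' * (L' powr (1 / \<alpha>) - lam powr (1 / \<alpha>) + L' powr (1 / \<alpha>) / (\<alpha> - 1)) /
        (lam / L' * (L' powr (1 / \<alpha>) - lam powr (1 / \<alpha>) + L' powr (1 / \<alpha>) / (\<alpha> - 1)))"
      using lam lamL alpha by (intro tendsto_divide limits(1) den tendsto_intros lim) auto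
    then have 1: "(\<lambda>n. ?f1 (q (\<sigma> n)) (t (\<sigma> n))) \<longlonglongrightarrow> 1" unfolding divide_self[OF den] by (simp add: divide_divide_eq_left mult.commute)
    have "(\<lambda>n. MES M (q (\<sigma> n)) (loss k (t (\<sigma> n))) (aggregate (t (\<sigma> n))) / gen_inverse F (q (\<sigma> n)) /
        (\<alpha> / (\<alpha> - 1) * (l k (t (\<sigma> n)) / L (t (\<sigma> n)) powr (1 - 1 / \<alpha>))))
      \<longlonglongrightarrow> \<alpha> / (\<alpha> - 1) * (lam / L' powr (1 - 1 / \<alpha>)) / (\<alpha> / (\<alpha> - 1) * (lam / L' powr (1 - 1 / \<alpha>)))"
      using lam lamL alpha by (intro tendsto_divide[OF limits(2) _ den2] tendsto_intros lim) auto
    then have 2: "(\<lambda>n. ?f2 (q (\<sigma> n)) (t (\<sigma> n))) \<longlonglongrightarrow> 1" unfolding divide_self[OF den2] by (simp add: divide_divide_eq_left mult.commute)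
    show ?thesis using z(2) 1 2 by blast
  qed
  show "uniform_limit ?S ?f1 (\<lambda>_. 1) (at_left 1)"
    by (rule uniform_limit_seqI) (use both in blast)
  show "uniform_limit ?S ?f2 (\<lambda>_. 1) (at_left 1)"
    by (rule uniform_limit_seqI) (use both in blast)
qed

end

theorem theorem3p2:
  fixes M :: "'a measure" and d r :: nat
    and X \<theta> :: "nat \<Rightarrow> nat \<Rightarrow> nat \<Rightarrow> 'a \<Rightarrow> real"
    and Fc :: "nat \<Rightarrow> nat \<Rightarrow> real \<Rightarrow> real"
    and R :: "real \<Rightarrow> 'a \<Rightarrow> real"
    and c :: "nat \<Rightarrow> real"
    and F :: "real \<Rightarrow> real"
    and a :: "nat \<Rightarrow> nat \<Rightarrow> real"
    and \<alpha> \<alpha>' :: real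
    and Z :: "nat \<Rightarrow> ennreal \<Rightarrow> 'a \<Rightarrow> real" and D :: "ennreal \<Rightarrow> 'a \<Rightarrow> real"
    and l :: "nat \<Rightarrow> ennreal \<Rightarrow> real" and L :: "ennreal \<Rightarrow> real" and \<Lambda> :: "ennreal set"
  defines "Z \<equiv> line_loss r X \<theta> R c"
    and "D \<equiv> total_loss d r X \<theta> R c"
    and "l \<equiv> ell M r \<theta> R \<alpha> a"
    and "L \<equiv> \<lambda>t. \<Sum>i=1..d. l i t"
    and "\<Lambda> \<equiv> admissible_times M d r \<theta>"
  assumes model: "renewal_risk_model M d r X Fc \<theta> R c"
    and alpha: "\<alpha> > 1"
    and rv: "\<And>k j. \<lbrakk>k \<in> {1..d}; j \<in> {1..r}\<rbrakk> \<Longrightarrow> regularly_varying (- \<alpha>) (tail (Fc k j))"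
    and F: "distribution_function F"
    and a_pos: "\<And>k j. \<lbrakk>k \<in> {1..d}; j \<in> {1..r}\<rbrakk> \<Longrightarrow> 0 < a k j"
    and tail_equiv: "\<And>k j. \<lbrakk>k \<in> {1..d}; j \<in> {1..r}\<rbrakk> \<Longrightarrow>
           tail (Fc k j) \<sim>[at_top] (\<lambda>x. a k j * tail F x)"
    and alpha': "\<alpha>' > \<alpha>"
    and phi_finite: "integrable M (\<lambda>\<omega>. exp (- \<alpha>' * R 1 \<omega>))"
    and phi_neg: "laplace_exponent M R \<alpha>' < 0"
  shows "\<forall>k\<in>{1..d}. \<forall>T\<in>\<Lambda>.
    uniform_limit (\<Lambda> \<inter> {T..})
      (\<lambda>q t. SES M q (Z k t) (D t) /
        (l k t / L t
          * (L t powr (1 / \<alpha>) - l k t powr (1 / \<alpha>) + L t powr (1 / \<alpha>) / (\<alpha> - 1))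
          * gen_inverse F q))
      (\<lambda>_. 1) (at_left 1) \<and>
    uniform_limit (\<Lambda> \<inter> {T..})
      (\<lambda>q t. MES M q (Z k t) (D t) /
        (\<alpha> / (\<alpha> - 1) * (l k t / L t powr (1 - 1 / \<alpha>)) * gen_inverse F q))
      (\<lambda>_. 1) (at_left 1)"
proof -
  interpret regular_risk_model M d r X Fc \<theta> R c F a \<alpha> \<alpha>'
    using model alpha rv F a_pos tail_equiv alpha' phi_finite phi_neg
    by (intro regular_risk_model.intro regular_risk_model_axioms.intro)
  show ?thesis
    unfolding Z_def D_def l_def L_def \<Lambda>_def using uniform_risk_measures by blast
qed

end
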